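(* Let $\Lambda=\{(D,F)\in\mathbb{R}^2 : F>1,\ D<0,\ D+F>0\}$ and, for $\mu=(D,F)\in\Lambda$, let $X_\mu$ be the planar vector field associated with the dehomogenized Loud system $$\dot x=-y+xy,\qquad \dot y=x+Dx^2+Fy^2,$$ which has a center at the origin. Consider the period function of this center and let $\Pi_\mu$ be the outer boundary of its period annulus. If $\hat\mu=(\hat D,2)$ with $\hat D\in(-2,0)\setminus\{-\tfrac12\}$, then $\mathrm{Crit}\bigl((\Pi_{\hat\mu},X_{\hat\mu}),X_\mu\bigr)=1$.
   Context: The period annulus $\mathscr P_\mu$ of the center at the origin of $X_\mu$ is the largest punctured neighborhood of the origin entirely foliated by periodic orbits of $X_\mu$ surrounding it. After embedding $\mathscr P_\mu$ into $\mathbb{RP}^2$, the outer boundary is $\Pi_\mu:=\partial\mathscr P_\mu\setminus\{(0,0)\}$, with the boundary taken in $\mathbb{RP}^2$. The period function assigns to each periodic orbit in $\mathscr P_\mu$ its minimal period; a critical periodic orbit is a periodic orbit in $\mathscr P_\mu$ at which the derivative of the period function (with respect to an analytic parametrization of the orbits of the annulus) vanishes. Criticality. Let $\{X_\mu\}_{\mu\in\Lambda}$ be a continuous family of planar analytic vector fields with a center and fix $\hat\mu\in\Lambda$. Let $d_H$ be the Hausdorff distance between compact subsets of $\mathbb{RP}^2$, and suppose that the outer boundary varies continuously at $\hat\mu$, i.e. for every $\varepsilon>0$ there is $\delta>0$ with $d_H(\Pi_\mu,\Pi_{\hat\mu})\le\varepsilon$ whenever $\|\mu-\hat\mu\|\le\delta$.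 Set $$N(\delta,\varepsilon):=\sup\{\#\text{ critical periodic orbits }\gamma\text{ of }X_\mu\text{ in }\mathscr P_\mu\text{ with }d_H(\gamma,\Pi_{\hat\mu})\le\varepsilon\text{ and }\|\mu-\hat\mu\|\le\delta\}.$$ Then $\mathrm{Crit}\bigl((\Pi_{\hat\mu},X_{\hat\mu}),X_\mu\bigr):=\inf_{\delta,\varepsilon}N(\delta,\varepsilon)$. *)

theory Defs
  imports "HOL-Analysis.Analysis" "HOL-Library.Extended_Nat"
begin

section \<open>The real projective plane\<close>

typedef rp2 = "{L :: (real^3) set. \<exists>v. v \<noteq> 0 \<and> L = span {v}}"
proof -
  have "axis 1 1 \<noteq> (0 :: real^3)" by (simp add: axis_eq_0_iff)
  thus ?thesis by blast
qed

lemma rp2_sphere_section: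
  obtains u :: "real^3" where "norm u = 1" "Rep_rp2 p \<inter> sphere 0 1 = {u, -u}"
proof -
  obtain v :: "real^3" where v: "v \<noteq> 0" "Rep_rp2 p = span {v}"
    using Rep_rp2[of p] by auto
  define u where "u = v /\<^sub>R norm v"
  have u: "norm u = 1" using v by (simp add: u_def)
  have "span {v} \<inter> sphere 0 1 = {u, -u}"
  proof (intro set_eqI iffI)
    fix x assume x: "x \<in> span {v} \<inter> sphere 0 1"
    then obtain k where k: "x = k *\<^sub>R v" by (auto simp: span_singleton)
    with x have "\<bar>k\<bar> * norm v = 1" by simp
    hence "\<bar>k\<bar> = inverse (norm v)" using v by (simp add: field_simps)
    hence "k = inverse (norm v) \<or> k = - inverse (norm v)" by linarith
    thus "x \<in> {u, -u}" unfolding k u_def by auto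
  next
    fix x assume "x \<in> {u, -u}"
    thus "x \<in> span {v} \<inter> sphere 0 1"
      using u by (auto simp: u_def span_neg span_scale span_base)
  qed
  with u v show ?thesis by (intro that[of u]) auto
qed

lemma setdist_antipodal:
  fixes u v :: "'a::real_normed_vector"
  shows "setdist {u, -u} {v, -v} = min (norm (u - v)) (norm (u + v))"
proof -
  have "norm (- u - v) = norm (u + v)" "norm (v - u) = norm (u - v)"
    using norm_minus_cancel[of "u + v"] by (simp_all add: norm_minus_commute)
  moreover have "infdist w {v, -v} = min (dist w v) (dist w (-v))" for w
    by (simp add: infdist_def cInf_eq_Min min_def)
  ultimately show ?thesis
    by (simp add: setdist_eq_infdist cInf_eq_Min dist_norm norm_minus_commute)
qed

text \<open>
  The distance below is the quotient of the chordal distance of the unit sphere by the antipodal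
  map.  All metrics inducing the topology of the compact space \<^typ>\<open>rp2\<close> are uniformly
  equivalent, so neither the continuity of the outer boundary nor the criticality depends
  on this choice.
\<close>

instantiation rp2 :: metric_space
begin

definition dist_rp2 :: "rp2 \<Rightarrow> rp2 \<Rightarrow> real" where
  "dist_rp2 p q = setdist (Rep_rp2 p \<inter> sphere 0 1) (Rep_rp2 q \<inter> sphere 0 1)"

definition uniformity_rp2 :: "(rp2 \<times> rp2) filter" where
  "uniformity_rp2 = (INF e\<in>{0<..}. principal {(x, y). dist x y < e})"

definition open_rp2 :: "rp2 set \<Rightarrow> bool" where
  "open_rp2 U = (\<forall>x\<in>U. \<forall>\<^sub>F (x', y) in uniformity. x' = x \<longrightarrow> y \<in> U)"

instance
proof
  fix p q r :: rp2
  obtain u where u: "norm u = 1" "Rep_rp2 p \<inter> sphere 0 1 = {u, -u}"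
    by (rule rp2_sphere_section)
  obtain v where v: "norm v = 1" "Rep_rp2 q \<inter> sphere 0 1 = {v, -v}"
    by (rule rp2_sphere_section)
  obtain w where w: "norm w = 1" "Rep_rp2 r \<inter> sphere 0 1 = {w, -w}"
    by (rule rp2_sphere_section)
  show "dist p q = 0 \<longleftrightarrow> p = q"
  proof
    assume "dist p q = 0"
    hence "min (norm (u - v)) (norm (u + v)) = 0"
      by (simp only: dist_rp2_def u v setdist_antipodal)
    hence "norm (u - v) = 0 \<or> norm (u + v) = 0" by linarith
    hence uv: "u = v \<or> u = -v" by (auto simp: eq_neg_iff_add_eq_0)
    have line: "Rep_rp2 s = span {x}"
      if x: "norm x = 1" "Rep_rp2 s \<inter> sphere 0 1 = {x, -x}" for s x
    proof -
      obtain y :: "real^3" where y: "y \<noteq> 0" "Rep_rp2 s = span {y}"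
        using Rep_rp2[of s] by auto
      with x obtain k where k: "x = k *\<^sub>R y" by (auto simp: span_singleton)
      with x have "k \<noteq> 0" by auto
      thus ?thesis unfolding y k
        using span_image_scale[of "{y}" "\<lambda>_. k"] by simp
    qed
    from uv have "span {u} = span {v}"
      using span_image_scale[of "{v}" "\<lambda>_. -1"] by auto
    hence "Rep_rp2 p = Rep_rp2 q" using line[OF u] line[OF v] by simp
    thus "p = q" by (simp add: Rep_rp2_inject)
  next
    assume "p = q"
    thus "dist p q = 0"
      by (simp add: dist_rp2_def setdist_refl)
  qed
  have "min (norm (u - v)) (norm (u + v)) \<le> 
        min (norm (u - w)) (norm (u + w)) + min (norm (v - w)) (norm (v + w))"
    using norm_triangle_ineq4[of "u - w" "v - w"] norm_triangle_ineq4[of "u + w" "v + w"]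
      norm_triangle_ineq[of "u - w" "v + w"] norm_triangle_ineq[of "u + w" "v - w"]
    by (simp add: algebra_simps min_def)
  thus "dist p q \<le> dist p r + dist q r"
    by (simp only: dist_rp2_def u v w setdist_antipodal)
qed (simp_all only: uniformity_rp2_def open_rp2_def)

end

definition to_rp2 :: "real \<times> real \<Rightarrow> rp2" where
  "to_rp2 p = Abs_rp2 (span {vector [fst p, snd p, 1]})"

text \<open>Meaningful for nonempty bounded sets, in particular for nonempty compact ones.\<close>

definition hausdorff_dist :: "'a::metric_space set \<Rightarrow> 'a set \<Rightarrow> real" where
  "hausdorff_dist A B = max (SUP a\<in>A. infdist a B) (SUP b\<in>B. infdist b A)"


section \<open>Period annulus and critical periodic orbits of a planar vector field\<close>

type_synonym vector_field = "real \<times> real \<Rightarrow> real \<times> real"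

definition integral_curve :: "vector_field \<Rightarrow> (real \<Rightarrow> real \<times> real) \<Rightarrow> bool" where
  "integral_curve X \<phi> \<longleftrightarrow> (\<forall>t. (\<phi> has_vector_derivative X (\<phi> t)) (at t))"

definition is_period :: "vector_field \<Rightarrow> (real \<times> real) set \<Rightarrow> real \<Rightarrow> bool" where
  "is_period X \<gamma> T \<longleftrightarrow> 0 < T \<and>
     (\<exists>\<phi>. integral_curve X \<phi> \<and> range \<phi> = \<gamma> \<and> (\<forall>t. \<phi> (t + T) = \<phi> t))"

definition periodic_orbit :: "vector_field \<Rightarrow> (real \<times> real) set \<Rightarrow> bool" where
  "periodic_orbit X \<gamma> \<longleftrightarrow> (\<exists>T. is_period X \<gamma> T) \<and> \<not> is_singleton \<gamma>"

definition minimal_period :: "vector_field \<Rightarrow> (real \<times> real) set \<Rightarrow> real" where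
  "minimal_period X \<gamma> = (LEAST T. is_period X \<gamma> T)"

text \<open>
  The union of all connected punctured neighborhoods of the origin foliated by periodic orbits
  surrounding the origin is itself one of them whenever the origin is a center, hence the
  largest one.  A periodic orbit is a Jordan curve, and the points it surrounds are those of
  the bounded component of its complement.
\<close>

definition period_annulus :: "vector_field \<Rightarrow> (real \<times> real) set" where
  "period_annulus X = \<Union>{U. 0 \<notin> U \<and> open (insert 0 U) \<and> connected (insert 0 U) \<and>
     (\<forall>p\<in>U. \<exists>\<gamma>. p \<in> \<gamma> \<and> \<gamma> \<subseteq> U \<and> periodic_orbit X \<gamma> \<and> 0 \<in> inside \<gamma>)}"

definition outer_boundary :: "vector_field \<Rightarrow> rp2 set" where
  "outer_boundary X = frontier (to_rp2 ` period_annulus X) - {to_rp2 0}"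

definition real_analytic_on :: "(real \<Rightarrow> 'a::real_normed_vector) \<Rightarrow> real set \<Rightarrow> bool" where
  "real_analytic_on f S \<longleftrightarrow> (\<forall>x\<in>S. \<exists>a. \<exists>r>0. \<forall>y. \<bar>y - x\<bar> < r \<longrightarrow>
     (\<lambda>n. (y - x) ^ n *\<^sub>R a n) sums f y)"

text \<open>
  The orbits are parametrized through an analytic curve \<open>\<sigma>\<close> transverse to \<open>X\<close>, with \<open>\<Gamma> s\<close> the
  orbit through \<open>\<sigma> s\<close>.  Without transversality a degenerate reparametrization, such as one
  with \<open>s\<^sup>3\<close> in place of \<open>s\<close>, would create spurious critical orbits.  With it, the vanishing of
  the derivative of the period does not depend on the parametrization.
\<close>

definition analytic_orbit_parametrization ::
    "vector_field \<Rightarrow> (real \<Rightarrow> (real \<times> real) set) \<Rightarrow> bool" where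
  "analytic_orbit_parametrization X \<Gamma> \<longleftrightarrow>
     bij_betw \<Gamma> {0<..<1} {\<gamma>. periodic_orbit X \<gamma> \<and> \<gamma> \<subseteq> period_annulus X} \<and>
     (\<exists>\<sigma>. real_analytic_on \<sigma> {0<..<1} \<and>
       (\<forall>s\<in>{0<..<1}. \<sigma> s \<in> \<Gamma> s \<and>
         (\<exists>v. (\<sigma> has_vector_derivative v) (at s) \<and>
              fst (X (\<sigma> s)) * snd v - snd (X (\<sigma> s)) * fst v \<noteq> 0)))"

definition critical_periodic_orbit :: "vector_field \<Rightarrow> (real \<times> real) set \<Rightarrow> bool" where
  "critical_periodic_orbit X \<gamma> \<longleftrightarrow>
     (\<exists>\<Gamma> s. analytic_orbit_parametrization X \<Gamma> \<and> s \<in> {0<..<1} \<and> \<Gamma> s = \<gamma> \<and>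
       ((\<lambda>s. minimal_period X (\<Gamma> s)) has_real_derivative 0) (at s))"


section \<open>Criticality\<close>

definition outer_boundary_continuous_at ::
    "'p::real_normed_vector set \<Rightarrow> ('p \<Rightarrow> vector_field) \<Rightarrow> 'p \<Rightarrow> bool" where
  "outer_boundary_continuous_at \<Lambda> X \<mu>0 \<longleftrightarrow>
     (\<forall>\<epsilon>>0. \<exists>\<delta>>0. \<forall>\<mu>\<in>\<Lambda>. norm (\<mu> - \<mu>0) \<le> \<delta> \<longrightarrow>
        hausdorff_dist (outer_boundary (X \<mu>)) (outer_boundary (X \<mu>0)) \<le> \<epsilon>)"

definition ecard :: "'a set \<Rightarrow> enat" where
  "ecard A = (if finite A then enat (card A) else \<infinity>)"

definition criticality_bound ::
    "'p::real_normed_vector set \<Rightarrow> ('p \<Rightarrow> vector_field) \<Rightarrow> 'p \<Rightarrow> real \<Rightarrow> real \<Rightarrow> enat" where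
  "criticality_bound \<Lambda> X \<mu>0 \<delta> \<epsilon> =
     (SUP \<mu>\<in>{\<mu>\<in>\<Lambda>. norm (\<mu> - \<mu>0) \<le> \<delta>}.
        ecard {\<gamma>. critical_periodic_orbit (X \<mu>) \<gamma> \<and>
                  hausdorff_dist (to_rp2 ` \<gamma>) (outer_boundary (X \<mu>0)) \<le> \<epsilon>})"

definition criticality ::
    "'p::real_normed_vector set \<Rightarrow> ('p \<Rightarrow> vector_field) \<Rightarrow> 'p \<Rightarrow> enat" where
  "criticality \<Lambda> X \<mu>0 = (INF \<delta>\<in>{0<..}. INF \<epsilon>\<in>{0<..}. criticality_bound \<Lambda> X \<mu>0 \<delta> \<epsilon>)"


section \<open>The dehomogenized Loud family\<close>

definition loud :: "real \<times> real \<Rightarrow> vector_field" where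
  "loud = (\<lambda>(D, F) (x, y). (- y + x * y, x + D * x\<^sup>2 + F * y\<^sup>2))"

definition loud_params :: "(real \<times> real) set" where
  "loud_params = {(D, F). F > 1 \<and> D < 0 \<and> D + F > 0}"

end

theory Submission
  imports Defs
begin

text \<open>
  In the projective chart \<open>v = 1 / (1 - x)\<close>, \<open>p = y / (1 - x)\<close> the system has the first integral
  \<open>v\<^sup>m (q(v) - p\<^sup>2)\<close> with \<open>m = 2F - 2\<close> and a quadratic polynomial \<open>q\<close>.  The
  annulus consists of the levels \<open>0 < \<eta> < c\<close>, and the outer boundary is the level \<open>\<eta> = 0\<close>, formed by
  an arc of the line at infinity \<open>v = 0\<close> and a branch of the conic \<open>p\<^sup>2 = q(v)\<close>.

  The period is \<open>T(\<eta>) = 2 \<integral> dv / \<surd>(q(v) - \<eta> v\<^bsup>-m\<^esup>)\<close>.  Taking \<open>e(v) = v\<^sup>m q(v)\<close> as variable near the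
  turning points turns it into Abel integrals which can be differentiated in \<open>\<eta>\<close>.  All
  contributions stay bounded except that of the turning point near \<open>v = 0\<close>.  In the combination
  \<open>\<eta> T'' + (1 - 1/m) T'\<close> this contribution has, for \<open>D \<noteq> -1/2\<close>, a constant sign and is unbounded
  as \<open>\<eta> \<rightarrow> 0\<close> and \<open>F \<rightarrow> 2\<close>; so \<open>\<eta>\<^bsup>1 - 1/m\<^esup> T'\<close> is strictly monotone for small \<open>\<eta>\<close>, uniformly
  in the parameters, and \<open>T'\<close> has at most one zero there.  For \<open>F\<close> on the appropriate side of \<open>2\<close>
  the sign of \<open>T'\<close> as \<open>\<eta> \<rightarrow> 0\<close> is opposite to the sign it has at a fixed small \<open>\<eta>\<close>, so the
  intermediate value theorem provides a zero.
\<close>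

section \<open>Abel integrals\<close>

text \<open>Near \<open>v = 0\<close> the derivative of the period has the integrand
  \<open>loud_H1\<close>, of order \<open>v powr (4 - 3 * F)\<close> with leading coefficient
  proportional to \<open>(2 - F) / D^2\<close>. This coefficient changes sign at
  \<open>F = 2\<close>, so no sign of \<open>T'\<close> is uniform there. The operator
  \<open>e d/de + (3/2 - 1/m)\<close> annihilates the leading term, since \<open>e\<close> behaves
  like \<open>v powr m\<close> and \<open>(4 - 3 * F) / m = 1/m - 3/2\<close>; the Abel kernel
  accounts for the 1/2 by which this differs from \<open>1 - 1/m\<close>. What remains is
  \<open>v powr (5 - 3 * F) * loud_b / 4\<close>. At \<open>F = 2\<close>, \<open>v = 0\<close> one
  has \<open>loud_b = -(1 + 2 * D) / (2 * (-D)^3)\<close>: hence the exclusion of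
  \<open>D = -1/2\<close>. The range \<open>-2 < D\<close> is \<open>D + F > 0\<close> at
  \<open>F = 2\<close>. At \<open>F = 2\<close> the remainder is of order
  \<open>e powr (-1/2)\<close>, whose Abel integral diverges only logarithmically. To be uniform in
  \<open>F\<close> it is compared with \<open>e powr (\<nu> - 1/2)\<close>,
  \<open>\<nu> > 0\<close>, whose Abel integral still exceeds any given \<open>K\<close> once
  \<open>\<nu>\<close> and \<open>\<eta>\<close> are small. The order of choice is therefore
  essential: first the bound \<open>K\<close> on the regular contributions, independent of the
  parameters, then \<open>\<nu>\<close> and \<open>\<eta>\<close>, and only then the neighbourhood
  \<open>\<bar>F - 2\<bar> \<le> \<nu> / 2\<close>.\<close>

text \<open>The integral of \<open>f e / sqrt (e - \<eta>)\<close> over \<open>e \<in> {\<eta>..e0}\<close>, after the substitution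
  \<open>e = \<eta> + (e0 - \<eta>) * x\<^sup>2\<close>.\<close>

definition abel :: "real \<Rightarrow> (real \<Rightarrow> real) \<Rightarrow> real \<Rightarrow> real" where
  "abel e0 f \<eta> = 2 * sqrt (e0 - \<eta>) * integral {0..1} (\<lambda>x. f (\<eta> + (e0 - \<eta>) * x\<^sup>2))"

lemma abel_arg:
  fixes \<eta> e0 x :: real
  assumes "0 < \<eta>" "\<eta> < e0" "x \<in> {0..1}"
  shows "\<eta> \<le> \<eta> + (e0 - \<eta>) * x\<^sup>2" "\<eta> + (e0 - \<eta>) * x\<^sup>2 \<le> e0"
    and "\<eta> + (e0 - \<eta>) * x\<^sup>2 \<in> {0<..e0}"
proof -
  have "x\<^sup>2 \<le> 1" using assms by (simp add: abs_square_le_1)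
  then have "(e0 - \<eta>) * x\<^sup>2 \<le> (e0 - \<eta>) * 1" using assms by (intro mult_left_mono) auto
  then show le: "\<eta> + (e0 - \<eta>) * x\<^sup>2 \<le> e0" by simp
  show ge: "\<eta> \<le> \<eta> + (e0 - \<eta>) * x\<^sup>2" using assms by simp
  show "\<eta> + (e0 - \<eta>) * x\<^sup>2 \<in> {0<..e0}" using le order.strict_trans2[OF assms(1) ge] by (intro iffD2[OF greaterThanAtMost_iff] conjI)
qed

lemma abel_integrable:
  fixes \<eta> e0 :: real and f :: "real \<Rightarrow> real"
  assumes "0 < \<eta>" "\<eta> < e0" "continuous_on {0<..e0} f"
  shows "continuous_on {0..1} (\<lambda>x. f (\<eta> + (e0 - \<eta>) * x\<^sup>2))"
    and "(\<lambda>x. f (\<eta> + (e0 - \<eta>) * x\<^sup>2)) integrable_on {0..1}"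
proof -
  show "continuous_on {0..1} (\<lambda>x. f (\<eta> + (e0 - \<eta>) * x\<^sup>2))"
    by (rule continuous_on_compose2[OF assms(3)])
       (use abel_arg(3)[OF assms(1,2)] in \<open>auto intro!: continuous_intros simp del: greaterThanAtMost_iff\<close>)
  then show "(\<lambda>x. f (\<eta> + (e0 - \<eta>) * x\<^sup>2)) integrable_on {0..1}"
    by (rule integrable_continuous_real)
qed

text \<open>Comes from integrating the derivative of
  \<open>x * f (\<eta> + (e0 - \<eta>) * x\<^sup>2)\<close>, where the chain rule produces the
  factor \<open>2 * (e0 - \<eta>) * x\<close>.\<close>

lemma abel_by_parts:
  assumes \<eta>: "0 < \<eta>" "\<eta> < e0"
    and f: "\<And>e. e \<in> {0<..e0} \<Longrightarrow> (f has_real_derivative f' e) (at e)"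
    and f': "continuous_on {0<..e0} f'"
  shows "integral {0..1} (\<lambda>x. f (\<eta> + (e0 - \<eta>) * x\<^sup>2)) =
    f e0 - 2 * (e0 - \<eta>) * integral {0..1} (\<lambda>x. x\<^sup>2 * f' (\<eta> + (e0 - \<eta>) * x\<^sup>2))"
proof -
  let ?e = "\<lambda>x. \<eta> + (e0 - \<eta>) * x\<^sup>2"
  have cf: "continuous_on {0<..e0} f"
    using f by (blast intro: continuous_at_imp_continuous_on DERIV_isCont)
  have "((\<lambda>x. f (?e x) + 2 * (e0 - \<eta>) * (x\<^sup>2 * f' (?e x))) has_integral
      1 * f (?e 1) - 0 * f (?e 0)) {0..1}"
  proof (rule fundamental_theorem_of_calculus[where f="\<lambda>x. x * f (?e x)"])
    fix x :: real assume x: "x \<in> {0..1}"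
    have "((\<lambda>x. f (?e x)) has_real_derivative f' (?e x) * ((e0 - \<eta>) * (2 * x))) (at x)"
      by (rule DERIV_chain2[OF f]) (use abel_arg(3)[OF \<eta> x] in \<open>auto intro!: derivative_eq_intros\<close>)
    from DERIV_mult[OF DERIV_ident this]
    have "((\<lambda>x. x * f (?e x)) has_real_derivative f (?e x) + 2 * (e0 - \<eta>) * (x\<^sup>2 * f' (?e x))) (at x)"
      by (rule DERIV_cong) (simp add: power2_eq_square)
    then show "((\<lambda>x. x * f (?e x)) has_vector_derivative f (?e x) + 2 * (e0 - \<eta>) * (x\<^sup>2 * f' (?e x)))
        (at x within {0..1})"
      by (simp add: has_real_derivative_iff_has_vector_derivative has_vector_derivative_at_within)
  qed simp
  moreover
  have "((\<lambda>x. f (?e x) + 2 * (e0 - \<eta>) * (x\<^sup>2 * f' (?e x))) has_integral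
     integral {0..1} (\<lambda>x. f (?e x)) + 2 * (e0 - \<eta>) * integral {0..1} (\<lambda>x. x\<^sup>2 * f' (?e x))) {0..1}"
    by (intro has_integral_add has_integral_mult_right integrable_integral
        integrable_continuous_real continuous_intros abel_integrable[OF \<eta>] cf f')
  ultimately show ?thesis by (auto dest: has_integral_unique)
qed

text \<open>The substitution has removed the singular kernel, so differentiation under the integral
  sign is legitimate and yields the weight \<open>1 - x\<^sup>2\<close>. By
  \<open>abel_by_parts\<close> the \<open>x\<^sup>2\<close> part cancels against the derivative of
  the prefactor, which leaves an Abel integral of \<open>f'\<close> and a boundary term at the fixed
  end \<open>e0\<close> only.\<close>

lemma abel_has_derivative:
  assumes \<eta>: "0 < \<eta>" "\<eta> < e0"
    and f: "\<And>e. e \<in> {0<..e0} \<Longrightarrow> (f has_real_derivative f' e) (at e)"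
    and f': "continuous_on {0<..e0} f'"
  shows "(abel e0 f has_real_derivative abel e0 f' \<eta> - f e0 / sqrt (e0 - \<eta>)) (at \<eta>)"
proof -
  let ?e = "\<lambda>\<eta> x. \<eta> + (e0 - \<eta>) * x\<^sup>2"
  define U where "U = {\<eta>/2..(\<eta>+e0)/2}"
  have U: "0 < t" "t < e0" if "t \<in> U" for t using that \<eta> by (auto simp: U_def field_simps)
  have cf: "continuous_on {0<..e0} f"
    using f by (blast intro: continuous_at_imp_continuous_on DERIV_isCont)
  have "((\<lambda>\<eta>. integral (cbox 0 1) (\<lambda>x. f (?e \<eta> x))) has_field_derivative
      integral (cbox 0 1) (\<lambda>x. f' (?e \<eta> x) * (1 - x\<^sup>2))) (at \<eta> within U)"
  proof (rule leibniz_rule_field_derivative)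
    fix t x :: real assume tx: "t \<in> U" "x \<in> cbox 0 1"
    show "((\<lambda>t. f (?e t x)) has_real_derivative f' (?e t x) * (1 - x\<^sup>2)) (at t within U)"
      by (rule DERIV_chain2[OF f]) (use abel_arg(3)[of t e0 x] U tx in \<open>auto intro!: derivative_eq_intros\<close>)
  next
    fix t assume "t \<in> U"
    then show "(\<lambda>x. f (?e t x)) integrable_on cbox 0 1"
      using abel_integrable(2)[OF U cf] by simp
  next
    show "continuous_on (U \<times> cbox 0 1) (\<lambda>(t, x). f' (?e t x) * (1 - x\<^sup>2))"
      unfolding split_def
      by (intro continuous_intros continuous_on_compose2[OF f']) (use abel_arg(3) U in auto)
  qed (use \<eta> in \<open>auto simp: U_def\<close>)
  moreover have "at \<eta> within U = at \<eta>"
    by (rule at_within_interior) (use \<eta> in \<open>auto simp: U_def\<close>)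
  ultimately have d: "((\<lambda>\<eta>. integral {0..1} (\<lambda>x. f (?e \<eta> x))) has_real_derivative
      integral {0..1} (\<lambda>x. f' (?e \<eta> x) * (1 - x\<^sup>2))) (at \<eta>)" by simp
  have "integral {0..1} (\<lambda>x. f' (?e \<eta> x) * (1 - x\<^sup>2)) =
      integral {0..1} (\<lambda>x. f' (?e \<eta> x) - x\<^sup>2 * f' (?e \<eta> x))"
    by (intro integral_cong) (simp add: right_diff_distrib)
  also have "\<dots> = integral {0..1} (\<lambda>x. f' (?e \<eta> x)) - integral {0..1} (\<lambda>x. x\<^sup>2 * f' (?e \<eta> x))"
    by (intro integral_diff integrable_continuous_real continuous_intros abel_integrable[OF \<eta>] f')
  finally have "integral {0..1} (\<lambda>x. f' (?e \<eta> x) * (1 - x\<^sup>2)) =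
      integral {0..1} (\<lambda>x. f' (?e \<eta> x)) - integral {0..1} (\<lambda>x. x\<^sup>2 * f' (?e \<eta> x))" .
  with d have d: "((\<lambda>\<eta>. integral {0..1} (\<lambda>x. f (?e \<eta> x))) has_real_derivative
      integral {0..1} (\<lambda>x. f' (?e \<eta> x)) - integral {0..1} (\<lambda>x. x\<^sup>2 * f' (?e \<eta> x))) (at \<eta>)" by simp
  define I J K where "I = integral {0..1} (\<lambda>x. f (?e \<eta> x))"
    and "J = integral {0..1} (\<lambda>x. f' (?e \<eta> x))"
    and "K = integral {0..1} (\<lambda>x. x\<^sup>2 * f' (?e \<eta> x))"
  have I: "I = f e0 - 2 * (e0 - \<eta>) * K"
    unfolding I_def K_def by (rule abel_by_parts[OF assms])
  define r where "r = sqrt (e0 - \<eta>)"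
  have r: "r > 0" "e0 - \<eta> = r\<^sup>2" using \<eta> by (auto simp: r_def)
  have "((\<lambda>\<eta>. 2 * sqrt (e0 - \<eta>) * integral {0..1} (\<lambda>x. f (?e \<eta> x))) has_real_derivative
     2 * sqrt (e0 - \<eta>) * (J - K) - I / sqrt (e0 - \<eta>)) (at \<eta>)"
  proof -
    have "((\<lambda>\<eta>. 2 * sqrt (e0 - \<eta>)) has_real_derivative - 1 / sqrt (e0 - \<eta>)) (at \<eta>)"
    proof -
      have "((\<lambda>\<eta>. e0 - \<eta>) has_real_derivative -1) (at \<eta>)" by (auto intro!: derivative_eq_intros)
      from DERIV_cmult[OF DERIV_chain2[OF DERIV_real_sqrt this], of 2] \<eta> show ?thesis
        by (simp add: inverse_eq_divide)
    qed
    from DERIV_mult[OF this d] show ?thesis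
    proof (rule DERIV_cong)
      show "- 1 / sqrt (e0 - \<eta>) * integral {0..1} (\<lambda>x. f (?e \<eta> x)) +
          (integral {0..1} (\<lambda>x. f' (?e \<eta> x)) - integral {0..1} (\<lambda>x. x\<^sup>2 * f' (?e \<eta> x))) *
          (2 * sqrt (e0 - \<eta>)) = 2 * sqrt (e0 - \<eta>) * (J - K) - I / sqrt (e0 - \<eta>)"
        unfolding I_def[symmetric] J_def[symmetric] K_def[symmetric] by (simp only: mult.commute) simp
    qed
  qed
  moreover have "2 * r * (J - K) - I / r = 2 * r * J - f e0 / r"
  proof -
    have "I / r = f e0 / r - 2 * r * K"
      by (subst I, subst r(2)) (use r(1) in \<open>simp add: diff_divide_distrib power2_eq_square\<close>)
    then show ?thesis by (simp add: right_diff_distrib)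
  qed
  moreover have "abel e0 f' \<eta> = 2 * r * J" "abel e0 f = (\<lambda>\<eta>. 2 * sqrt (e0 - \<eta>) * integral {0..1} (\<lambda>x. f (?e \<eta> x)))"
    by (simp_all add: abel_def fun_eq_iff J_def r_def)
  ultimately show ?thesis
    by (simp only: r_def)
qed

text \<open>In the original variable: write \<open>\<eta> = e - (e - \<eta>)\<close> and integrate
  \<open>sqrt (e - \<eta>) * f' e\<close> by parts; this produces the term with the factor
  1/2.\<close>

lemma abel_scaling:
  assumes \<eta>: "0 < \<eta>" "\<eta> < e0"
    and f: "\<And>e. e \<in> {0<..e0} \<Longrightarrow> (f has_real_derivative f' e) (at e)"
    and f': "continuous_on {0<..e0} f'"
  shows "\<eta> * abel e0 f' \<eta> = abel e0 (\<lambda>e. e * f' e) \<eta> + abel e0 f \<eta> / 2 - sqrt (e0 - \<eta>) * f e0"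
proof -
  let ?e = "\<lambda>x. \<eta> + (e0 - \<eta>) * x\<^sup>2"
  define J K where "J = integral {0..1} (\<lambda>x. f' (?e x))"
    and "K = integral {0..1} (\<lambda>x. x\<^sup>2 * f' (?e x))"
  have "integral {0..1} (\<lambda>x. ?e x * f' (?e x)) =
      integral {0..1} (\<lambda>x. \<eta> * f' (?e x) + (e0 - \<eta>) * (x\<^sup>2 * f' (?e x)))"
    by (intro integral_cong) (simp only: distrib_right mult.assoc)
  also have "\<dots> = integral {0..1} (\<lambda>x. \<eta> * f' (?e x)) + integral {0..1} (\<lambda>x. (e0 - \<eta>) * (x\<^sup>2 * f' (?e x)))"
    by (intro integral_add integrable_continuous_real continuous_intros abel_integrable[OF \<eta>] f')
  finally have "integral {0..1} (\<lambda>x. ?e x * f' (?e x)) = \<eta> * J + (e0 - \<eta>) * K"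
    unfolding J_def K_def by simp
  note ef = this
  define I where "I = integral {0..1} (\<lambda>x. f (?e x))"
  have I: "I = f e0 - 2 * (e0 - \<eta>) * K"
    unfolding I_def K_def by (rule abel_by_parts[OF assms])
  show ?thesis
    unfolding abel_def ef unfolding I_def[symmetric] J_def[symmetric]
    by (subst I) (simp add: algebra_simps add_divide_distrib diff_divide_distrib)
qed

lemma abel_mono:
  assumes "0 < \<eta>" "\<eta> < e0" "continuous_on {0<..e0} f" "continuous_on {0<..e0} g"
    and "\<And>e. \<eta> \<le> e \<Longrightarrow> e \<le> e0 \<Longrightarrow> f e \<le> g e"
  shows "abel e0 f \<eta> \<le> abel e0 g \<eta>"
  unfolding abel_def
  by (intro mult_left_mono integral_le abel_integrable assms(1-4) assms(5))
     (use abel_arg(1,2)[OF assms(1,2)] assms(2) in \<open>simp_all (no_asm_simp)\<close>)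

lemma abel_const: "abel e0 (\<lambda>_. c) \<eta> = 2 * sqrt (e0 - \<eta>) * c"
  by (simp add: abel_def)

lemma abel_cmult: "abel e0 (\<lambda>e. c * f e) \<eta> = c * abel e0 f \<eta>"
  by (simp add: abel_def)

lemma abel_add:
  assumes "0 < \<eta>" "\<eta> < e0" "continuous_on {0<..e0} f" "continuous_on {0<..e0} g"
  shows "abel e0 (\<lambda>e. f e + g e) \<eta> = abel e0 f \<eta> + abel e0 g \<eta>"
  unfolding abel_def
  by (subst integral_add) (use abel_integrable(2)[OF assms(1,2)] assms(3,4) in \<open>auto simp only: distrib_left\<close>)

lemma abel_bound:
  assumes "0 < \<eta>" "\<eta> < e0" "continuous_on {0<..e0} f"
    and "\<And>e. \<eta> \<le> e \<Longrightarrow> e \<le> e0 \<Longrightarrow> \<bar>f e\<bar> \<le> M"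
  shows "\<bar>abel e0 f \<eta>\<bar> \<le> 2 * sqrt e0 * M"
proof -
  have M: "M \<ge> 0" using assms(4)[of e0] assms(2) by linarith
  have "abel e0 f \<eta> \<le> abel e0 (\<lambda>_. M) \<eta>"
    by (rule abel_mono[OF assms(1-3) continuous_on_const]) (use assms(4) in \<open>simp add: abs_le_iff\<close>)
  moreover have "abel e0 (\<lambda>_. -M) \<eta> \<le> abel e0 f \<eta>"
    by (rule abel_mono[OF assms(1,2) continuous_on_const assms(3)]) (use assms(4) in \<open>simp add: abs_le_iff minus_le_iff\<close>)
  moreover have "sqrt (e0 - \<eta>) * M \<le> sqrt e0 * M"
    using assms M by (intro mult_right_mono) auto
  ultimately show ?thesis by (simp add: abel_const abs_le_iff)
qed

section \<open>Periods of oscillators\<close>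

text \<open>At a zero of \<open>f\<close> continuity of \<open>g\<close> is enough. This is needed
  at turning points, where the angular speed of the oscillator is only known to be
  continuous.\<close>

lemma DERIV_mult_zero:
  fixes f g :: "real \<Rightarrow> real"
  assumes "(f has_real_derivative D) (at x)" "f x = 0" "isCont g x"
  shows "((\<lambda>s. f s * g s) has_real_derivative D * g x) (at x)"
proof -
  have "((\<lambda>y. (f y - f x) / (y - x)) \<longlongrightarrow> D) (at x)" "(g \<longlongrightarrow> g x) (at x)"
    using assms by (auto simp: has_field_derivative_iff isCont_def)
  from tendsto_mult[OF this] show ?thesis
    by (simp add: has_field_derivative_iff assms(2))
qed

lemma antiderivative_UNIV:
  fixes f :: "real \<Rightarrow> real"
  assumes "continuous_on UNIV f"
  obtains F where "\<And>x. (F has_real_derivative f x) (at x)" "F 0 = 0"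
proof -
  have "\<exists>F. \<forall>x. -\<infinity> < ereal x \<longrightarrow> ereal x < \<infinity> \<longrightarrow> (F has_vector_derivative f x) (at x)"
    by (rule einterval_antiderivative) (use assms in \<open>auto simp: continuous_on_eq_continuous_at\<close>)
  then obtain F where "\<And>x. (F has_real_derivative f x) (at x)"
    by (auto simp: has_real_derivative_iff_has_vector_derivative)
  then have "\<And>x. ((\<lambda>x. F x - F 0) has_real_derivative f x) (at x)"
    by (auto intro!: derivative_eq_intros)
  then show ?thesis by (rule that) simp
qed

text \<open>Both simple zeros are divided out. The limits of the quotient at the ends are difference
  quotients of \<open>g\<close>, so differentiability of \<open>g\<close> suffices, and
  \<open>k\<close> is obtained as a continuous function only.\<close>

lemma bracket_quotient:
  fixes g g' :: "real \<Rightarrow> real"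
  assumes ab: "a < b" and d: "\<And>v. v \<in> {a..b} \<Longrightarrow> (g has_real_derivative g' v) (at v)"
    and ga: "g a = 0" and gb: "g b = 0" and pos: "\<And>v. a < v \<Longrightarrow> v < b \<Longrightarrow> g v > 0"
    and g'a: "g' a > 0" and g'b: "g' b < 0"
  obtains k where "continuous_on {a..b} k" "\<And>v. v \<in> {a..b} \<Longrightarrow> k v > 0"
    "\<And>v. v \<in> {a..b} \<Longrightarrow> g v = (v - a) * (b - v) * k v"
    "k a = g' a / (b - a)" "k b = - g' b / (b - a)"
proof -
  define k where "k v = (if v = a then g' a / (b - a) else if v = b then - g' b / (b - a)
    else g v / ((v - a) * (b - v)))" for v
  have ka: "(k \<longlongrightarrow> k a) (at a within {a..b})"
  proof -
    have "((\<lambda>v. (g v - g a) / (v - a) / (b - v)) \<longlongrightarrow> g' a / (b - a)) (at a)"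
      using d[of a] ab by (intro tendsto_divide tendsto_intros) (auto simp: has_field_derivative_iff)
    moreover have "\<forall>\<^sub>F v in at a within {a..b}. (g v - g a) / (v - a) / (b - v) = k v"
    proof -
      have "\<forall>\<^sub>F v in at a within {a..b}. v < b"
        by (rule order_tendstoD(2)[OF tendsto_ident_at ab])
      moreover have "\<forall>\<^sub>F v in at a within {a..b}. v \<noteq> a"
        by (auto simp: eventually_at_filter)
      ultimately show ?thesis by eventually_elim (auto simp: k_def ga)
    qed
    ultimately have "(k \<longlongrightarrow> g' a / (b - a)) (at a within {a..b})"
      by (rule Lim_transform_eventually[OF tendsto_within_subset[OF _ subset_UNIV]])
    moreover have "k a = g' a / (b - a)" using ab by (simp add: k_def)
    ultimately show ?thesis by simp
  qed
  have kb: "(k \<longlongrightarrow> k b) (at b within {a..b})"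
  proof -
    have "((\<lambda>v. - ((g v - g b) / (v - b)) / (v - a)) \<longlongrightarrow> - g' b / (b - a)) (at b)"
      using d[of b] ab by (intro tendsto_divide tendsto_minus tendsto_intros) (auto simp: has_field_derivative_iff)
    moreover have "\<forall>\<^sub>F v in at b within {a..b}. - ((g v - g b) / (v - b)) / (v - a) = k v"
    proof -
      have "\<forall>\<^sub>F v in at b within {a..b}. v > a"
        by (rule order_tendstoD(1)[OF tendsto_ident_at ab])
      moreover have "\<forall>\<^sub>F v in at b within {a..b}. v \<noteq> b"
        by (auto simp: eventually_at_filter)
      ultimately show ?thesis by eventually_elim (auto simp: k_def gb divide_simps algebra_simps)
    qed
    ultimately have "(k \<longlongrightarrow> - g' b / (b - a)) (at b within {a..b})"
      by (rule Lim_transform_eventually[OF tendsto_within_subset[OF _ subset_UNIV]])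
    moreover have "k b = - g' b / (b - a)" using ab by (simp add: k_def)
    ultimately show ?thesis by simp
  qed
  have ki: "(k \<longlongrightarrow> k v) (at v within {a..b})" if v: "a < v" "v < b" for v
  proof -
    have "isCont g v" using d[of v] v by (auto intro: DERIV_isCont)
    then have "((\<lambda>v. g v / ((v - a) * (b - v))) \<longlongrightarrow> k v) (at v)"
      using v by (auto simp: k_def isCont_def intro!: tendsto_intros)
    moreover have "\<forall>\<^sub>F w in at v. w \<in> {a<..<b}"
      using v by (intro eventually_at_in_open') auto
    then have "\<forall>\<^sub>F w in at v. g w / ((w - a) * (b - w)) = k w"
      by eventually_elim (auto simp: k_def)
    ultimately show ?thesis
      by (rule Lim_transform_eventually[OF tendsto_within_subset[OF _ subset_UNIV] filter_leD[OF at_le[OF subset_UNIV]]])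
  qed
  show ?thesis
  proof
    show "continuous_on {a..b} k" unfolding continuous_on_def
    proof
      fix v assume "v \<in> {a..b}"
      then consider "v = a" | "v = b" | "a < v" "v < b" by fastforce
      then show "(k \<longlongrightarrow> k v) (at v within {a..b})" by cases (use ka kb ki in auto)
    qed
    show "k v > 0" if "v \<in> {a..b}" for v
      using that ab g'a g'b pos[of v] by (auto simp: k_def divide_neg_pos)
    show "g v = (v - a) * (b - v) * k v" if "v \<in> {a..b}" for v
      using that ab by (auto simp: k_def ga gb)
  qed (use ab in \<open>auto simp: k_def\<close>)
qed

text \<open>The substitution \<open>v = (a + b) / 2 - (b - a) / 2 * cos \<theta>\<close> desingularizes the turning
  points: \<open>\<theta>\<close> moves with a positive, continuous and \<open>2\<pi>\<close>-periodic speed.\<close>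

lemma oscillator:
  fixes g g' :: "real \<Rightarrow> real"
  assumes ab: "a < b" and d: "\<And>v. v \<in> {a..b} \<Longrightarrow> (g has_real_derivative g' v) (at v)"
    and ga: "g a = 0" and gb: "g b = 0" and pos: "\<And>v. a < v \<Longrightarrow> v < b \<Longrightarrow> g v > 0"
    and g'a: "g' a > 0" and g'b: "g' b < 0"
  obtains T v p t where "T > 0"
    "\<And>s. (v has_real_derivative - p s) (at s)"
    "\<And>s. (p has_real_derivative - g' (v s) / 2) (at s)"
    "\<And>s. v (s + T) = v s" "\<And>s. p (s + T) = p s"
    "range (\<lambda>s. (v s, p s)) = {(w, q). a \<le> w \<and> w \<le> b \<and> q\<^sup>2 = g w}"
    "v 0 = a" "\<And>s. s > 0 \<Longrightarrow> v s = a \<Longrightarrow> T \<le> s"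
    "continuous_on {a..b} t" "t a = 0" "t b = T / 2"
    "\<And>w. a < w \<Longrightarrow> w < b \<Longrightarrow> (t has_real_derivative 1 / sqrt (g w)) (at w)"
proof -
  obtain k where kc: "continuous_on {a..b} k" and kpos: "\<And>v. v \<in> {a..b} \<Longrightarrow> k v > 0"
    and gk: "\<And>v. v \<in> {a..b} \<Longrightarrow> g v = (v - a) * (b - v) * k v"
    and ka: "k a = g' a / (b - a)" and kb: "k b = - g' b / (b - a)"
    by (rule bracket_quotient[OF assms]) blast+
  define c r where "c = (a + b) / 2" and "r = (b - a) / 2"
  have r: "r > 0" and cr: "c - r = a" "c + r = b" using ab by (auto simp: c_def r_def field_simps)
  define w where "w \<theta> = c - r * cos \<theta>" for \<theta>
  \<comment> \<open>With \<open>v = w \<theta>\<close> and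
    \<open>p = - r * sin \<theta> * \<omega> \<theta>\<close>, the equation \<open>v' = - p\<close>
    becomes \<open>\<theta>' = \<omega> \<theta>\<close>; the antiderivative \<open>\<tau>\<close>
    of \<open>1 / \<omega>\<close> is time as a function of the angle.\<close>
  define \<omega> where "\<omega> \<theta> = sqrt (k (w \<theta>))" for \<theta>
  have w: "w \<theta> \<in> {a..b}" for \<theta>
  proof -
    have "r * cos \<theta> \<le> r * 1" "r * (-1) \<le> r * cos \<theta>" using r by (intro mult_left_mono; simp)+
    then show ?thesis unfolding w_def atLeastAtMost_iff cr[symmetric] by linarith
  qed
  have \<omega>pos: "\<omega> \<theta> > 0" for \<theta> using kpos[OF w] by (simp add: \<omega>_def)
  have wq: "(w \<theta> - a) * (b - w \<theta>) = (r * sin \<theta>)\<^sup>2" for \<theta>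
  proof -
    have "(w \<theta> - a) * (b - w \<theta>) = (r - r * cos \<theta>) * (r + r * cos \<theta>)"
      unfolding w_def cr[symmetric] by simp
    also have "\<dots> = r\<^sup>2 * (1 - (cos \<theta>)\<^sup>2)" by (simp add: algebra_simps power2_eq_square)
    finally show ?thesis by (simp add: sin_squared_eq power_mult_distrib)
  qed
  have cw: "continuous_on UNIV w" unfolding w_def by (intro continuous_intros)
  have c\<omega>: "continuous_on UNIV \<omega>" unfolding \<omega>_def
    by (intro continuous_intros continuous_on_compose2[OF kc cw]) (use w in auto)
  have "continuous_on UNIV (\<lambda>\<theta>. 1 / \<omega> \<theta>)"
    by (intro continuous_intros c\<omega>) (use \<omega>pos in \<open>auto simp: less_le\<close>)
  then obtain \<tau> where \<tau>: "\<And>\<theta>. (\<tau> has_real_derivative 1 / \<omega> \<theta>) (at \<theta>)" and \<tau>0: "\<tau> 0 = 0"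
    using antiderivative_UNIV by blast
  define T where "T = \<tau> (2 * pi)"
  have \<tau>mono: "x < y \<Longrightarrow> \<tau> x < \<tau> y" for x y
    by (rule DERIV_pos_imp_increasing) (use \<tau> \<omega>pos in \<open>force intro: zero_less_divide_1_iff[THEN iffD2]\<close>)+
  have \<tau>odd: "\<tau> (- x) = - \<tau> x" for x
  proof -
    have *: "((\<lambda>x. \<tau> (- x) + \<tau> x) has_real_derivative 1 / \<omega> (- y) * (-1) + 1 / \<omega> y) (at y)" for y
      by (intro DERIV_add \<tau> DERIV_chain2[OF \<tau>]) (auto intro!: derivative_eq_intros)
    have "1 / \<omega> (- y) * (-1) + 1 / \<omega> y = 0" for y by (simp add: \<omega>_def w_def)
    with * have "\<forall>y. ((\<lambda>x. \<tau> (- x) + \<tau> x) has_real_derivative 0) (at y)" by metis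
    from DERIV_isconst_all[OF this, of x 0] show ?thesis by (simp add: \<tau>0)
  qed
  have \<tau>per: "\<tau> (x + 2 * pi) = \<tau> x + T" for x
  proof -
    have *: "((\<lambda>x. \<tau> (x + 2 * pi) - \<tau> x) has_real_derivative 1 / \<omega> (y + 2 * pi) * 1 - 1 / \<omega> y) (at y)" for y
      by (intro DERIV_diff \<tau> DERIV_chain2[OF \<tau>]) (auto intro!: derivative_eq_intros)
    have "1 / \<omega> (y + 2 * pi) * 1 - 1 / \<omega> y = 0" for y by (simp add: \<omega>_def w_def)
    with * have "\<forall>y. ((\<lambda>x. \<tau> (x + 2 * pi) - \<tau> x) has_real_derivative 0) (at y)" by metis
    from DERIV_isconst_all[OF this, of x 0] show ?thesis by (simp add: \<tau>0 T_def)
  qed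
  have T: "T > 0" using \<tau>mono[of 0 "2 * pi"] by (simp add: T_def \<tau>0)
  \<comment> \<open>Evenness of \<open>\<omega>\<close> makes the passages from \<open>a\<close> to
    \<open>b\<close> and back equally long.\<close>
  have \<tau>pi: "\<tau> pi = T / 2" using \<tau>per[of "- pi"] \<tau>odd[of pi] by simp
  have \<tau>n: "\<tau> (2 * pi * real n) = real n * T" for n
  proof (induction n)
    case (Suc n)
    then show ?case using \<tau>per[of "2 * pi * real n"] by (simp add: algebra_simps)
  qed (simp add: \<tau>0)
  have \<tau>cont: "isCont \<tau> x" for x using \<tau> by (blast intro: DERIV_isCont)
  have surj: "\<exists>\<theta>. \<tau> \<theta> = s" for s
  proof -
    obtain n where n: "\<bar>s\<bar> / T \<le> real n" using real_arch_simple by blast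
    then have "\<bar>s\<bar> \<le> real n * T" using T by (simp add: field_simps)
    then have "\<tau> (- (2 * pi * real n)) \<le> s" "s \<le> \<tau> (2 * pi * real n)"
      unfolding \<tau>odd \<tau>n by auto
    then show ?thesis
      using IVT[of \<tau> "- (2 * pi * real n)" s "2 * pi * real n"] \<tau>cont by auto
  qed
  then obtain \<theta> where \<theta>: "\<And>s. \<tau> (\<theta> s) = s" by metis
  have \<theta>\<tau>: "\<theta> (\<tau> x) = x" for x
    using \<theta>[of "\<tau> x"] \<tau>mono by (metis less_irrefl linorder_neqE_linordered_idom)
  have \<theta>cont: "isCont \<theta> s" for s
    using isCont_inverse_function[of 1 "\<theta> s" \<theta> \<tau>] \<theta>\<tau> \<tau>cont by (simp add: \<theta>)
  have d\<theta>: "(\<theta> has_real_derivative \<omega> (\<theta> s)) (at s)" for s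
  proof -
    have "(\<theta> has_real_derivative inverse (1 / \<omega> (\<theta> s))) (at s)"
      by (rule DERIV_inverse_function[OF \<tau>, where a="s - 1" and b="s + 1"])
         (use \<omega>pos[of "\<theta> s"] \<theta> \<theta>cont in auto)
    then show ?thesis by simp
  qed
  have \<theta>per: "\<theta> (s + T) = \<theta> s + 2 * pi" for s
    using \<theta>\<tau>[of "\<theta> s + 2 * pi"] by (simp add: \<tau>per \<theta>)
  define v where "v s = w (\<theta> s)" for s
  define p where "p s = - (r * sin (\<theta> s) * \<omega> (\<theta> s))" for s
  have dv: "(v has_real_derivative - p s) (at s)" for s
    unfolding v_def[abs_def] w_def p_def
    by (auto intro!: derivative_eq_intros d\<theta>)
  have p2: "(p s)\<^sup>2 = g (v s)" for s
  proof -
    have "(p s)\<^sup>2 = (r * sin (\<theta> s))\<^sup>2 * (\<omega> (\<theta> s))\<^sup>2" by (simp add: p_def power_mult_distrib)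
    also have "\<dots> = g (v s)"
      unfolding gk[OF w, of "\<theta> s", folded v_def] using kpos[OF w, of "\<theta> s"] wq[of "\<theta> s"]
      by (simp add: \<omega>_def v_def)
    finally show ?thesis .
  qed
  \<comment> \<open>Away from the turning points \<open>p\<close> is locally
    \<open>sqrt (g v)\<close> up to a fixed sign. At a turning point \<open>sin \<theta>\<close>
    vanishes, \<open>DERIV_mult_zero\<close> applies, and the end values of \<open>k\<close> give
    back \<open>g'\<close>.\<close>
  have dp: "(p has_real_derivative - g' (v s) / 2) (at s)" for s
  proof (cases "p s = 0")
    case False
    have vs: "v s \<in> {a..b}" using w by (simp add: v_def)
    have "isCont p s" unfolding p_def
      by (intro continuous_intros \<theta>cont isCont_o2[OF \<theta>cont] continuous_on_interior[OF c\<omega>]) auto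
    then have "(p \<longlongrightarrow> p s) (nhds s)" by (simp add: isCont_def tendsto_at_iff_tendsto_nhds)
    then have "((\<lambda>x. p x * sgn (p s)) \<longlongrightarrow> p s * sgn (p s)) (nhds s)" by (intro tendsto_intros)
    moreover have "p s * sgn (p s) > 0" using False by (simp add: sgn_if)
    ultimately have "\<forall>\<^sub>F x in nhds s. p x * sgn (p s) > 0" by (rule order_tendstoD)
    then have ev: "\<forall>\<^sub>F x in nhds s. sgn (p s) * sqrt (g (v x)) = p x"
    proof eventually_elim
      case (elim x)
      then show ?case unfolding p2[symmetric] by (auto simp: sgn_if split: if_splits)
    qed
    have gp: "g (v s) > 0" using False by (simp add: p2[symmetric])
    have "((\<lambda>x. sgn (p s) * sqrt (g (v x))) has_real_derivative
        sgn (p s) * (inverse (sqrt (g (v s))) / 2 * (g' (v s) * (- p s)))) (at s)"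
      by (intro DERIV_cmult DERIV_chain2[where f=sqrt and g="\<lambda>x. g (v x)"] DERIV_real_sqrt[OF gp]
          DERIV_chain2[where f=g and g=v] d[OF vs] dv)
    moreover have "sgn (p s) * (inverse (sqrt (g (v s))) / 2 * (g' (v s) * (- p s))) = - g' (v s) / 2"
      using False by (auto simp: p2[symmetric] sgn_if field_simps)
    ultimately have "((\<lambda>x. sgn (p s) * sqrt (g (v x))) has_real_derivative - g' (v s) / 2) (at s)" by (simp only:)
    then show ?thesis using DERIV_cong_ev[OF refl ev refl] by blast
  next
    case True
    then have s0: "sin (\<theta> s) = 0" using r \<omega>pos[of "\<theta> s"] by (auto simp: p_def)
    have "((\<lambda>s. sin (\<theta> s)) has_real_derivative cos (\<theta> s) * \<omega> (\<theta> s)) (at s)"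
      by (auto intro!: derivative_eq_intros d\<theta>)
    moreover have "isCont (\<lambda>s. - r * \<omega> (\<theta> s)) s"
      by (intro continuous_intros isCont_o2[OF \<theta>cont] continuous_on_interior[OF c\<omega>]) auto
    ultimately have "((\<lambda>s. sin (\<theta> s) * (- r * \<omega> (\<theta> s))) has_real_derivative
        (cos (\<theta> s) * \<omega> (\<theta> s)) * (- r * \<omega> (\<theta> s))) (at s)"
      using s0 by (intro DERIV_mult_zero)
    moreover have "(\<lambda>s. sin (\<theta> s) * (- r * \<omega> (\<theta> s))) = p" by (auto simp: p_def)
    moreover have "(cos (\<theta> s) * \<omega> (\<theta> s)) * (- r * \<omega> (\<theta> s)) = - g' (v s) / 2"
    proof -
      have o2: "\<omega> (\<theta> s) * \<omega> (\<theta> s) = k (v s)" using kpos[OF w, of "\<theta> s"] by (simp add: \<omega>_def v_def)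
      have br: "b - a = 2 * r" by (simp add: r_def)
      have "(cos (\<theta> s))\<^sup>2 = 1" using s0 sin_cos_squared_add[of "\<theta> s"] by simp
      then have "cos (\<theta> s) = 1 \<or> cos (\<theta> s) = - 1" by (simp add: power2_eq_1_iff)
      then show ?thesis
      proof
        assume c1: "cos (\<theta> s) = 1"
        then have va: "v s = a" by (simp add: v_def w_def cr)
        show ?thesis using o2 r unfolding c1 va ka br by (simp add: field_simps)
      next
        assume c1: "cos (\<theta> s) = - 1"
        then have va: "v s = b" by (simp add: v_def w_def cr)
        show ?thesis using o2 r unfolding c1 va kb br by (simp add: field_simps)
      qed
    qed
    ultimately show ?thesis by (simp only:)
  qed
  \<comment> \<open>The time of the first half turn as a function of position. Being continuous on
    the closed interval with derivative \<open>1 / sqrt g\<close> inside, it stands in for the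
    improper integral for the half period.\<close>
  define t where "t x = \<tau> (arccos ((c - x) / r))" for x
  have u: "(c - x) / r \<in> {-1..1}" if "x \<in> {a..b}" for x
    using that r unfolding cr[symmetric] by (simp add: field_simps)
  have u': "-1 < (c - x) / r" "(c - x) / r < 1" if "a < x" "x < b" for x
    using that r unfolding cr[symmetric] by (simp_all add: field_simps)
  have warc: "w (arccos ((c - x) / r)) = x" if "x \<in> {a..b}" for x
    using u[OF that] r by (simp add: w_def cos_arccos)
  show ?thesis
  proof
    show "T > 0" by (rule T)
    show "(v has_real_derivative - p s) (at s)" for s by (rule dv)
    show "(p has_real_derivative - g' (v s) / 2) (at s)" for s by (rule dp)
    show "v (s + T) = v s" "p (s + T) = p s" for s
      by (simp_all add: v_def p_def \<theta>per \<omega>_def w_def)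
    show "range (\<lambda>s. (v s, p s)) = {(w, q). a \<le> w \<and> w \<le> b \<and> q\<^sup>2 = g w}"
    proof (intro equalityI subsetI)
      fix z assume "z \<in> range (\<lambda>s. (v s, p s))"
      then show "z \<in> {(w, q). a \<le> w \<and> w \<le> b \<and> q\<^sup>2 = g w}"
        using w p2 by (auto simp: v_def)
    next
      fix z assume "z \<in> {(w, q). a \<le> w \<and> w \<le> b \<and> q\<^sup>2 = g w}"
      then obtain x q where z: "z = (x, q)" and x: "x \<in> {a..b}" and q: "q\<^sup>2 = g x" by auto
      define \<theta>0 where "\<theta>0 = arccos ((c - x) / r)"
      define s1 s2 where "s1 = \<tau> \<theta>0" and "s2 = \<tau> (- \<theta>0)"
      have v: "v s1 = x" "v s2 = x" using warc[OF x] by (simp_all add: v_def s1_def s2_def \<theta>\<tau> \<theta>0_def w_def)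
      \<comment> \<open>Opposite angles give the same position with opposite velocities, so the two
        phases cover both signs of \<open>q\<close>.\<close>
      have "p s2 = - p s1" by (simp add: p_def s1_def s2_def \<theta>\<tau> \<omega>_def w_def)
      moreover have "(p s1)\<^sup>2 = q\<^sup>2" using p2[of s1] v q by simp
      then have "q = p s1 \<or> q = - p s1" by (metis power2_eq_iff)
      ultimately have "z = (v s1, p s1) \<or> z = (v s2, p s2)" using v z by auto
      then show "z \<in> range (\<lambda>s. (v s, p s))" by auto
    qed
    have "\<theta> 0 = 0" using \<theta>\<tau>[of 0] by (simp add: \<tau>0)
    then show "v 0 = a" by (simp add: v_def w_def cr)
    show "T \<le> s" if "s > 0" "v s = a" for s
    proof -
      have "r * cos (\<theta> s) = r * 1" using that(2) cr(1) unfolding v_def w_def by linarith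
      then have "cos (\<theta> s) = 1" using r by simp
      then obtain n :: int where n: "\<theta> s = n * 2 * pi" by (auto simp: cos_one_2pi_int)
      have "\<theta> s > 0" using \<tau>mono[of "\<theta> s" 0] that(1) \<theta>[of s] \<tau>0
        by (metis \<theta>\<tau> less_asym linorder_neqE_linordered_idom)
      then have "n \<ge> 1" using n by (simp add: zero_less_mult_iff)
      then have "1 * (2 * pi) \<le> real_of_int n * (2 * pi)" by (intro mult_right_mono) auto
      then have "2 * pi \<le> \<theta> s" unfolding n by simp
      then have "\<tau> (2 * pi) \<le> \<tau> (\<theta> s)" using \<tau>mono by (metis less_eq_real_def)
      then show ?thesis by (simp add: T_def \<theta>)
    qed
    have "continuous_on UNIV \<tau>" using \<tau>cont by (simp add: continuous_at_imp_continuous_on)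
    then show "continuous_on {a..b} t" unfolding t_def
      by (rule continuous_on_compose2) (use u r in \<open>auto intro!: continuous_intros\<close>)
    show "t a = 0" using r cr by (simp add: t_def \<tau>0 field_simps)
    show "t b = T / 2"
    proof -
      have "(c - b) / r = - 1" using r cr(2) by (simp add: field_simps)
      then show ?thesis by (simp add: t_def \<tau>pi)
    qed
    show "(t has_real_derivative 1 / sqrt (g x)) (at x)" if x: "a < x" "x < b" for x
    proof -
      define y where "y = (c - x) / r"
      have y: "-1 < y" "y < 1" using u'[OF x] by (auto simp: y_def)
      have "((\<lambda>x. (c - x) / r) has_real_derivative - 1 / r) (at x)"
        using r by (auto intro!: derivative_eq_intros)
      then have "((\<lambda>x. arccos ((c - x) / r)) has_real_derivative inverse (- sqrt (1 - y\<^sup>2)) * (- 1 / r)) (at x)"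
        unfolding y_def by (intro DERIV_chain2[OF DERIV_arccos] u'[OF x])
      then have "(t has_real_derivative 1 / \<omega> (arccos y) * (inverse (- sqrt (1 - y\<^sup>2)) * (- 1 / r))) (at x)"
        unfolding t_def[abs_def] y_def by (rule DERIV_chain2[OF \<tau>])
      moreover have "1 / \<omega> (arccos y) * (inverse (- sqrt (1 - y\<^sup>2)) * (- 1 / r)) = 1 / sqrt (g x)"
      proof -
        have o: "\<omega> (arccos y) = sqrt (k x)" using warc[of x] x by (simp add: \<omega>_def y_def)
        have "(x - a) * (b - x) = r\<^sup>2 * (1 - y\<^sup>2)"
          unfolding y_def cr[symmetric] using r by (simp add: field_simps power2_eq_square)
        then have "sqrt (g x) = r * sqrt (1 - y\<^sup>2) * sqrt (k x)"
          using gk[of x] x r by (simp add: real_sqrt_mult)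
        then show ?thesis unfolding o by (simp add: inverse_eq_divide)
      qed
      ultimately show ?thesis by simp
    qed
  qed
qed

section \<open>Uniqueness of integral curves\<close>

text \<open>Gronwall for the squared distance \<open>f\<close>:
  \<open>f s * exp (- 2 * K * s)\<close> is nonincreasing. A Lipschitz constant is available only on
  bounded sets; the two arcs over \<open>{t0..t}\<close> are compact, which provides
  \<open>M\<close>.\<close>

lemma integral_curve_unique_forward:
  fixes X :: vector_field
  assumes lip: "\<And>M. \<exists>K. \<forall>p q. norm p \<le> M \<longrightarrow> norm q \<le> M \<longrightarrow> norm (X p - X q) \<le> K * norm (p - q)"
    and \<phi>: "integral_curve X \<phi>" and \<psi>: "integral_curve X \<psi>"
    and eq: "\<phi> t0 = \<psi> t0" and t: "t0 \<le> t"
  shows "\<phi> t = \<psi> t"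
proof -
  have d: "(\<phi> has_vector_derivative X (\<phi> s)) (at s)" "(\<psi> has_vector_derivative X (\<psi> s)) (at s)" for s
    using \<phi> \<psi> by (auto simp: integral_curve_def)
  have "continuous_on {t0..t} \<phi>" "continuous_on {t0..t} \<psi>"
    using d by (auto intro!: continuous_at_imp_continuous_on has_vector_derivative_continuous)
  then have "bounded (\<phi> ` {t0..t} \<union> \<psi> ` {t0..t})"
    by (intro compact_imp_bounded compact_Un compact_continuous_image) auto
  then obtain M where M: "\<And>s. s \<in> {t0..t} \<Longrightarrow> norm (\<phi> s) \<le> M" "\<And>s. s \<in> {t0..t} \<Longrightarrow> norm (\<psi> s) \<le> M"
    unfolding bounded_iff by blast
  from lip[of M] obtain K where K: "\<And>p q. norm p \<le> M \<Longrightarrow> norm q \<le> M \<Longrightarrow> norm (X p - X q) \<le> K * norm (p - q)"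
    by blast
  define f where "f s = (\<phi> s - \<psi> s) \<bullet> (\<phi> s - \<psi> s)" for s
  define f' where "f' s = 2 * ((\<phi> s - \<psi> s) \<bullet> (X (\<phi> s) - X (\<psi> s)))" for s
  have df: "(f has_real_derivative f' s) (at s)" for s
  proof -
    have "((\<lambda>s. \<phi> s - \<psi> s) has_vector_derivative X (\<phi> s) - X (\<psi> s)) (at s)"
      by (intro has_vector_derivative_diff d)
    then have dd: "((\<lambda>s. \<phi> s - \<psi> s) has_derivative (\<lambda>h. h *\<^sub>R (X (\<phi> s) - X (\<psi> s)))) (at s)"
      by (simp add: has_vector_derivative_def)
    have "(f has_derivative (\<lambda>h. (\<phi> s - \<psi> s) \<bullet> (h *\<^sub>R (X (\<phi> s) - X (\<psi> s))) +
        (h *\<^sub>R (X (\<phi> s) - X (\<psi> s))) \<bullet> (\<phi> s - \<psi> s))) (at s)"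
      unfolding f_def[abs_def] by (rule has_derivative_inner[OF dd dd])
    moreover have "(\<lambda>h. (\<phi> s - \<psi> s) \<bullet> (h *\<^sub>R (X (\<phi> s) - X (\<psi> s))) +
        (h *\<^sub>R (X (\<phi> s) - X (\<psi> s))) \<bullet> (\<phi> s - \<psi> s)) = times (f' s)"
      by (auto simp: f'_def inner_commute)
    ultimately show ?thesis by (simp add: has_field_derivative_def)
  qed
  have f'_le: "f' s \<le> 2 * K * f s" if "s \<in> {t0..t}" for s
  proof -
    have "(\<phi> s - \<psi> s) \<bullet> (X (\<phi> s) - X (\<psi> s)) \<le> norm (\<phi> s - \<psi> s) * norm (X (\<phi> s) - X (\<psi> s))"
      by (rule norm_cauchy_schwarz)
    also have "\<dots> \<le> norm (\<phi> s - \<psi> s) * (K * norm (\<phi> s - \<psi> s))"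
      using K[OF M[OF that]] by (intro mult_left_mono) auto
    finally show ?thesis
      by (simp add: f'_def f_def power2_norm_eq_inner[symmetric] power2_eq_square mult.left_commute)
  qed
  define w where "w s = f s * exp (- 2 * K * s)" for s
  have "w t \<le> w t0"
  proof (rule DERIV_nonpos_imp_nonincreasing[OF t])
    fix s assume s: "t0 \<le> s" "s \<le> t"
    have "(w has_real_derivative f' s * exp (- 2 * K * s) + f s * (exp (- 2 * K * s) * (- 2 * K))) (at s)"
      unfolding w_def[abs_def] by (auto intro!: derivative_eq_intros df)
    moreover have "f' s * exp (- 2 * K * s) + f s * (exp (- 2 * K * s) * (- 2 * K)) \<le> 0"
      using mult_right_mono[OF f'_le[of s], of "exp (- 2 * K * s)"] s by (simp add: algebra_simps)
    ultimately show "\<exists>y. (w has_real_derivative y) (at s) \<and> y \<le> 0" by blast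
  qed
  also have "w t0 = 0" by (simp add: w_def f_def eq)
  finally have "f t \<le> 0" by (simp add: w_def mult_le_0_iff)
  then show ?thesis
    by (metis f_def inner_gt_zero_iff not_le right_minus_eq)
qed

text \<open>Times before \<open>t0\<close> are reached by reversing time and the field.\<close>

lemma integral_curve_unique:
  fixes X :: vector_field
  assumes lip: "\<And>M. \<exists>K. \<forall>p q. norm p \<le> M \<longrightarrow> norm q \<le> M \<longrightarrow> norm (X p - X q) \<le> K * norm (p - q)"
    and \<phi>: "integral_curve X \<phi>" and \<psi>: "integral_curve X \<psi>"
    and eq: "\<phi> t0 = \<psi> t0"
  shows "\<phi> = \<psi>"
proof
  fix t
  have rev: "integral_curve (\<lambda>p. - X p) (\<lambda>s. \<xi> (- s))" if "integral_curve X \<xi>" for \<xi>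
    unfolding integral_curve_def
  proof
    fix s
    have "(\<xi> has_vector_derivative X (\<xi> (- s))) (at (- s))"
      using that by (simp add: integral_curve_def)
    then have "(\<xi> \<circ> uminus has_vector_derivative (-1) *\<^sub>R X (\<xi> (- s))) (at s)"
      by (intro vector_diff_chain_at) (auto intro!: derivative_eq_intros)
    then show "((\<lambda>s. \<xi> (- s)) has_vector_derivative - X (\<xi> (- s))) (at s)"
      by (simp add: comp_def)
  qed
  show "\<phi> t = \<psi> t"
  proof (cases "t0 \<le> t")
    case True
    then show ?thesis by (rule integral_curve_unique_forward[OF lip \<phi> \<psi> eq])
  next
    case False
    have lip': "\<exists>K. \<forall>p q. norm p \<le> M \<longrightarrow> norm q \<le> M \<longrightarrow> norm (- X p - - X q) \<le> K * norm (p - q)" for M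
      using lip[of M] by (simp add: norm_minus_commute)
    have "\<phi> (- (- t)) = \<psi> (- (- t))"
      using eq False by (intro integral_curve_unique_forward[OF lip' rev[OF \<phi>] rev[OF \<psi>], of "- t0" "- t"]) auto
    then show ?thesis by simp
  qed
qed

lemma integral_curve_shift:
  assumes "integral_curve X \<phi>"
  shows "integral_curve X (\<lambda>t. \<phi> (t + s))"
  unfolding integral_curve_def
proof
  fix t
  have "(\<phi> has_vector_derivative X (\<phi> (t + s))) (at (t + s))"
    using assms by (simp add: integral_curve_def)
  then have "(\<phi> \<circ> (\<lambda>t. t + s) has_vector_derivative 1 *\<^sub>R X (\<phi> (t + s))) (at t)"
    by (intro vector_diff_chain_at) (auto intro!: derivative_eq_intros)
  then show "((\<lambda>t. \<phi> (t + s)) has_vector_derivative X (\<phi> (t + s))) (at t)"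
    by (simp add: comp_def)
qed

lemma abs_mult_diff_le:
  fixes a b c d M :: real
  assumes "\<bar>a\<bar> \<le> M" "\<bar>d\<bar> \<le> M"
  shows "\<bar>a * b - c * d\<bar> \<le> M * (\<bar>b - d\<bar> + \<bar>a - c\<bar>)"
proof -
  have "a * b - c * d = a * (b - d) + (a - c) * d" by (simp add: algebra_simps)
  also have "\<bar>\<dots>\<bar> \<le> \<bar>a\<bar> * \<bar>b - d\<bar> + \<bar>a - c\<bar> * \<bar>d\<bar>"
    by (metis abs_mult abs_triangle_ineq)
  also have "\<dots> \<le> M * \<bar>b - d\<bar> + \<bar>a - c\<bar> * M"
    using assms by (intro add_mono mult_right_mono mult_left_mono) auto
  finally show ?thesis by (simp add: algebra_simps)
qed

lemma loud_lipschitz: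
  "\<exists>K. \<forall>p q. norm p \<le> M \<longrightarrow> norm q \<le> M \<longrightarrow> norm (loud \<mu> p - loud \<mu> q) \<le> K * norm (p - q)"
proof -
  obtain D F where \<mu>: "\<mu> = (D, F)" by (cases \<mu>)
  define K where "K = 2 + 2 * M + 2 * \<bar>D\<bar> * M + 2 * \<bar>F\<bar> * M"
  have "norm (loud \<mu> p - loud \<mu> q) \<le> K * norm (p - q)" if pq: "norm p \<le> M" "norm q \<le> M" for p q
  proof -
    obtain x y where p: "p = (x, y)" by (cases p)
    obtain u v where q: "q = (u, v)" by (cases q)
    define n where "n = norm (p - q)"
    have M: "M \<ge> 0" using pq(1) norm_ge_zero order_trans by blast
    have b: "\<bar>x\<bar> \<le> M" "\<bar>y\<bar> \<le> M" "\<bar>u\<bar> \<le> M" "\<bar>v\<bar> \<le> M"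
      using pq norm_fst_le[of x y] norm_snd_le[of y x] norm_fst_le[of u v] norm_snd_le[of v u] p q
      by auto
    have n: "\<bar>x - u\<bar> \<le> n" "\<bar>y - v\<bar> \<le> n"
      using norm_fst_le[of "x - u" "y - v"] norm_snd_le[of "y - v" "x - u"] by (auto simp: n_def p q)
    have sq: "\<bar>x * y - u * v\<bar> \<le> M * (n + n)" "\<bar>x * x - u * u\<bar> \<le> M * (n + n)" "\<bar>y * y - v * v\<bar> \<le> M * (n + n)"
      using order_trans[OF abs_mult_diff_le mult_left_mono[OF add_mono M]] b n by blast+
    have 1: "\<bar>(- y + x * y) - (- v + u * v)\<bar> \<le> n + 2 * M * n"
      using sq(1) n(2) by (simp only: distrib_left)
    have "\<bar>D * (x * x) - D * (u * u)\<bar> \<le> \<bar>D\<bar> * (2 * M * n)" "\<bar>F * (y * y) - F * (v * v)\<bar> \<le> \<bar>F\<bar> * (2 * M * n)"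
      using mult_left_mono[OF sq(2), of "\<bar>D\<bar>"] mult_left_mono[OF sq(3), of "\<bar>F\<bar>"]
      by (simp_all add: abs_mult[symmetric] right_diff_distrib algebra_simps)
    then have 2: "\<bar>(x + D * (x * x) + F * (y * y)) - (u + D * (u * u) + F * (v * v))\<bar> \<le> n + \<bar>D\<bar> * (2 * M * n) + \<bar>F\<bar> * (2 * M * n)"
      using n(1) by linarith
    have "norm (loud \<mu> p - loud \<mu> q) \<le> \<bar>(- y + x * y) - (- v + u * v)\<bar> +
        \<bar>(x + D * (x * x) + F * (y * y)) - (u + D * (u * u) + F * (v * v))\<bar>"
      by (simp add: loud_def \<mu> p q norm_Pair order_trans[OF sqrt_sum_squares_le_sum_abs]
          power2_eq_square[of x] power2_eq_square[of y] power2_eq_square[of u] power2_eq_square[of v])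
    also have "\<dots> \<le> K * n" using 1 2 by (simp add: K_def algebra_simps)
    finally show ?thesis by (simp add: n_def)
  qed
  then show ?thesis by blast
qed

lemmas loud_unique = integral_curve_unique[of "loud \<mu>" for \<mu>, OF loud_lipschitz]

section \<open>The first integral of the Loud center\<close>

text \<open>The polynomial solution of \<open>m * q + v * q' = 2 * loud_N D v\<close>, found by
  comparing coefficients. Along trajectories \<open>p\<^sup>2\<close> as a function of
  \<open>v\<close> satisfies this same linear equation, and \<open>v powr (- m)\<close> solves the
  homogeneous one, so \<open>p\<^sup>2 = loud_q D F v - \<eta> * v powr (- m)\<close> on each
  orbit.\<close>

definition loud_q :: "real \<Rightarrow> real \<Rightarrow> real \<Rightarrow> real" where
  "loud_q D F v = - D / (F - 1) + (2 + 4 * D) / (2 * F - 1) * v - (1 + D) / F * v\<^sup>2"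

definition loud_q' :: "real \<Rightarrow> real \<Rightarrow> real \<Rightarrow> real" where
  "loud_q' D F v = (2 + 4 * D) / (2 * F - 1) - 2 * ((1 + D) / F) * v"

text \<open>For \<open>x = 1 - 1 / v\<close> one has
  \<open>x + D * x\<^sup>2 = - loud_N D v / v\<^sup>2\<close>; the zero \<open>v = 1\<close> is the
  center.\<close>

definition loud_N :: "real \<Rightarrow> real \<Rightarrow> real" where
  "loud_N D v = (1 - v) * ((1 + D) * v - D)"

text \<open>The positive zero of \<^term>\<open>loud_q D F\<close>, with rationalized numerator because the leading
  coefficient vanishes for \<open>D = -1\<close>.\<close>

definition loud_vmax :: "real \<Rightarrow> real \<Rightarrow> real" where
  "loud_vmax D F = (2 * (- D / (F - 1))) / (- ((2 + 4 * D) / (2 * F - 1)) +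
     sqrt (((2 + 4 * D) / (2 * F - 1))\<^sup>2 + 4 * (- D / (F - 1)) * ((1 + D) / F)))"

locale loud_center =
  fixes D F :: real
  assumes F: "F > 1" and D: "D < 0" and DF: "D + F > 0"
begin

definition "m = 2 * F - 2"

lemma m: "m > 0" "F = 1 + m / 2" using F by (simp_all add: m_def field_simps)

lemma coeffs:
  obtains a b g where "a > 0" "a * (F - 1) = - D" "b * (2 * F - 1) = 2 + 4 * D" "g * F = 1 + D"
    "\<And>v. loud_q D F v = a + b * v - g * v\<^sup>2" "\<And>v. loud_q' D F v = b - 2 * g * v"
proof
  show "- D / (F - 1) > 0" using F D by (simp add: divide_neg_pos)
  show "- D / (F - 1) * (F - 1) = - D" "(2 + 4 * D) / (2 * F - 1) * (2 * F - 1) = 2 + 4 * D"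
    "(1 + D) / F * F = 1 + D" using F by simp_all
qed (simp_all add: loud_q_def loud_q'_def)

lemma q_deriv: "(loud_q D F has_real_derivative loud_q' D F v) (at v)"
proof -
  obtain a b g where "\<And>v. loud_q D F v = a + b * v - g * v\<^sup>2" "\<And>v. loud_q' D F v = b - 2 * g * v"
    by (rule coeffs) blast
  then have *: "loud_q D F = (\<lambda>v. a + b * v - g * v\<^sup>2)" "loud_q' D F v = b - 2 * g * v" by auto
  show ?thesis unfolding * by (auto intro!: derivative_eq_intros)
qed

lemma q_N: "m * loud_q D F v + v * loud_q' D F v = 2 * loud_N D v"
proof -
  obtain a b g where abg: "a * (F - 1) = - D" "b * (2 * F - 1) = 2 + 4 * D" "g * F = 1 + D"
    and q: "\<And>v. loud_q D F v = a + b * v - g * v\<^sup>2" "\<And>v. loud_q' D F v = b - 2 * g * v"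
    by (rule coeffs) blast
  have "m * loud_q D F v + v * loud_q' D F v = 2 * (a * (F - 1)) + (b * (2 * F - 1)) * v - 2 * (g * F) * v\<^sup>2"
    unfolding q m_def by (simp add: algebra_simps power2_eq_square)
  then show ?thesis unfolding abg by (simp add: loud_N_def algebra_simps power2_eq_square)
qed

lemma q_pos_at_1: "loud_q D F 1 > 0"
proof -
  obtain a b g where abg: "a * (F - 1) = - D" "b * (2 * F - 1) = 2 + 4 * D" "g * F = 1 + D"
    and q: "\<And>v. loud_q D F v = a + b * v - g * v\<^sup>2"
    by (rule coeffs) blast
  have "loud_q D F 1 * ((F - 1) * (2 * F - 1) * F) =
      (a * (F - 1)) * ((2 * F - 1) * F) + (b * (2 * F - 1)) * ((F - 1) * F) - (g * F) * ((F - 1) * (2 * F - 1))"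
    unfolding q by (simp add: algebra_simps)
  also have "\<dots> = F - 1 - D" unfolding abg by (simp add: algebra_simps)
  finally have "loud_q D F 1 * ((F - 1) * (2 * F - 1) * F) = F - 1 - D" .
  moreover have "F - 1 - D > 0" "(F - 1) * (2 * F - 1) * F > 0" using F D by simp_all
  ultimately show ?thesis by (metis zero_less_mult_pos2)
qed

text \<open>In the variable \<open>z = 1 / v\<close> the polynomial becomes
  \<open>(a * z\<^sup>2 + b * z - g) / z\<^sup>2\<close> with \<open>a > 0\<close> for every
  admissible \<open>D\<close>. The larger root \<open>z\<close> of the numerator is shown to lie
  strictly between 0 and 1, and \<open>loud_vmax D F = 1 / z\<close>.\<close>

lemma vmax:
  shows vmax_gt_1: "loud_vmax D F > 1"
    and q_vmax: "loud_q D F (loud_vmax D F) = 0"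
    and q_pos: "\<And>v. 0 \<le> v \<Longrightarrow> v < loud_vmax D F \<Longrightarrow> loud_q D F v > 0"
    and q'_vmax: "loud_q' D F (loud_vmax D F) < 0"
proof -
  define a b g where "a = - D / (F - 1)" and "b = (2 + 4 * D) / (2 * F - 1)" and "g = (1 + D) / F"
  define \<Delta> where "\<Delta> = b\<^sup>2 + 4 * a * g"
  define z where "z = (- b + sqrt \<Delta>) / (2 * a)"
  have a: "a > 0" using F D by (simp add: a_def divide_neg_pos)
  have q: "loud_q D F v = a + b * v - g * v\<^sup>2" for v by (simp add: loud_q_def a_def b_def g_def)
  have q': "loud_q' D F v = b - 2 * g * v" for v by (simp add: loud_q'_def b_def g_def)
  \<comment> \<open>After clearing denominators the discriminant factors as
    \<open>4 * (F - 1 - D) * (F + D)\<close>, so its sign rests on \<open>D + F > 0\<close>.\<close>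
  have \<Delta>: "\<Delta> > 0"
  proof -
    have "\<Delta> * ((2 * F - 1)\<^sup>2 * F * (F - 1)) = 4 * (F - 1 - D) * (F + D)"
    proof -
      have "b * (2 * F - 1) = 2 + 4 * D" "a * (F - 1) = - D" "g * F = 1 + D"
        using F by (simp_all add: a_def b_def g_def)
      moreover have "\<Delta> * ((2 * F - 1)\<^sup>2 * F * (F - 1)) =
          (b * (2 * F - 1))\<^sup>2 * F * (F - 1) + 4 * (a * (F - 1)) * (g * F) * (2 * F - 1)\<^sup>2"
        by (simp add: \<Delta>_def algebra_simps power2_eq_square)
      ultimately show ?thesis by (simp only:) (simp add: algebra_simps power2_eq_square)
    qed
    moreover have "4 * (F - 1 - D) * (F + D) > 0" "(2 * F - 1)\<^sup>2 * F * (F - 1) > 0"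
      using F D DF by simp_all
    ultimately show ?thesis by (metis zero_less_mult_pos2)
  qed
  have r: "(sqrt \<Delta>)\<^sup>2 = \<Delta>" "sqrt \<Delta> > 0" using \<Delta> by simp_all
  have z2: "a * z\<^sup>2 + b * z - g = 0"
  proof -
    have "4 * a * (a * z\<^sup>2 + b * z - g) = (2 * a * z)\<^sup>2 + 2 * b * (2 * a * z) - 4 * a * g"
      by (simp add: algebra_simps power2_eq_square)
    also have "2 * a * z = - b + sqrt \<Delta>" using a by (simp add: z_def)
    also have "(- b + sqrt \<Delta>)\<^sup>2 + 2 * b * (- b + sqrt \<Delta>) - 4 * a * g = (sqrt \<Delta>)\<^sup>2 - b\<^sup>2 - 4 * a * g"
      by (simp add: algebra_simps power2_eq_square)
    also have "\<dots> = 0" using r by (simp add: \<Delta>_def)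
    finally show ?thesis using a by simp
  qed
  have z0: "z > 0"
  proof (cases "b < 0")
    case True
    then have "- b + sqrt \<Delta> > 0" using r(2) by linarith
    then show ?thesis unfolding z_def using a by (intro divide_pos_pos) auto
  next
    case False
    then have "D \<ge> - 1 / 2" using F by (simp add: b_def zero_le_divide_iff not_less)
    then have "g > 0" using F by (simp add: g_def)
    then have "b\<^sup>2 < \<Delta>" using a by (simp add: \<Delta>_def)
    then have "b < sqrt \<Delta>" using False by (simp add: real_less_rsqrt)
    then show ?thesis unfolding z_def using a by (intro divide_pos_pos) auto
  qed
  have tz: "2 * a * z + b = sqrt \<Delta>" using a by (simp add: z_def)
  have z1: "z < 1"
  proof (rule ccontr)
    assume "\<not> z < 1"
    \<comment> \<open>At \<open>z = 1\<close> the numerator has value \<open>loud_q D F 1\<close>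
      and slope \<open>2 * a + b\<close>. As \<open>loud_N\<close> vanishes at 1, \<open>q_N\<close>
      makes the slope \<open>(m + 2) * loud_q D F 1\<close>. With both positive there is no zero in
      \<open>z \<ge> 1\<close>.\<close>
    have "2 * a + b > 0"
    proof -
      have "m * loud_q D F 1 + loud_q' D F 1 = 0" using q_N[of 1] by (simp add: loud_N_def)
      then have "2 * a + b = (m + 2) * loud_q D F 1" unfolding q q' by (simp add: algebra_simps)
      then show ?thesis using m q_pos_at_1 by simp
    qed
    have "a + b - g > 0" using q_pos_at_1 by (simp add: q)
    moreover have "a * z\<^sup>2 + b * z - g - (a + b - g) = (z - 1) * (a * (z - 1) + (2 * a + b))"
      by (simp add: algebra_simps power2_eq_square)
    moreover have "(z - 1) * (a * (z - 1) + (2 * a + b)) \<ge> 0"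
      using \<open>\<not> z < 1\<close> a \<open>2 * a + b > 0\<close> mult_nonneg_nonneg[of a "z - 1"]
      by (intro mult_nonneg_nonneg) linarith+
    ultimately show False using z2 by linarith
  qed
  have v: "loud_vmax D F = 1 / z"
    by (simp add: loud_vmax_def z_def \<Delta>_def a_def b_def g_def)
  show "loud_vmax D F > 1" unfolding v using z0 z1 by simp
  have "loud_q D F (1 / z) = (a * z\<^sup>2 + b * z - g) / z\<^sup>2"
    using z0 unfolding q by (simp add: field_simps power2_eq_square)
  then show "loud_q D F (loud_vmax D F) = 0" by (simp add: v z2)
  have "loud_q' D F (1 / z) * z = b * z - 2 * g" using z0 unfolding q' by (simp add: field_simps)
  also have "\<dots> = - z * (2 * a * z + b)" using z2 by (simp add: algebra_simps power2_eq_square)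
  also have "\<dots> < 0" unfolding tz using z0 r by (simp add: mult_neg_pos)
  finally show "loud_q' D F (loud_vmax D F) < 0" using z0 by (simp add: v mult_less_0_iff)
  show "loud_q D F w > 0" if w: "0 \<le> w" "w < loud_vmax D F" for w
  proof -
    have wz: "w * z < 1" using w z0 by (simp add: v field_simps)
    have "loud_q D F w = (1 - w * z) * (a + w * (a * z + b))"
    proof -
      have g: "g = a * z\<^sup>2 + b * z" using z2 by simp
      show ?thesis unfolding q g by (simp add: algebra_simps power2_eq_square)
    qed
    moreover have "a + w * (a * z + b) > 0"
    proof -
      have "a + w * (a * z + b) = a * (1 - w * z) + w * (2 * a * z + b)" by (simp add: algebra_simps)
      moreover have "a * (1 - w * z) > 0" using a wz by simp
      moreover have "w * (2 * a * z + b) \<ge> 0" unfolding tz using r w by simp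
      ultimately show ?thesis by linarith
    qed
    ultimately show ?thesis using wz by simp
  qed
qed

text \<open>The factor is affine in \<open>v\<close>, equals \<open>- D > 0\<close> at 0, and is
  positive at \<open>loud_vmax D F\<close>, where \<open>q_N\<close> reduces to
  \<open>2 * loud_N = v * loud_q' < 0\<close>.\<close>

lemma N_factor_pos: "0 \<le> v \<Longrightarrow> v \<le> loud_vmax D F \<Longrightarrow> (1 + D) * v - D > 0"
proof -
  assume v: "0 \<le> v" "v \<le> loud_vmax D F"
  have "2 * loud_N D (loud_vmax D F) = loud_vmax D F * loud_q' D F (loud_vmax D F)" using q_N[of "loud_vmax D F"] by (simp add: q_vmax)
  also have "\<dots> < 0" using q'_vmax vmax_gt_1 by (simp add: mult_pos_neg)
  finally have *: "(1 + D) * loud_vmax D F - D > 0"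
    using vmax_gt_1 by (simp add: loud_N_def mult_less_0_iff)
  show ?thesis
  proof (cases "1 + D \<ge> 0")
    case True
    then show ?thesis using v D by (smt (verit) mult_nonneg_nonneg)
  next
    case False
    then have "(1 + D) * loud_vmax D F \<le> (1 + D) * v" using v by (intro mult_left_mono_neg) auto
    then show ?thesis using * by linarith
  qed
qed

lemma N_pos: "0 \<le> v \<Longrightarrow> v < 1 \<Longrightarrow> loud_N D v > 0"
  using N_factor_pos[of v] vmax_gt_1 by (simp add: loud_N_def)

lemma N_neg: "1 < v \<Longrightarrow> v \<le> loud_vmax D F \<Longrightarrow> loud_N D v < 0"
  using N_factor_pos[of v] by (simp add: loud_N_def mult_neg_pos)

text \<open>The first integral on the axis \<open>p = 0\<close>. It rises from 0 at
  \<open>v = 0\<close> to its maximum at the center \<open>v = 1\<close> and falls back to 0 at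
  \<open>loud_vmax D F\<close>, so each level below the maximum has exactly two turning
  points.\<close>

definition e :: "real \<Rightarrow> real" where "e v = v powr m * loud_q D F v"

lemma e_deriv:
  assumes "v > 0"
  shows "(e has_real_derivative 2 * v powr (m - 1) * loud_N D v) (at v)"
proof -
  have "((\<lambda>v. v powr m * loud_q D F v) has_real_derivative m * v powr (m - 1) * loud_q D F v + loud_q' D F v * v powr m) (at v)"
    using assms by (intro DERIV_mult q_deriv has_real_derivative_powr)
  moreover have "v powr m = v powr (m - 1) * v"
    using assms by (simp add: powr_diff)
  then have "m * v powr (m - 1) * loud_q D F v + loud_q' D F v * v powr m = v powr (m - 1) * (m * loud_q D F v + v * loud_q' D F v)"
    by (simp add: algebra_simps)
  ultimately show ?thesis unfolding q_N e_def[abs_def] by (simp add: algebra_simps)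
qed

lemma e_isCont: "v > 0 \<Longrightarrow> isCont e v" using e_deriv by (blast intro: DERIV_isCont)

lemma e_0: "e 0 = 0" by (simp add: e_def)

lemma e_vmax: "e (loud_vmax D F) = 0" by (simp add: e_def q_vmax)

definition c :: real where "c = e 1"

lemma c_pos: "c > 0" using q_pos_at_1 by (simp add: c_def e_def)

lemma e_pos: "0 < v \<Longrightarrow> v < loud_vmax D F \<Longrightarrow> e v > 0"
  using q_pos[of v] by (simp add: e_def)

lemma e_cont: "continuous_on {0..} e"
  unfolding e_def[abs_def] using m
  by (intro continuous_intros continuous_on_powr' DERIV_continuous_on[OF has_field_derivative_at_within[OF q_deriv]]) auto

lemma e_strict_mono: "0 \<le> v \<Longrightarrow> v < w \<Longrightarrow> w \<le> 1 \<Longrightarrow> e v < e w"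
proof (rule DERIV_pos_imp_increasing_open[where f=e])
  fix x assume "0 \<le> v" "w \<le> 1" "v < x" "x < w"
  then have "2 * x powr (m - 1) * loud_N D x > 0" using N_pos[of x] by simp
  then show "\<exists>y. (e has_real_derivative y) (at x) \<and> y > 0"
    using e_deriv[of x] \<open>0 \<le> v\<close> \<open>v < x\<close> by auto
qed (auto intro: continuous_on_subset[OF e_cont])

lemma e_strict_antimono: "1 \<le> v \<Longrightarrow> v < w \<Longrightarrow> w \<le> loud_vmax D F \<Longrightarrow> e w < e v"
proof (rule DERIV_neg_imp_decreasing_open[where f=e])
  fix x assume "1 \<le> v" "w \<le> loud_vmax D F" "v < x" "x < w"
  then have "2 * x powr (m - 1) * loud_N D x < 0" using N_neg[of x] by (simp add: mult_pos_neg)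
  then show "\<exists>y. (e has_real_derivative y) (at x) \<and> y < 0"
    using e_deriv[of x] \<open>1 \<le> v\<close> \<open>v < x\<close> by auto
qed (auto intro: continuous_on_subset[OF e_cont])

lemma e_le_c:
  assumes "0 \<le> v" "v \<le> loud_vmax D F"
  shows "e v \<le> c" and "e v = c \<longleftrightarrow> v = 1"
  using e_strict_mono[of v 1] e_strict_antimono[of 1 v] assms
  by (cases v "1 :: real" rule: linorder_cases; force simp: c_def)+

end

section \<open>Turning points of a level and the flow along it\<close>

context loud_center
begin

definition "vl = the_inv_into {0<..<1} e"
definition "vr = the_inv_into {1<..<loud_vmax D F} e"

lemma inj_e: "inj_on e {0<..<1}" "inj_on e {1<..<loud_vmax D F}"
  by (rule inj_onI; rename_tac x y; metis e_strict_mono greaterThanLessThan_iff less_eq_real_def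
        less_irrefl linorder_neqE_linordered_idom)
     (rule inj_onI; rename_tac x y; metis e_strict_antimono greaterThanLessThan_iff less_eq_real_def
        less_irrefl linorder_neqE_linordered_idom)

lemma e_image: "e ` {0<..<1} = {0<..<c}" "e ` {1<..<loud_vmax D F} = {0<..<c}"
proof -
  show "e ` {0<..<1} = {0<..<c}"
  proof (intro equalityI subsetI)
    fix y assume y: "y \<in> {0<..<c}"
    have "continuous_on {0..1} e" by (rule continuous_on_subset[OF e_cont]) auto
    then obtain x where x: "0 \<le> x" "x \<le> 1" "e x = y"
      using IVT'[of e 0 y 1] y by (auto simp: e_0 c_def)
    then have "x \<noteq> 0" "x \<noteq> 1" using y by (auto simp: e_0 c_def)
    then show "y \<in> e ` {0<..<1}" using x by force
  qed (use e_strict_mono[of _ 1] e_pos vmax_gt_1 in \<open>force simp: c_def\<close>)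
  show "e ` {1<..<loud_vmax D F} = {0<..<c}"
  proof (intro equalityI subsetI)
    fix y assume y: "y \<in> {0<..<c}"
    have "continuous_on {1..loud_vmax D F} e" by (rule continuous_on_subset[OF e_cont]) auto
    then obtain x where x: "1 \<le> x" "x \<le> loud_vmax D F" "e x = y"
      using IVT2'[of e "loud_vmax D F" y 1] y vmax_gt_1 by (auto simp: e_vmax c_def)
    then have "x \<noteq> loud_vmax D F" "x \<noteq> 1" using y by (auto simp: e_vmax c_def)
    then show "y \<in> e ` {1<..<loud_vmax D F}" using x by force
  qed (use e_strict_antimono[of 1] e_pos in \<open>force simp: c_def\<close>)
qed

lemma vl: "0 < \<eta> \<Longrightarrow> \<eta> < c \<Longrightarrow> 0 < vl \<eta> \<and> vl \<eta> < 1 \<and> e (vl \<eta>) = \<eta>"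
  using the_inv_into_into[OF inj_e(1), of \<eta> "{0<..<1}"] f_the_inv_into_f[OF inj_e(1), of \<eta>]
  by (auto simp: e_image vl_def)

lemma vr: "0 < \<eta> \<Longrightarrow> \<eta> < c \<Longrightarrow> 1 < vr \<eta> \<and> vr \<eta> < loud_vmax D F \<and> e (vr \<eta>) = \<eta>"
  using the_inv_into_into[OF inj_e(2), of \<eta> "{1<..<loud_vmax D F}"] f_the_inv_into_f[OF inj_e(2), of \<eta>]
  by (auto simp: e_image vr_def)

lemma vl_e: "0 < v \<Longrightarrow> v < 1 \<Longrightarrow> vl (e v) = v"
  by (simp add: vl_def the_inv_into_f_f[OF inj_e(1)])

lemma vr_e: "1 < v \<Longrightarrow> v < loud_vmax D F \<Longrightarrow> vr (e v) = v"
  by (simp add: vr_def the_inv_into_f_f[OF inj_e(2)])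

lemma e_gt_iff:
  assumes \<eta>: "0 < \<eta>" "\<eta> < c" and v: "0 < v" "v \<le> loud_vmax D F"
  shows "\<eta> < e v \<longleftrightarrow> vl \<eta> < v \<and> v < vr \<eta>"
    and "\<eta> \<le> e v \<longleftrightarrow> vl \<eta> \<le> v \<and> v \<le> vr \<eta>"
proof -
  note l = vl[OF \<eta>] and r = vr[OF \<eta>]
  have 1: "v < vl \<eta> \<Longrightarrow> e v < \<eta>" using e_strict_mono[of v "vl \<eta>"] l v by auto
  have 2: "vr \<eta> < v \<Longrightarrow> e v < \<eta>" using e_strict_antimono[of "vr \<eta>" v] r v by auto
  have 3: "vl \<eta> < v \<Longrightarrow> v < vr \<eta> \<Longrightarrow> \<eta> < e v"
    using e_strict_mono[of "vl \<eta>" v] e_strict_antimono[of v "vr \<eta>"] l r by (cases "v \<le> 1") auto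
  consider "v < vl \<eta>" | "v = vl \<eta>" | "vl \<eta> < v" "v < vr \<eta>" | "v = vr \<eta>" | "vr \<eta> < v" by linarith
  then have "(\<eta> < e v \<longleftrightarrow> vl \<eta> < v \<and> v < vr \<eta>) \<and> (\<eta> \<le> e v \<longleftrightarrow> vl \<eta> \<le> v \<and> v \<le> vr \<eta>)"
  proof cases
    case 1
    then show ?thesis using \<open>v < vl \<eta> \<Longrightarrow> e v < \<eta>\<close> by linarith
  next
    case 3
    then show ?thesis using \<open>vl \<eta> < v \<Longrightarrow> v < vr \<eta> \<Longrightarrow> \<eta> < e v\<close> by linarith
  next
    case 5
    then show ?thesis using \<open>vr \<eta> < v \<Longrightarrow> e v < \<eta>\<close> by linarith
  qed (use l r in auto)
  then show "\<eta> < e v \<longleftrightarrow> vl \<eta> < v \<and> v < vr \<eta>" "\<eta> \<le> e v \<longleftrightarrow> vl \<eta> \<le> v \<and> v \<le> vr \<eta>"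
    by blast+
qed

lemma isCont_inverse_branch:
  fixes f g :: "real \<Rightarrow> real"
  assumes "a < x" "x < b" "\<And>z. a < z \<Longrightarrow> z < b \<Longrightarrow> g (f z) = z" "\<And>z. a < z \<Longrightarrow> z < b \<Longrightarrow> isCont f z"
  shows "isCont g (f x)"
proof -
  define d where "d = min (x - a) (b - x) / 2"
  have d: "d > 0" "d < x - a" "d < b - x" using assms(1,2) by (auto simp: d_def min_def)
  then have "\<bar>z - x\<bar> \<le> d \<Longrightarrow> a < z \<and> z < b" for z by linarith
  with d(1) show ?thesis using assms(3,4) by (intro isCont_inverse_function[of d x g f]) auto
qed

lemma vl_deriv:
  assumes "0 < \<eta>" "\<eta> < c"
  shows "(vl has_real_derivative 1 / (2 * vl \<eta> powr (m - 1) * loud_N D (vl \<eta>))) (at \<eta>)"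
proof -
  note l = vl[OF assms]
  have "isCont vl (e (vl \<eta>))"
    by (rule isCont_inverse_branch[where f=e and a=0 and b=1]) (use l vl_e e_isCont in auto)
  moreover have "vl \<eta> > 0" "2 * vl \<eta> powr (m - 1) * loud_N D (vl \<eta>) \<noteq> 0"
    using l N_pos[of "vl \<eta>"] by auto
  ultimately show ?thesis
    unfolding inverse_eq_divide[symmetric] using assms vl[of \<eta>] vl
    by (intro DERIV_inverse_function[where f=e and a=0 and b=c] e_deriv) (simp_all only: simp_thms)
qed

lemma vr_deriv:
  assumes "0 < \<eta>" "\<eta> < c"
  shows "(vr has_real_derivative 1 / (2 * vr \<eta> powr (m - 1) * loud_N D (vr \<eta>))) (at \<eta>)"
proof -
  note r = vr[OF assms]
  have "isCont vr (e (vr \<eta>))"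
    by (rule isCont_inverse_branch[where f=e and a=1 and b="loud_vmax D F"]) (use r vr_e e_isCont in auto)
  moreover have "vr \<eta> > 0" "2 * vr \<eta> powr (m - 1) * loud_N D (vr \<eta>) \<noteq> 0"
    using r N_neg[of "vr \<eta>"] by auto
  ultimately show ?thesis
    unfolding inverse_eq_divide[symmetric] using assms vr[of \<eta>] vr
    by (intro DERIV_inverse_function[where f=e and a=0 and b=c] e_deriv) (simp_all only: simp_thms)
qed

text \<open>The value of \<open>p\<^sup>2\<close> on the level \<open>\<eta>\<close>; its zeros are
  the turning points.\<close>

definition gq :: "real \<Rightarrow> real \<Rightarrow> real" where "gq \<eta> v = loud_q D F v - \<eta> * v powr (- m)"

lemma gq_e: "v > 0 \<Longrightarrow> gq \<eta> v = v powr (- m) * (e v - \<eta>)"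
  by (simp add: gq_def e_def right_diff_distrib powr_minus field_simps)

lemma gq_deriv:
  "v > 0 \<Longrightarrow> (gq \<eta> has_real_derivative loud_q' D F v + m * (\<eta> * v powr (- m)) / v) (at v)"
  unfolding gq_def[abs_def]
  by (auto intro!: derivative_eq_intros q_deriv simp: powr_diff)

definition en :: "real \<times> real \<Rightarrow> real" where
  "en = (\<lambda>(x, y). (1 / (1 - x)) powr m * (loud_q D F (1 / (1 - x)) - (y / (1 - x))\<^sup>2))"

text \<open>The half plane corresponds to \<open>v < loud_vmax D F\<close>. It is needed because
  \<open>en\<close> can take the value \<open>\<eta>\<close> again beyond
  \<open>loud_vmax D F\<close>, for instance when \<open>D < -1\<close>.\<close>

definition orbit :: "real \<Rightarrow> (real \<times> real) set" where
  "orbit \<eta> = {(x, y). x < 1 - 1 / loud_vmax D F \<and> en (x, y) = \<eta>}"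

lemma en_chart: "v > 0 \<Longrightarrow> en (1 - 1 / v, p / v) = v powr m * (loud_q D F v - p\<^sup>2)"
  by (simp add: en_def)

lemma orbit_chart:
  assumes \<eta>: "0 < \<eta>" "\<eta> < c"
  shows "orbit \<eta> = (\<lambda>(v, p). (1 - 1 / v, p / v)) ` {(v, p). vl \<eta> \<le> v \<and> v \<le> vr \<eta> \<and> p\<^sup>2 = gq \<eta> v}"
proof (intro equalityI subsetI)
  fix z assume "z \<in> orbit \<eta>"
  then obtain x y where z: "z = (x, y)" "x < 1 - 1 / loud_vmax D F" "en (x, y) = \<eta>"
    by (auto simp: orbit_def)
  define v p where "v = 1 / (1 - x)" and "p = y / (1 - x)"
  have "1 - x > 1 / loud_vmax D F" "1 / loud_vmax D F > 0" using z vmax_gt_1 by auto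
  then have x: "1 - x > 0" by linarith
  have v: "v > 0" "v < loud_vmax D F"
    using x \<open>1 - x > 1 / loud_vmax D F\<close> vmax_gt_1 by (auto simp: v_def field_simps)
  have xy: "x = 1 - 1 / v" "y = p / v" using x by (auto simp: v_def p_def)
  then have E: "v powr m * (loud_q D F v - p\<^sup>2) = \<eta>" using z en_chart[OF v(1), of p] by simp
  then have p: "p\<^sup>2 = gq \<eta> v" using v by (simp add: gq_def powr_minus field_simps)
  then have "gq \<eta> v \<ge> 0" by (metis zero_le_power2)
  then have "\<eta> \<le> e v" unfolding gq_e[OF v(1)] using v by (simp add: zero_le_mult_iff)
  then have "vl \<eta> \<le> v \<and> v \<le> vr \<eta>" using e_gt_iff(2)[OF \<eta>] v by simp
  then show "z \<in> (\<lambda>(v, p). (1 - 1 / v, p / v)) ` {(v, p). vl \<eta> \<le> v \<and> v \<le> vr \<eta> \<and> p\<^sup>2 = gq \<eta> v}"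
    using p z(1) xy by (intro image_eqI[of _ _ "(v, p)"]) auto
next
  fix z assume "z \<in> (\<lambda>(v, p). (1 - 1 / v, p / v)) ` {(v, p). vl \<eta> \<le> v \<and> v \<le> vr \<eta> \<and> p\<^sup>2 = gq \<eta> v}"
  then obtain v p where z: "z = (1 - 1 / v, p / v)" and v: "vl \<eta> \<le> v" "v \<le> vr \<eta>" and p: "p\<^sup>2 = gq \<eta> v"
    by auto
  have v0: "0 < v" "v < loud_vmax D F" using v vl[OF \<eta>] vr[OF \<eta>] by auto
  then have "en z = \<eta>" unfolding z en_chart[OF v0(1)] p
    by (simp add: gq_def powr_minus field_simps)
  moreover have "1 - 1 / v < 1 - 1 / loud_vmax D F" using v0 by (simp add: frac_less2)
  ultimately show "z \<in> orbit \<eta>" by (simp add: orbit_def z)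
qed

text \<open>In the coordinates \<open>v\<close>, \<open>p\<close> no change of time is needed: on
  the level \<open>\<eta>\<close> the system reads \<open>v' = - p\<close>,
  \<open>p' = - g' v / 2\<close>, so \<open>oscillator\<close> applies. The turning points are
  simple zeros because \<open>v * g' v = 2 * loud_N D v - m * gq \<eta> v\<close> and
  \<open>loud_N\<close> has opposite signs on the two sides of 1.\<close>

lemma orbit_flow:
  assumes \<eta>: "0 < \<eta>" "\<eta> < c"
  obtains T \<phi> t where "T > 0" "integral_curve (loud (D, F)) \<phi>" "range \<phi> = orbit \<eta>"
    "\<And>s. \<phi> (s + T) = \<phi> s" "\<And>s. s > 0 \<Longrightarrow> \<phi> s = \<phi> 0 \<Longrightarrow> T \<le> s"
    "continuous_on {vl \<eta>..vr \<eta>} t" "t (vl \<eta>) = 0" "t (vr \<eta>) = T / 2"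
    "\<And>v. vl \<eta> < v \<Longrightarrow> v < vr \<eta> \<Longrightarrow> (t has_real_derivative 1 / sqrt (gq \<eta> v)) (at v)"
proof -
  note l = vl[OF \<eta>] and r = vr[OF \<eta>]
  define g' where "g' v = loud_q' D F v + m * (\<eta> * v powr (- m)) / v" for v
  have g'N: "g' v = (2 * loud_N D v - m * gq \<eta> v) / v" if "v > 0" for v
    using that q_N[of v] by (simp add: g'_def gq_def field_simps)
  have ge: "gq \<eta> (vl \<eta>) = 0" "gq \<eta> (vr \<eta>) = 0" using l r by (simp_all add: gq_e)
  obtain T v p t where osc: "T > 0"
    "\<And>s. (v has_real_derivative - p s) (at s)"
    "\<And>s. (p has_real_derivative - g' (v s) / 2) (at s)"
    "\<And>s. v (s + T) = v s" "\<And>s. p (s + T) = p s"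
    "range (\<lambda>s. (v s, p s)) = {(w, q). vl \<eta> \<le> w \<and> w \<le> vr \<eta> \<and> q\<^sup>2 = gq \<eta> w}"
    "v 0 = vl \<eta>" "\<And>s. s > 0 \<Longrightarrow> v s = vl \<eta> \<Longrightarrow> T \<le> s"
    "continuous_on {vl \<eta>..vr \<eta>} t" "t (vl \<eta>) = 0" "t (vr \<eta>) = T / 2"
    "\<And>w. vl \<eta> < w \<Longrightarrow> w < vr \<eta> \<Longrightarrow> (t has_real_derivative 1 / sqrt (gq \<eta> w)) (at w)"
  proof (rule oscillator[of "vl \<eta>" "vr \<eta>" "gq \<eta>" g'])
    show "(gq \<eta> has_real_derivative g' w) (at w)" if "w \<in> {vl \<eta>..vr \<eta>}" for w
      unfolding g'_def using that l by (intro gq_deriv) auto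
    show "gq \<eta> w > 0" if "vl \<eta> < w" "w < vr \<eta>" for w
      using that l r e_gt_iff(1)[OF \<eta>, of w] by (simp add: gq_e)
    show "g' (vl \<eta>) > 0" "g' (vr \<eta>) < 0"
      using l r N_pos[of "vl \<eta>"] N_neg[of "vr \<eta>"] by (simp_all add: g'N ge divide_neg_pos)
  qed (use l r ge in auto)
  have vp: "vl \<eta> \<le> v s" "v s \<le> vr \<eta>" "(p s)\<^sup>2 = gq \<eta> (v s)" for s
    using osc(6) by blast+
  have v0: "v s > 0" for s using vp(1)[of s] l by linarith
  define \<phi> where "\<phi> s = (1 - 1 / v s, p s / v s)" for s
  show ?thesis
  proof
    show "integral_curve (loud (D, F)) \<phi>" unfolding integral_curve_def
    proof
      fix s
      have v: "v s > 0" by (rule v0)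
      have dx: "((\<lambda>s. 1 - 1 / v s) has_real_derivative - p s / (v s * v s)) (at s)"
        using v by (auto intro!: derivative_eq_intros osc(2))
      have dy: "((\<lambda>s. p s / v s) has_real_derivative (- g' (v s) / 2 * v s - p s * - p s) / (v s * v s)) (at s)"
        using v by (intro DERIV_divide osc(2,3)) auto
      have "- p s / (v s * v s) = - (p s / v s) + (1 - 1 / v s) * (p s / v s)"
        using v by (simp add: field_simps)
      moreover have "(- g' (v s) / 2 * v s - p s * - p s) / (v s * v s) =
          (1 - 1 / v s) + D * (1 - 1 / v s)\<^sup>2 + F * (p s / v s)\<^sup>2"
      proof -
        have g: "g' (v s) * v s = 2 * loud_N D (v s) - m * (p s * p s)"
          using v vp(3)[of s] by (simp add: g'N power2_eq_square)
        have num: "(- g' (v s) / 2 * v s - p s * - p s) = - loud_N D (v s) + F * (p s * p s)"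
          using g by (simp add: m_def algebra_simps)
        show ?thesis unfolding num
          using v by (simp add: loud_N_def field_simps power2_eq_square)
      qed
      ultimately show "(\<phi> has_vector_derivative loud (D, F) (\<phi> s)) (at s)"
        using has_vector_derivative_Pair[OF dx[unfolded has_real_derivative_iff_has_vector_derivative]
            dy[unfolded has_real_derivative_iff_has_vector_derivative]]
        by (simp add: \<phi>_def[abs_def] loud_def)
    qed
    have "range \<phi> = (\<lambda>(v, p). (1 - 1 / v, p / v)) ` range (\<lambda>s. (v s, p s))"
      by (auto simp: \<phi>_def image_iff)
    then show "range \<phi> = orbit \<eta>" unfolding osc(6) orbit_chart[OF \<eta>] .
    show "\<phi> (s + T) = \<phi> s" for s by (simp add: \<phi>_def osc)
    show "T \<le> s" if "s > 0" "\<phi> s = \<phi> 0" for s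
      using that v0[of s] l by (intro osc(8)) (auto simp: \<phi>_def osc(7))
  qed (use osc in auto)
qed

definition period :: "real \<Rightarrow> real" where "period \<eta> = minimal_period (loud (D, F)) (orbit \<eta>)"

lemma orbit_through:
  assumes \<eta>: "0 < \<eta>" "\<eta> < c" and T: "is_period (loud (D, F)) \<gamma> T" and z: "z \<in> \<gamma>" "z \<in> orbit \<eta>"
  shows "\<gamma> = orbit \<eta>"
proof -
  obtain \<psi> where \<psi>: "integral_curve (loud (D, F)) \<psi>" "range \<psi> = \<gamma>"
    using T by (auto simp: is_period_def)
  obtain S \<phi> where \<phi>: "integral_curve (loud (D, F)) \<phi>" "range \<phi> = orbit \<eta>"
    by (rule orbit_flow[OF \<eta>]) blast
  obtain s1 s2 where s: "\<psi> s1 = z" "\<phi> s2 = z" using z unfolding \<psi>(2)[symmetric] \<phi>(2)[symmetric] by (metis imageE)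
  have "\<psi> = (\<lambda>t. \<phi> (t + (s2 - s1)))"
    by (rule loud_unique[OF \<psi>(1) integral_curve_shift[OF \<phi>(1)], of s1]) (simp add: s)
  then have "range \<psi> = range (\<lambda>t. \<phi> (t + (s2 - s1)))" by simp
  also have "\<dots> = range \<phi>"
    by (auto simp: image_iff) (metis diff_add_cancel)
  finally show ?thesis using \<psi> \<phi> by simp
qed

text \<open>\<open>minimal_period\<close> refers to every solution with this range. By uniqueness
  any such solution is a time shift of the one from \<open>orbit_flow\<close>, so each of its
  periods is a return time of the latter and is at least \<open>T\<close>.\<close>

lemma period_time:
  assumes \<eta>: "0 < \<eta>" "\<eta> < c"
  obtains t where "is_period (loud (D, F)) (orbit \<eta>) (period \<eta>)"
    "continuous_on {vl \<eta>..vr \<eta>} t" "t (vl \<eta>) = 0" "t (vr \<eta>) = period \<eta> / 2"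
    "\<And>v. vl \<eta> < v \<Longrightarrow> v < vr \<eta> \<Longrightarrow> (t has_real_derivative 1 / sqrt (gq \<eta> v)) (at v)"
proof -
  obtain T \<phi> t where f: "T > 0" "integral_curve (loud (D, F)) \<phi>" "range \<phi> = orbit \<eta>"
    "\<And>s. \<phi> (s + T) = \<phi> s" "\<And>s. s > 0 \<Longrightarrow> \<phi> s = \<phi> 0 \<Longrightarrow> T \<le> s"
    "continuous_on {vl \<eta>..vr \<eta>} t" "t (vl \<eta>) = 0" "t (vr \<eta>) = T / 2"
    "\<And>v. vl \<eta> < v \<Longrightarrow> v < vr \<eta> \<Longrightarrow> (t has_real_derivative 1 / sqrt (gq \<eta> v)) (at v)"
    by (rule orbit_flow[OF \<eta>]) (rule that; assumption)
  have T: "is_period (loud (D, F)) (orbit \<eta>) T"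
    unfolding is_period_def by (intro conjI exI[of _ \<phi>] allI f)
  have "T \<le> S" if S: "is_period (loud (D, F)) (orbit \<eta>) S" for S
  proof -
    obtain \<psi> where \<psi>: "S > 0" "integral_curve (loud (D, F)) \<psi>" "range \<psi> = orbit \<eta>" "\<forall>t. \<psi> (t + S) = \<psi> t"
      using S unfolding is_period_def by (elim conjE exE) (rule that)
    have "\<phi> 0 \<in> range \<psi>" using \<psi>(3) f(3) by blast
    then obtain s where s: "\<psi> s = \<phi> 0" by force
    have eq: "\<phi> = (\<lambda>t. \<psi> (t + s))"
      by (rule loud_unique[OF f(2) integral_curve_shift[OF \<psi>(2)], of 0]) (simp add: s)
    have "\<phi> S = \<psi> (s + S)" using fun_cong[OF eq, of S] by (simp only: add.commute)
    also have "\<dots> = \<phi> 0" by (simp only: \<psi>(4)[rule_format] s)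
    finally have "\<phi> S = \<phi> 0" .
    then show ?thesis by (intro f(5) \<psi>(1))
  qed
  then have "period \<eta> = T"
    unfolding period_def minimal_period_def by (intro Least_equality T)
  then show ?thesis
    by (intro that[of t]) (use T f(6-9) in \<open>simp_all only:\<close>)
qed

end

section \<open>The period annulus\<close>

context loud_center
begin

definition "xmax = 1 - 1 / loud_vmax D F"

lemma xmax: "0 < xmax" "xmax < 1" using vmax_gt_1 by (simp_all add: xmax_def)

lemma chart_bounds:
  assumes "x < xmax"
  shows "0 < 1 / (1 - x)" "1 / (1 - x) < loud_vmax D F"
proof -
  have "1 - x > 1 / loud_vmax D F" "1 / loud_vmax D F > 0" using assms vmax_gt_1 by (auto simp: xmax_def)
  moreover from this have "1 - x > 0" by linarith
  ultimately show "0 < 1 / (1 - x)" "1 / (1 - x) < loud_vmax D F"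
    using vmax_gt_1 by (auto simp: field_simps)
qed

lemma en_axis: "en (x, 0) = e (1 / (1 - x))"
  by (simp add: en_def e_def)

lemma en_0: "en 0 = c"
  using en_axis[of 0] by (simp add: c_def zero_prod_def)

lemma en_le_e: "en (x, y) \<le> e (1 / (1 - x))"
  unfolding en_def e_def by (auto intro!: mult_left_mono)

lemma en_eq_c_iff:
  assumes "x < xmax"
  shows "en (x, y) = c \<longleftrightarrow> (x, y) = 0" and "en (x, y) \<le> c"
proof -
  note b = chart_bounds[OF assms]
  show "en (x, y) \<le> c" using en_le_e[of x y] e_le_c[of "1 / (1 - x)"] b by linarith
  show "en (x, y) = c \<longleftrightarrow> (x, y) = 0"
  proof
    assume *: "en (x, y) = c"
    then have "e (1 / (1 - x)) = c" using en_le_e[of x y] e_le_c(1)[of "1 / (1 - x)"] b by linarith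
    then have "1 / (1 - x) = 1" using e_le_c(2)[of "1 / (1 - x)"] b by simp
    then have x: "x = 0" by simp
    then have "y = 0" using * by (simp add: en_def c_def e_def)
    then show "(x, y) = 0" using x by (simp add: zero_prod_def)
  qed (simp add: en_0)
qed

lemma en_cont: "continuous_on {z. fst z < 1} en"
proof -
  have q: "continuous_on UNIV (loud_q D F)"
    using q_deriv by (blast intro: DERIV_continuous_on has_field_derivative_at_within)
  have "continuous_on {z. fst z < 1} (\<lambda>z. (1 / (1 - fst z)) powr m *
      (loud_q D F (1 / (1 - fst z)) - (snd z / (1 - fst z))\<^sup>2))"
    by (intro continuous_intros continuous_on_compose2[OF q]) auto
  moreover have "en = (\<lambda>z. (1 / (1 - fst z)) powr m *
      (loud_q D F (1 / (1 - fst z)) - (snd z / (1 - fst z))\<^sup>2))"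
    by (auto simp: en_def)
  ultimately show ?thesis by simp
qed

definition region :: "(real \<times> real) set" where
  "region = {(x, y). x < xmax \<and> 0 < en (x, y)}"

lemma orbit_region: "0 < \<eta> \<Longrightarrow> orbit \<eta> \<subseteq> region"
  by (auto simp: orbit_def region_def xmax_def)

lemma orbit_eq: "orbit \<eta> = {z. fst z < xmax \<and> en z = \<eta>}"
  by (auto simp: orbit_def xmax_def)

lemma open_halfplane: "open {z :: real \<times> real. fst z < a}"
  by (intro open_Collect_less continuous_intros)

lemma open_en_gt: "open {z. fst z < xmax \<and> \<eta> < en z}"
proof -
  have "{z. fst z < xmax \<and> \<eta> < en z} = en -` {\<eta><..} \<inter> {z. fst z < xmax}" by auto
  moreover have "continuous_on {z. fst z < xmax} en"
    by (rule continuous_on_subset[OF en_cont]) (use xmax in auto)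
  ultimately show ?thesis
    using continuous_on_open_vimage[OF open_halfplane[of xmax], of en] by simp
qed

lemma open_region: "open region"
  using open_en_gt[of 0] by (auto simp: region_def case_prod_unfold)

lemma region_iff_orbit:
  assumes "z \<in> region" "z \<noteq> 0"
  shows "0 < en z \<and> en z < c \<and> z \<in> orbit (en z)"
  using assms en_eq_c_iff[of "fst z" "snd z"] by (auto simp: region_def orbit_eq case_prod_unfold less_le)

lemma region_0: "0 \<in> region"
  using xmax c_pos by (auto simp: region_def zero_prod_def en_0[unfolded zero_prod_def])

lemma en_pos_iff: "x < 1 \<Longrightarrow> 0 < en (x, y) \<longleftrightarrow> (y / (1 - x))\<^sup>2 < loud_q D F (1 / (1 - x))"
  by (simp add: en_def zero_less_mult_iff)

text \<open>Rescaling \<open>y\<close> by the height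
  \<open>(1 - x) * sqrt (loud_q D F (1 / (1 - x)))\<close> of the bounding curve makes the region
  the continuous image of a convex strip.\<close>

lemma connected_region: "connected region"
proof -
  define h where "h = (\<lambda>z :: real \<times> real. (fst z, snd z * ((1 - fst z) * sqrt (loud_q D F (1 / (1 - fst z))))))"
  have q: "continuous_on UNIV (loud_q D F)"
    using q_deriv by (blast intro: DERIV_continuous_on has_field_derivative_at_within)
  have "region = h ` ({..<xmax} \<times> {-1<..<1})"
  proof (intro equalityI subsetI)
    fix z assume "z \<in> region"
    then obtain x y where z: "z = (x, y)" "x < xmax" "0 < en (x, y)" by (auto simp: region_def)
    have x: "x < 1" using z xmax by linarith
    define r where "r = sqrt (loud_q D F (1 / (1 - x)))"
    have q0: "loud_q D F (1 / (1 - x)) > 0" using q_pos chart_bounds[OF z(2)] by simp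
    then have r: "r > 0" "r\<^sup>2 = loud_q D F (1 / (1 - x))" by (simp_all add: r_def)
    then have "(y / (1 - x))\<^sup>2 < r\<^sup>2" using en_pos_iff[OF x, of y] z by simp
    then have "\<bar>y / (1 - x)\<bar> < r" using r(1) by (metis abs_le_square_iff abs_of_pos not_le)
    then have "\<bar>y / ((1 - x) * r)\<bar> < 1" using r(1) x by (simp add: abs_mult abs_divide field_simps)
    then have "-1 < y / ((1 - x) * r)" "y / ((1 - x) * r) < 1" by linarith+
    then have "y / ((1 - x) * r) \<in> {-1<..<1}" by (simp only: greaterThanLessThan_iff simp_thms)
    moreover have "z = h (x, y / ((1 - x) * r))" using r(1) x by (simp add: h_def z r_def[symmetric])
    ultimately show "z \<in> h ` ({..<xmax} \<times> {-1<..<1})" using z(2) by blast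
  next
    fix z assume "z \<in> h ` ({..<xmax} \<times> {-1<..<1})"
    then obtain x t where z: "z = h (x, t)" "x < xmax" "-1 < t" "t < 1" by auto
    have x: "x < 1" using z xmax by linarith
    define r where "r = sqrt (loud_q D F (1 / (1 - x)))"
    have q0: "loud_q D F (1 / (1 - x)) > 0" using q_pos chart_bounds[OF z(2)] by simp
    then have r: "r > 0" "r\<^sup>2 = loud_q D F (1 / (1 - x))" by (simp_all add: r_def)
    have "t\<^sup>2 < 1" using z by (simp add: abs_square_less_1)
    then have "(t * ((1 - x) * r) / (1 - x))\<^sup>2 < r\<^sup>2"
      using x r(1) by (simp add: power_mult_distrib)
    then show "z \<in> region" using z x r en_pos_iff[OF x, of "t * ((1 - x) * r)"]
      by (simp add: region_def h_def r_def[symmetric])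
  qed
  moreover have "continuous_on ({..<xmax} \<times> {-1<..<1}) h"
    unfolding h_def using xmax
    by (intro continuous_intros continuous_on_compose2[OF q]) auto
  moreover have "connected ({..<xmax} \<times> {-1<..<1 :: real})"
    by (intro convex_connected convex_Times) auto
  ultimately show ?thesis by (simp add: connected_continuous_image)
qed

text \<open>No Jordan curve theorem is involved. The superlevel set \<open>S\<close> is open and
  \<open>S\<close> together with the orbit is closed, so the component of 0 in the complement of the
  orbit cannot leave \<open>S\<close>. Boundedness of \<open>S\<close> follows from
  \<open>vl \<eta> < v\<close>, which bounds \<open>1 - x\<close>, and from the bound of
  \<open>loud_q\<close> on a compact interval.\<close>

lemma orbit_surrounds_0:
  assumes \<eta>: "0 < \<eta>" "\<eta> < c"
  shows "0 \<in> inside (orbit \<eta>)"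
proof -
  define S where "S = {z. fst z < xmax \<and> \<eta> < en z}"
  define C where "C = connected_component_set (- orbit \<eta>) 0"
  have 0: "0 \<notin> orbit \<eta>" using \<eta> by (simp add: orbit_eq en_0)
  have S0: "0 \<in> S" using \<eta> xmax by (simp add: S_def en_0)
  have cl: "closed {z. fst z \<le> xmax \<and> \<eta> \<le> en z}"
  proof -
    have "closed {z :: real \<times> real. fst z \<le> xmax}" by (intro closed_Collect_le continuous_intros)
    moreover have "continuous_on {z. fst z \<le> xmax} en"
      by (rule continuous_on_subset[OF en_cont]) (use xmax in auto)
    ultimately have "closed (en -` {\<eta>..} \<inter> {z. fst z \<le> xmax})"
      using continuous_on_closed_vimage by blast
    moreover have "en -` {\<eta>..} \<inter> {z. fst z \<le> xmax} = {z. fst z \<le> xmax \<and> \<eta> \<le> en z}" by auto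
    ultimately show ?thesis by simp
  qed
  \<comment> \<open>Keeps the edge of the half plane out of the closed superlevel set, which is
    therefore \<open>S\<close> and the orbit and nothing else.\<close>
  have "en (xmax, y) \<le> 0" for y
    using en_le_e[of xmax y] e_vmax vmax_gt_1 by (simp add: xmax_def)
  then have xm: "en z \<le> 0" if "fst z = xmax" for z
    using that by (cases z) simp
  have split: "{z. fst z \<le> xmax \<and> \<eta> \<le> en z} = S \<union> orbit \<eta>"
  proof (intro set_eqI iffI)
    fix z assume z: "z \<in> {z. fst z \<le> xmax \<and> \<eta> \<le> en z}"
    then have "fst z \<noteq> xmax" using xm[of z] \<eta> by auto
    then show "z \<in> S \<union> orbit \<eta>" using z by (auto simp: S_def orbit_eq)
  qed (auto simp: S_def orbit_eq)
  have "C \<subseteq> S"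
  proof (rule ccontr)
    assume "\<not> C \<subseteq> S"
    have C: "C \<subseteq> - orbit \<eta>" "connected C" "0 \<in> C"
      unfolding C_def by (auto simp: connected_component_in 0 connected_component_subset)
    have "S \<inter> C \<noteq> {}" "- (S \<union> orbit \<eta>) \<inter> C \<noteq> {}"
      using S0 C \<open>\<not> C \<subseteq> S\<close> by auto
    moreover have "S \<inter> - (S \<union> orbit \<eta>) \<inter> C = {}" "C \<subseteq> S \<union> - (S \<union> orbit \<eta>)" using C by auto
    moreover have "open S" using open_en_gt[of \<eta>] by (simp add: S_def)
    moreover have "open (- (S \<union> orbit \<eta>))" using cl unfolding split by (rule open_Compl)
    ultimately show False using connectedD[OF C(2), of S "- (S \<union> orbit \<eta>)"] by blast
  qed
  moreover have "bounded S"
  proof -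
    note l = vl[OF \<eta>]
    have "compact {0..loud_vmax D F}" by simp
    moreover have "continuous_on {0..loud_vmax D F} (loud_q D F)"
      using q_deriv by (blast intro: DERIV_continuous_on has_field_derivative_at_within)
    ultimately have "bounded (loud_q D F ` {0..loud_vmax D F})"
      by (intro compact_imp_bounded compact_continuous_image)
    then obtain B where "\<forall>v\<in>{0..loud_vmax D F}. \<bar>loud_q D F v\<bar> \<le> B"
      by (auto simp: bounded_iff)
    then have B: "\<And>v. v \<in> {0..loud_vmax D F} \<Longrightarrow> \<bar>loud_q D F v\<bar> \<le> B" by blast
    define R where "R = 1 / vl \<eta>"
    have "S \<subseteq> {- R..1} \<times> {- R * (1 + B)..R * (1 + B)}"
    proof
      fix z assume z: "z \<in> S"
      obtain x y where xy: "z = (x, y)" by (cases z)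
      have x: "x < xmax" "\<eta> < en (x, y)" using z by (auto simp: S_def xy)
      note b = chart_bounds[OF x(1)]
      have "\<eta> < e (1 / (1 - x))" using x en_le_e[of x y] by linarith
      then have "vl \<eta> < 1 / (1 - x)" using e_gt_iff(1)[OF \<eta> b(1)] b by simp
      then have xR: "1 - x < R" using l b(1) by (simp add: R_def field_simps)
      have x1: "x < 1" using x xmax by linarith
      have "(y / (1 - x))\<^sup>2 < loud_q D F (1 / (1 - x))" using en_pos_iff[OF x1, of y] x \<eta> by simp
      also have "\<dots> \<le> B" using B[of "1 / (1 - x)"] b by auto
      finally have y2: "(y / (1 - x))\<^sup>2 \<le> B" by simp
      then have "\<bar>y / (1 - x)\<bar> \<le> 1 + B"
      proof -
        define w where "w = \<bar>y / (1 - x)\<bar>"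
        have "w\<^sup>2 \<le> B" using y2 by (simp only: w_def power2_abs)
        moreover have "0 \<le> (w - 1)\<^sup>2" by simp
        ultimately show ?thesis unfolding w_def[symmetric] by (simp add: power2_diff) (smt (verit) zero_le_power2)
      qed
      then have "\<bar>y\<bar> \<le> (1 - x) * (1 + B)" using x1 by (simp add: abs_divide field_simps)
      also have "\<dots> \<le> R * (1 + B)" using xR order_trans[OF zero_le_power2 y2] by (intro mult_right_mono) auto
      finally show "z \<in> {- R..1} \<times> {- R * (1 + B)..R * (1 + B)}"
        using xR x1 by (auto simp: xy abs_le_iff)
    qed
    then show ?thesis
      by (rule bounded_subset[rotated]) (intro bounded_Times bounded_closed_interval)
  qed
  ultimately show ?thesis
    using 0 bounded_subset by (auto simp: inside_def C_def)
qed

lemma axis_orbit: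
  assumes "0 < v" "v < loud_vmax D F"
  shows "(1 - 1 / v, 0) \<in> orbit (e v)"
  using assms by (simp add: orbit_def en_axis frac_less2)

lemma orbit_periodic:
  assumes \<eta>: "0 < \<eta>" "\<eta> < c"
  shows "periodic_orbit (loud (D, F)) (orbit \<eta>)"
proof -
  obtain t where "is_period (loud (D, F)) (orbit \<eta>) (period \<eta>)"
    by (rule period_time[OF \<eta>]) blast
  moreover have "\<not> is_singleton (orbit \<eta>)"
  proof
    assume "is_singleton (orbit \<eta>)"
    then obtain z where z: "orbit \<eta> = {z}" by (auto simp: is_singleton_def)
    have lr: "0 < vl \<eta>" "vl \<eta> < 1" "1 < vr \<eta>" using vl[OF \<eta>] vr[OF \<eta>] by auto
    have "(1 - 1 / vl \<eta>, 0) \<in> orbit \<eta>" "(1 - 1 / vr \<eta>, 0) \<in> orbit \<eta>"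
      using axis_orbit[of "vl \<eta>"] axis_orbit[of "vr \<eta>"] vl[OF \<eta>] vr[OF \<eta>] vmax_gt_1 by auto
    then have "1 - 1 / vl \<eta> = 1 - 1 / vr \<eta>" unfolding z by (metis prod.inject singletonD)
    then have "vl \<eta> = vr \<eta>" using lr by (simp add: field_simps)
    then show False using lr by linarith
  qed
  ultimately show ?thesis by (auto simp: periodic_orbit_def)
qed

lemma periodic_not_0:
  assumes "periodic_orbit (loud (D, F)) \<gamma>"
  shows "0 \<notin> \<gamma>"
proof
  assume 0: "0 \<in> \<gamma>"
  obtain T \<phi> where \<phi>: "integral_curve (loud (D, F)) \<phi>" "range \<phi> = \<gamma>"
    using assms by (auto simp: periodic_orbit_def is_period_def)
  obtain s where s: "\<phi> s = 0" using 0 \<phi>(2) by (metis imageE)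
  have "loud (D, F) 0 = 0" by (simp add: loud_def zero_prod_def)
  then have "integral_curve (loud (D, F)) (\<lambda>_. 0)" by (simp add: integral_curve_def)
  from loud_unique[OF \<phi>(1) this, of s] s have "\<phi> = (\<lambda>_. 0)" by simp
  then have "\<gamma> = {0}" using \<phi>(2) by auto
  then show False using assms by (simp add: periodic_orbit_def is_singleton_def)
qed

text \<open>An orbit around 0 has to meet the ray of nonpositive \<open>x\<close> on the axis
  \<open>y = 0\<close>, since otherwise this unbounded ray would lie in a bounded component of the
  complement. Every point of the ray other than 0 lies on a level \<open>0 < \<eta> < c\<close>, and
  uniqueness of solutions identifies the orbit.\<close>

lemma surrounding_orbit:
  assumes \<gamma>: "periodic_orbit (loud (D, F)) \<gamma>" "0 \<in> inside \<gamma>"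
  obtains \<eta> where "0 < \<eta>" "\<eta> < c" "\<gamma> = orbit \<eta>"
proof -
  obtain T where T: "is_period (loud (D, F)) \<gamma> T" using \<gamma> by (auto simp: periodic_orbit_def)
  define R where "R = {..0 :: real} \<times> {0 :: real}"
  have "R \<inter> \<gamma> \<noteq> {}"
  proof
    assume R: "R \<inter> \<gamma> = {}"
    have "connected R" unfolding R_def by (intro convex_connected convex_Times) auto
    then have "R \<subseteq> connected_component_set (- \<gamma>) 0"
      using R by (intro connected_component_maximal) (auto simp: R_def zero_prod_def)
    moreover have "bounded (connected_component_set (- \<gamma>) 0)" using \<gamma> by (simp add: inside_def)
    ultimately have "bounded R" using bounded_subset by blast
    then obtain B where B: "\<And>z. z \<in> R \<Longrightarrow> norm z \<le> B" by (auto simp: bounded_iff)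
    have "(- \<bar>B\<bar> - 1, 0) \<in> R" by (simp add: R_def)
    from B[OF this] have "\<bar>- \<bar>B\<bar> - 1\<bar> \<le> B" by (simp only: norm_Pair) simp
    then show False by linarith
  qed
  then obtain x where x: "(x, 0) \<in> \<gamma>" "x \<le> 0" by (auto simp: R_def)
  have "x \<noteq> 0" using x periodic_not_0[OF \<gamma>(1)] by (auto simp: zero_prod_def)
  then have x0: "x < 0" using x by simp
  define \<eta> where "\<eta> = e (1 / (1 - x))"
  have xm: "x < xmax" using x0 xmax by linarith
  have "(x, 0) \<in> region" using chart_bounds[OF xm] xm e_pos by (simp add: region_def en_axis)
  from region_iff_orbit[OF this] have \<eta>: "0 < \<eta>" "\<eta> < c" "(x, 0) \<in> orbit \<eta>"
    using x0 by (auto simp: zero_prod_def \<eta>_def en_axis)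
  then show ?thesis using that[OF \<eta>(1,2)] orbit_through[OF \<eta>(1,2) T x(1) \<eta>(3)] by simp
qed

text \<open>Maximality needs no continuation argument: by \<open>surrounding_orbit\<close> any orbit
  that can occur in a competing neighbourhood is already one of the levels.\<close>

lemma period_annulus_loud: "period_annulus (loud (D, F)) = region - {0}"
proof (intro equalityI subsetI)
  fix z assume "z \<in> period_annulus (loud (D, F))"
  then obtain \<gamma> where "z \<in> \<gamma>" "periodic_orbit (loud (D, F)) \<gamma>" "0 \<in> inside \<gamma>"
    unfolding period_annulus_def by blast
  then show "z \<in> region - {0}"
    using surrounding_orbit orbit_region periodic_not_0 by (metis DiffI singletonD subsetD)
next
  fix z assume z: "z \<in> region - {0}"
  have "\<exists>\<gamma>. p \<in> \<gamma> \<and> \<gamma> \<subseteq> region - {0} \<and> periodic_orbit (loud (D, F)) \<gamma> \<and> 0 \<in> inside \<gamma>"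
    if "p \<in> region - {0}" for p
  proof -
    from that have p: "0 < en p" "en p < c" "p \<in> orbit (en p)" using region_iff_orbit[of p] by auto
    have "orbit (en p) \<subseteq> region - {0}"
      using orbit_region[OF p(1)] periodic_not_0[OF orbit_periodic[OF p(1,2)]] by auto
    then show ?thesis using p orbit_periodic orbit_surrounds_0 by blast
  qed
  then show "z \<in> period_annulus (loud (D, F))"
    unfolding period_annulus_def using z
    by (intro UnionI[of "region - {0}"]) (simp_all add: insert_absorb[OF region_0] open_region connected_region)
qed

lemma annulus_orbits:
  "{\<gamma>. periodic_orbit (loud (D, F)) \<gamma> \<and> \<gamma> \<subseteq> period_annulus (loud (D, F))} = orbit ` {0<..<c}"
proof (intro equalityI subsetI)
  fix \<gamma> assume "\<gamma> \<in> {\<gamma>. periodic_orbit (loud (D, F)) \<gamma> \<and> \<gamma> \<subseteq> period_annulus (loud (D, F))}"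
  then have \<gamma>: "periodic_orbit (loud (D, F)) \<gamma>" "\<gamma> \<subseteq> region - {0}" by (simp_all add: period_annulus_loud)
  then obtain T where T: "is_period (loud (D, F)) \<gamma> T" by (auto simp: periodic_orbit_def)
  then obtain \<phi> where "integral_curve (loud (D, F)) \<phi>" "range \<phi> = \<gamma>" by (auto simp: is_period_def)
  then obtain z where "z \<in> \<gamma>" by blast
  then have "0 < en z \<and> en z < c \<and> z \<in> orbit (en z)" using \<gamma>(2) region_iff_orbit by blast
  then show "\<gamma> \<in> orbit ` {0<..<c}" using orbit_through[OF _ _ T \<open>z \<in> \<gamma>\<close>] by auto
next
  fix \<gamma> assume "\<gamma> \<in> orbit ` {0<..<c}"
  then obtain \<eta> where \<eta>: "0 < \<eta>" "\<eta> < c" "\<gamma> = orbit \<eta>" by auto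
  then show "\<gamma> \<in> {\<gamma>. periodic_orbit (loud (D, F)) \<gamma> \<and> \<gamma> \<subseteq> period_annulus (loud (D, F))}"
    using orbit_periodic orbit_region periodic_not_0[OF orbit_periodic[OF \<eta>(1,2)]]
    by (auto simp: period_annulus_loud)
qed

lemma orbit_inj: "0 < \<eta> \<Longrightarrow> \<eta> < c \<Longrightarrow> orbit \<eta> = orbit \<eta>' \<Longrightarrow> \<eta> = \<eta>'"
proof -
  assume \<eta>: "0 < \<eta>" "\<eta> < c" and eq: "orbit \<eta> = orbit \<eta>'"
  have "(1 - 1 / vl \<eta>, 0) \<in> orbit \<eta>"
    using axis_orbit[of "vl \<eta>"] vl[OF \<eta>] vmax_gt_1 by auto
  with eq have "(1 - 1 / vl \<eta>, 0) \<in> orbit \<eta>'" by simp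
  with \<open>(1 - 1 / vl \<eta>, 0) \<in> orbit \<eta>\<close> show "\<eta> = \<eta>'" by (simp add: orbit_eq)
qed

end

section \<open>An affine chart of the projective plane\<close>

definition chart_vec :: "real \<times> real \<Rightarrow> real^3" where
  "chart_vec z = vector [fst z - 1, snd z, fst z]"

text \<open>The affine chart of \<^typ>\<open>rp2\<close> whose line at infinity is the invariant line \<open>x = 1\<close>: with
  \<open>v = 1 / (1 - x)\<close> and \<open>p = y / (1 - x)\<close> one has \<open>[x : y : 1] = [v - 1 : p : v]\<close>, and \<open>v = 0\<close>
  is the line at infinity of the original plane.\<close>

definition rp_chart :: "real \<times> real \<Rightarrow> rp2" where
  "rp_chart z = Abs_rp2 (span {chart_vec z})"

lemma chart_vec_nth: "chart_vec z $ 1 = fst z - 1" "chart_vec z $ 2 = snd z" "chart_vec z $ 3 = fst z"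
  by (simp_all add: chart_vec_def)

lemma chart_vec_nz: "chart_vec z \<noteq> 0"
  using chart_vec_nth[of z] by (auto simp del: vector_minus_component)

lemma Rep_Abs_rp2: "w \<noteq> 0 \<Longrightarrow> Rep_rp2 (Abs_rp2 (span {w})) = span {w}"
  by (rule Abs_rp2_inverse) auto

lemma Rep_rp_chart: "Rep_rp2 (rp_chart z) = span {chart_vec z}"
  by (simp add: rp_chart_def Rep_Abs_rp2 chart_vec_nz)

lemma span_scaleR: "k \<noteq> 0 \<Longrightarrow> span {k *\<^sub>R w} = span {w :: real^3}"
  using span_image_scale[of "{w}" "\<lambda>_. k"] by simp

lemma span_inter_sphere:
  fixes w :: "real^3"
  assumes "w \<noteq> 0"
  shows "span {w} \<inter> sphere 0 1 = {w /\<^sub>R norm w, - (w /\<^sub>R norm w)}"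
proof (intro set_eqI iffI)
  fix x assume x: "x \<in> span {w} \<inter> sphere 0 1"
  then obtain k where k: "x = k *\<^sub>R w" by (auto simp: span_singleton)
  with x have "\<bar>k\<bar> * norm w = 1" by simp
  hence "\<bar>k\<bar> = inverse (norm w)" using assms by (simp add: field_simps)
  hence "k = inverse (norm w) \<or> k = - inverse (norm w)" by linarith
  thus "x \<in> {w /\<^sub>R norm w, - (w /\<^sub>R norm w)}" unfolding k by auto
next
  fix x assume "x \<in> {w /\<^sub>R norm w, - (w /\<^sub>R norm w)}"
  thus "x \<in> span {w} \<inter> sphere 0 1"
    using assms by (auto simp: span_neg span_scale span_base)
qed

lemma dist_rp2_span:
  assumes "Rep_rp2 p = span {u}" "Rep_rp2 r = span {w}" "u \<noteq> 0" "w \<noteq> 0"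
  shows "dist p r = min (norm (u /\<^sub>R norm u - w /\<^sub>R norm w)) (norm (u /\<^sub>R norm u + w /\<^sub>R norm w))"
  by (simp only: dist_rp2_def assms span_inter_sphere[OF assms(3)] span_inter_sphere[OF assms(4)] setdist_antipodal)

lemma dist_rp2_le_2: "dist (p :: rp2) r \<le> 2"
proof -
  obtain u w where "u \<noteq> 0" "Rep_rp2 p = span {u}" "w \<noteq> 0" "Rep_rp2 r = span {w}"
    using Rep_rp2[of p] Rep_rp2[of r] by auto
  then show ?thesis
    using norm_triangle_ineq4[of "u /\<^sub>R norm u" "w /\<^sub>R norm w"] by (simp add: dist_rp2_span min_le_iff_disj)
qed

lemma norm_normalize_diff:
  fixes u w :: "'a :: real_normed_vector"
  assumes "u \<noteq> 0" "w \<noteq> 0"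
  shows "norm (u /\<^sub>R norm u - w /\<^sub>R norm w) \<le> 2 * norm (u - w) / norm u"
proof -
  have "u /\<^sub>R norm u - w /\<^sub>R norm w = (u - w) /\<^sub>R norm u + (inverse (norm u) - inverse (norm w)) *\<^sub>R w"
    by (simp add: algebra_simps)
  also have "norm \<dots> \<le> norm ((u - w) /\<^sub>R norm u) + norm ((inverse (norm u) - inverse (norm w)) *\<^sub>R w)"
    by (rule norm_triangle_ineq)
  also have "norm ((inverse (norm u) - inverse (norm w)) *\<^sub>R w) = \<bar>norm w - norm u\<bar> / norm u"
  proof -
    have "inverse (norm u) - inverse (norm w) = (norm w - norm u) / (norm u * norm w)"
      using assms by (simp add: field_simps)
    then show ?thesis using assms by (simp add: abs_mult)
  qed
  also have "\<bar>norm w - norm u\<bar> / norm u \<le> norm (u - w) / norm u"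
    using norm_triangle_ineq3[of w u] by (intro divide_right_mono) (simp_all add: norm_minus_commute)
  also have "norm ((u - w) /\<^sub>R norm u) = norm (u - w) / norm u"
    by (simp only: norm_scaleR abs_inverse abs_norm_cancel divide_inverse mult.commute)
  finally show ?thesis by simp
qed

lemma norm_vec3: "norm (x :: real^3) = sqrt ((x $ 1)\<^sup>2 + (x $ 2)\<^sup>2 + (x $ 3)\<^sup>2)"
  by (simp add: norm_vec_def L2_set_def sum_3)

text \<open>The constant is \<open>2 * sqrt 2 / sqrt (1/2)\<close>: the factor 2 from
  \<open>norm_normalize_diff\<close>, \<open>sqrt 2\<close> from the linear part of
  \<open>chart_vec\<close>, and \<open>sqrt (1/2)\<close> as a lower bound for the norm of
  \<open>chart_vec\<close>.\<close>

lemma rp_chart_lipschitz: "dist (rp_chart z) (rp_chart z') \<le> 4 * dist z z'"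
proof -
  have n: "norm (chart_vec z) \<ge> sqrt (1 / 2)"
  proof -
    have "0 \<le> (2 * fst z - 1)\<^sup>2" by simp
    then have "1 / 2 \<le> (fst z - 1)\<^sup>2 + (snd z)\<^sup>2 + (fst z)\<^sup>2"
      by (simp add: power2_diff power_mult_distrib) (smt (verit) zero_le_power2)
    then show ?thesis by (simp add: norm_vec3 chart_vec_nth)
  qed
  have d: "norm (chart_vec z - chart_vec z') \<le> sqrt 2 * dist z z'"
  proof -
    have "norm (chart_vec z - chart_vec z') = sqrt (2 * (fst z - fst z')\<^sup>2 + (snd z - snd z')\<^sup>2)"
      by (simp add: norm_vec3 chart_vec_nth)
    also have "\<dots> \<le> sqrt (2 * ((fst z - fst z')\<^sup>2 + (snd z - snd z')\<^sup>2))" by (intro real_sqrt_le_mono) simp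
    also have "\<dots> = sqrt 2 * dist z z'" by (simp only: real_sqrt_mult dist_prod_def dist_real_def power2_abs)
    finally show ?thesis .
  qed
  have "dist (rp_chart z) (rp_chart z') \<le>
      norm (chart_vec z /\<^sub>R norm (chart_vec z) - chart_vec z' /\<^sub>R norm (chart_vec z'))"
    by (simp add: dist_rp2_span[OF Rep_rp_chart Rep_rp_chart chart_vec_nz chart_vec_nz])
  also have "\<dots> \<le> 2 * norm (chart_vec z - chart_vec z') / norm (chart_vec z)"
    by (rule norm_normalize_diff) (rule chart_vec_nz)+
  also have "\<dots> \<le> 2 * (sqrt 2 * dist z z') / sqrt (1 / 2)"
    using n d by (intro frac_le mult_left_mono) auto
  also have "\<dots> = 4 * dist z z'" by (simp add: real_sqrt_divide)
  finally show ?thesis .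
qed

lemma continuous_on_rp_chart: "continuous_on S rp_chart"
  unfolding continuous_on_iff
proof (intro ballI allI impI)
  fix x and e :: real assume "e > 0"
  moreover have "dist x' x < e / 4 \<Longrightarrow> dist (rp_chart x') (rp_chart x) < e" for x'
    using rp_chart_lipschitz[of x' x] by linarith
  ultimately show "\<exists>d>0. \<forall>x'\<in>S. dist x' x < d \<longrightarrow> dist (rp_chart x') (rp_chart x) < e"
    by (intro exI[of _ "e / 4"]) auto
qed

lemma rp_chart_inj: "rp_chart z = rp_chart z' \<Longrightarrow> z = z'"
proof -
  assume "rp_chart z = rp_chart z'"
  then have "span {chart_vec z} = span {chart_vec z'}" using Rep_rp_chart by metis
  then have "chart_vec z \<in> span {chart_vec z'}" by (metis insertI1 span_base)
  then obtain k where k: "chart_vec z = k *\<^sub>R chart_vec z'" by (auto simp: span_singleton)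
  have 1: "fst z - 1 = k * (fst z' - 1)" "snd z = k * snd z'" "fst z = k * fst z'"
    using arg_cong[OF k, of "\<lambda>x. x $ 1"] arg_cong[OF k, of "\<lambda>x. x $ 2"] arg_cong[OF k, of "\<lambda>x. x $ 3"]
    by (simp_all add: chart_vec_nth)
  then have "k = 1" by (simp add: algebra_simps)
  then show ?thesis using 1 by (simp add: prod_eq_iff)
qed

lemma to_rp2_chart:
  assumes "x \<noteq> 1"
  shows "to_rp2 (x, y) = rp_chart (1 / (1 - x), y / (1 - x))"
proof -
  have "vector [x, y, 1] = (1 - x) *\<^sub>R chart_vec (1 / (1 - x), y / (1 - x))"
    unfolding vec_eq_iff forall_3 using assms by (simp add: chart_vec_nth right_diff_distrib)
  then show ?thesis
    using assms span_scaleR[of "1 - x"] by (simp add: to_rp2_def rp_chart_def)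
qed

text \<open>The local inverse \<open>f\<close> is homogeneous of degree 0 on
  \<open>\<real>^3\<close>, so openness can be checked in a ball around a unit representative
  \<open>u\<close>. A nearby line has two unit representatives \<open>y\<close> and
  \<open>- y\<close>, one of which lies in the ball.\<close>

lemma rp_chart_open_map:
  assumes "open U"
  shows "open (rp_chart ` U)"
  unfolding open_dist
proof
  fix r assume "r \<in> rp_chart ` U"
  then obtain z where z: "z \<in> U" "r = rp_chart z" by auto
  define w where "w = chart_vec z"
  have w: "w \<noteq> 0" "Rep_rp2 r = span {w}" by (simp_all add: w_def chart_vec_nz z Rep_rp_chart)
  define u where "u = w /\<^sub>R norm w"
  define f where "f x = (x $ 3 / (x $ 3 - x $ 1), x $ 2 / (x $ 3 - x $ 1))" for x :: "real^3"
  define V where "V = {x :: real^3. x $ 3 - x $ 1 \<noteq> 0}"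
  have oV: "open V" unfolding V_def by (intro open_Collect_neq continuous_intros)
  have "continuous_on V f" unfolding f_def V_def by (intro continuous_intros) auto
  then have op: "open (f -` U \<inter> V)" using oV assms continuous_on_open_vimage by blast
  have "w $ 3 - w $ 1 = 1" by (simp add: w_def chart_vec_nth)
  then have u31: "u $ 3 - u $ 1 = 1 / norm w" by (simp add: u_def inverse_eq_divide diff_divide_distrib[symmetric])
  have fu: "f u = z"
    using w(1) unfolding f_def u31 by (simp add: u_def w_def chart_vec_nth prod_eq_iff)
  have "u $ 3 - u $ 1 \<noteq> 0" unfolding u31 using w by simp
  then have "u \<in> f -` U \<inter> V" using fu z by (simp add: V_def)
  then obtain \<epsilon> where \<epsilon>: "\<epsilon> > 0" "ball u \<epsilon> \<subseteq> f -` U \<inter> V" using op open_contains_ball by blast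
  have key: "s \<in> rp_chart ` U" if "Rep_rp2 s = span {x}" "dist u x < \<epsilon>" for s x
  proof -
    have x: "f x \<in> U" "x $ 3 - x $ 1 \<noteq> 0" using \<epsilon>(2) that(2) by (auto simp: V_def)
    have "x = (x $ 3 - x $ 1) *\<^sub>R chart_vec (f x)"
      unfolding vec_eq_iff forall_3 using x(2) by (simp add: chart_vec_nth f_def right_diff_distrib)
    then have "span {x} = span {chart_vec (f x)}" using span_scaleR[OF x(2)] by metis
    then have "Rep_rp2 s = Rep_rp2 (rp_chart (f x))" using that(1) by (simp add: Rep_rp_chart)
    then show ?thesis using x(1) by (simp add: Rep_rp2_inject)
  qed
  show "\<exists>\<epsilon>>0. \<forall>s. dist s r < \<epsilon> \<longrightarrow> s \<in> rp_chart ` U"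
  proof (intro exI[of _ \<epsilon>] conjI allI impI)
    fix s assume s: "dist s r < \<epsilon>"
    obtain x where x: "x \<noteq> 0" "Rep_rp2 s = span {x}" using Rep_rp2[of s] by auto
    define y where "y = x /\<^sub>R norm x"
    have y: "Rep_rp2 s = span {y}" "Rep_rp2 s = span {- y}"
      using x span_scaleR[of "inverse (norm x)" x] span_scaleR[of "- inverse (norm x)" x] by (simp_all add: y_def)
    have "min (norm (y - u)) (norm (y + u)) < \<epsilon>"
      using s unfolding dist_rp2_span[OF x(2) w(2) x(1) w(1)] u_def y_def .
    then have "norm (y - u) < \<epsilon> \<or> norm (y + u) < \<epsilon>" by linarith
    then show "s \<in> rp_chart ` U"
    proof
      assume "norm (y - u) < \<epsilon>"
      then show ?thesis by (intro key[OF y(1)]) (simp add: dist_norm norm_minus_commute)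
    next
      assume "norm (y + u) < \<epsilon>"
      then show ?thesis by (intro key[OF y(2)]) (simp add: dist_norm add.commute)
    qed
  qed (rule \<epsilon>(1))
qed

text \<open>Boundedness is what matters: the closure of \<open>S\<close> in the chart is compact,
  hence its image is closed in the projective plane and the closure acquires no points outside the
  chart.\<close>

lemma frontier_rp_chart:
  assumes "open S" "bounded S" "z \<in> S"
  shows "frontier (rp_chart ` (S - {z})) - {rp_chart z} = rp_chart ` (closure S - S)"
proof -
  define T where "T = S - {z}"
  have T: "open T" "bounded T" using assms bounded_subset[of S T] by (auto simp: T_def open_delete)
  have "compact (closure T)" using T by (simp add: compact_closure)
  then have "compact (rp_chart ` closure T)"
    by (intro compact_continuous_image continuous_on_rp_chart)
  then have "closure (rp_chart ` T) \<subseteq> rp_chart ` closure T"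
    by (intro closure_minimal image_mono closure_subset compact_imp_closed)
  moreover have "rp_chart ` closure T \<subseteq> closure (rp_chart ` T)"
    by (intro image_closure_subset continuous_on_rp_chart closure_subset) simp
  ultimately have cl: "closure (rp_chart ` T) = rp_chart ` closure T" by blast
  have "interior (rp_chart ` T) = rp_chart ` T"
    by (intro interior_open rp_chart_open_map T)
  then have "frontier (rp_chart ` T) = rp_chart ` closure T - rp_chart ` T"
    by (simp add: frontier_def cl)
  also have "\<dots> - {rp_chart z} = rp_chart ` (closure T - T - {z})"
    by (auto dest: rp_chart_inj)
  also have "closure T - T - {z} = closure S - S"
  proof -
    have "closure S \<subseteq> closure T \<union> {z}"
      by (rule closure_minimal) (use closure_subset[of T] in \<open>auto simp: T_def\<close>)
    moreover have "closure T \<subseteq> closure S" by (rule closure_mono) (auto simp: T_def)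
    ultimately show ?thesis using assms(3) by (auto simp: T_def)
  qed
  finally show ?thesis by (simp add: T_def)
qed

section \<open>Critical orbits and the derivative of the period\<close>

text \<open>The curve is the negative \<open>x\<close>-axis parametrized by
  \<open>v = 1 - s\<close>, which crosses every level exactly once. The series is the geometric
  expansion of \<open>1 / (1 - y)\<close> about \<open>x\<close>; the constant 1 contributes to the
  term of order 0 only.\<close>

lemma real_analytic_axis: "real_analytic_on (\<lambda>s. (1 - 1 / (1 - s), 0 :: real)) {0<..<1}"
  unfolding real_analytic_on_def
proof
  fix x :: real assume x: "x \<in> {0<..<1}"
  define b where "b n = (if n = 0 then 1 else 0) - 1 / (1 - x) ^ Suc n" for n
  show "\<exists>a. \<exists>r>0. \<forall>y. \<bar>y - x\<bar> < r \<longrightarrow> (\<lambda>n. (y - x) ^ n *\<^sub>R a n) sums (1 - 1 / (1 - y), 0 :: real)"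
  proof (intro exI[of _ "\<lambda>n. b n *\<^sub>R (1 :: real, 0 :: real)"] exI[of _ "1 - x"] conjI allI impI)
    fix y assume y: "\<bar>y - x\<bar> < 1 - x"
    have ne: "1 - x \<noteq> 0" "1 - y \<noteq> 0" using x y by auto
    have "norm ((y - x) / (1 - x)) < 1" using x y by simp
    then have "(\<lambda>n. ((y - x) / (1 - x)) ^ n) sums (1 / (1 - (y - x) / (1 - x)))" by (rule geometric_sums)
    then have "(\<lambda>n. 1 / (1 - x) * ((y - x) / (1 - x)) ^ n) sums (1 / (1 - x) * (1 / (1 - (y - x) / (1 - x))))"
      by (rule sums_mult)
    moreover have "1 / (1 - x) * (1 / (1 - (y - x) / (1 - x))) = 1 / (1 - y)"
    proof -
      have "1 - (y - x) / (1 - x) = (1 - y) / (1 - x)" using ne by (simp add: field_simps)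
      then show ?thesis using ne by simp
    qed
    ultimately have "(\<lambda>n. 1 / (1 - x) * ((y - x) / (1 - x)) ^ n) sums (1 / (1 - y))" by simp
    moreover have "(\<lambda>n. if n = 0 then 1 else 0 :: real) sums 1" using sums_single[of 0 "\<lambda>_. 1 :: real"] by simp
    ultimately have "(\<lambda>n. (if n = 0 then 1 else 0) - 1 / (1 - x) * ((y - x) / (1 - x)) ^ n) sums (1 - 1 / (1 - y))"
      by (intro sums_diff)
    moreover have "(if n = 0 then 1 else 0) - 1 / (1 - x) * ((y - x) / (1 - x)) ^ n = (y - x) ^ n * b n" for n
      by (simp add: b_def right_diff_distrib power_divide)
    ultimately have "(\<lambda>n. (y - x) ^ n * b n) sums (1 - 1 / (1 - y))" by simp
    from bounded_linear.sums[OF bounded_linear_scaleR_left this, of "(1 :: real, 0 :: real)"]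
    show "(\<lambda>n. (y - x) ^ n *\<^sub>R b n *\<^sub>R (1, 0)) sums (1 - 1 / (1 - y), 0 :: real)" by simp
  qed (use x in auto)
qed

context loud_center
begin

text \<open>\<open>2 * v powr (m + 3)\<close> is an integrating factor: it turns the wedge product
  of the field with the velocity into the differential of the first integral. Hence on a curve
  transverse to the field the energy has nonzero derivative.\<close>

lemma en_has_derivative:
  assumes \<sigma>: "(\<sigma> has_vector_derivative w) (at s)" and x1: "fst (\<sigma> s) < 1"
  shows "((\<lambda>s. en (\<sigma> s)) has_real_derivative 2 * (1 / (1 - fst (\<sigma> s))) powr (m + 3) *
     (fst (loud (D, F) (\<sigma> s)) * snd w - snd (loud (D, F) (\<sigma> s)) * fst w)) (at s)"
proof -
  define x y where "x s = fst (\<sigma> s)" and "y s = snd (\<sigma> s)" for s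
  have dx: "(x has_real_derivative fst w) (at s)" "(y has_real_derivative snd w) (at s)"
    using bounded_linear.has_vector_derivative[OF bounded_linear_fst \<sigma>]
      bounded_linear.has_vector_derivative[OF bounded_linear_snd \<sigma>]
    by (simp_all add: x_def[abs_def] y_def[abs_def] has_real_derivative_iff_has_vector_derivative)
  define v p where "v s = 1 / (1 - x s)" and "p s = y s * v s" for s
  have v0: "v s > 0" using x1 by (simp add: v_def x_def)
  have dv: "(v has_real_derivative fst w * (v s)\<^sup>2) (at s)"
    unfolding v_def[abs_def] using x1[folded x_def]
    by (auto intro!: derivative_eq_intros dx simp: power2_eq_square)
  have dp: "(p has_real_derivative snd w * v s + fst w * (v s)\<^sup>2 * y s) (at s)"
    unfolding p_def[abs_def] by (rule DERIV_mult[OF dx(2) dv])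
  have dpow: "((\<lambda>s. v s powr m) has_real_derivative m * v s powr (m - 1) * (fst w * (v s)\<^sup>2)) (at s)"
    by (rule DERIV_chain2[where f="\<lambda>t. t powr m", OF has_real_derivative_powr[OF v0] dv])
  have dq: "((\<lambda>s. loud_q D F (v s) - (p s)\<^sup>2) has_real_derivative
      loud_q' D F (v s) * (fst w * (v s)\<^sup>2) - 2 * p s * (snd w * v s + fst w * (v s)\<^sup>2 * y s)) (at s)"
    by (intro DERIV_diff DERIV_chain2[OF q_deriv dv]) (auto intro!: derivative_eq_intros dp)
  have "((\<lambda>s. v s powr m * (loud_q D F (v s) - (p s)\<^sup>2)) has_real_derivative
     m * v s powr (m - 1) * (fst w * (v s)\<^sup>2) * (loud_q D F (v s) - (p s)\<^sup>2) +
     (loud_q' D F (v s) * (fst w * (v s)\<^sup>2) - 2 * p s * (snd w * v s + fst w * (v s)\<^sup>2 * y s)) * v s powr m) (at s)"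
    by (rule DERIV_mult[OF dpow dq])
  moreover have "(\<lambda>s. en (\<sigma> s)) = (\<lambda>s. v s powr m * (loud_q D F (v s) - (p s)\<^sup>2))"
    by (simp add: en_def v_def p_def x_def y_def case_prod_unfold)
  moreover have "m * v s powr (m - 1) * (fst w * (v s)\<^sup>2) * (loud_q D F (v s) - (p s)\<^sup>2) +
     (loud_q' D F (v s) * (fst w * (v s)\<^sup>2) - 2 * p s * (snd w * v s + fst w * (v s)\<^sup>2 * y s)) * v s powr m =
     2 * v s powr (m + 3) * (fst (loud (D, F) (\<sigma> s)) * snd w - snd (loud (D, F) (\<sigma> s)) * fst w)"
  proof -
    define V Y where "V = v s" and "Y = y s"
    have V: "V > 0" using v0 by (simp add: V_def)
    have xV: "x s = 1 - 1 / V" using x1 by (simp add: V_def v_def x_def)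
    have p1: "V powr m = V powr (m - 1) * V" "V powr (m + 3) = V powr (m - 1) * V ^ 4"
      using V by (simp_all add: powr_diff powr_add powr_numeral power4_eq_xxxx power3_eq_cube)
    have X: "fst (loud (D, F) (\<sigma> s)) = - Y / V" "snd (loud (D, F) (\<sigma> s)) = (1 - 1 / V) + D * (1 - 1 / V)\<^sup>2 + F * Y\<^sup>2"
      using V by (simp_all add: loud_def case_prod_unfold x_def[symmetric] y_def[symmetric] xV Y_def[symmetric] field_simps)
    have qN: "m * loud_q D F V = 2 * loud_N D V - V * loud_q' D F V" using q_N[of V] by simp
    have NV: "(1 - 1 / V) + D * (1 - 1 / V)\<^sup>2 = - loud_N D V / V\<^sup>2"
      using V by (simp add: loud_N_def field_simps power2_eq_square)
    have "m * V powr (m - 1) * (fst w * V\<^sup>2) * (loud_q D F V - (Y * V)\<^sup>2) +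
       (loud_q' D F V * (fst w * V\<^sup>2) - 2 * (Y * V) * (snd w * V + fst w * V\<^sup>2 * Y)) * V powr m =
       V powr (m - 1) * ((fst w * V\<^sup>2) * (m * loud_q D F V - m * (Y * V)\<^sup>2) +
       (loud_q' D F V * (fst w * V\<^sup>2) - 2 * (Y * V) * (snd w * V + fst w * V\<^sup>2 * Y)) * V)"
      unfolding p1 by (simp add: algebra_simps)
    also have "\<dots> = V powr (m - 1) * ((fst w * V\<^sup>2) * (2 * loud_N D V - (m + 2) * (Y * V)\<^sup>2) - 2 * Y * snd w * V ^ 3)"
      unfolding qN by (simp add: algebra_simps power2_eq_square power3_eq_cube)
    also have "\<dots> = 2 * V powr (m + 3) * (- Y / V * snd w - (- loud_N D V / V\<^sup>2 + F * Y\<^sup>2) * fst w)"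
    proof -
      have "m + 2 = 2 * F" by (simp add: m_def)
      then show ?thesis unfolding p1
        using V by (simp add: field_simps power2_eq_square power3_eq_cube power4_eq_xxxx)
    qed
    finally show ?thesis
      unfolding X NV[symmetric] p_def V_def[symmetric] Y_def[symmetric] by simp
  qed
  ultimately show ?thesis by (simp add: v_def x_def)
qed

text \<open>By \<open>en_has_derivative\<close>, an admissible parametrization and the energy are
  related by a function with nonzero derivative at the point in question, and the chain rule
  transfers the vanishing. The conclusion is conditional because differentiability of
  \<open>period\<close> becomes available only near the outer boundary.\<close>

lemma critical_orbit_energy:
  assumes "critical_periodic_orbit (loud (D, F)) \<gamma>"
  obtains \<eta> where "0 < \<eta>" "\<eta> < c" "\<gamma> = orbit \<eta>"
    "\<And>d. (period has_real_derivative d) (at \<eta>) \<Longrightarrow> d = 0"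
proof -
  obtain \<Gamma> s where \<Gamma>: "analytic_orbit_parametrization (loud (D, F)) \<Gamma>" "s \<in> {0<..<1}" "\<Gamma> s = \<gamma>"
    and d0: "((\<lambda>s. minimal_period (loud (D, F)) (\<Gamma> s)) has_real_derivative 0) (at s)"
    using assms by (auto simp: critical_periodic_orbit_def)
  obtain \<sigma> where bij: "bij_betw \<Gamma> {0<..<1} (orbit ` {0<..<c})"
    and \<sigma>: "\<And>s. s \<in> {0<..<1} \<Longrightarrow> \<sigma> s \<in> \<Gamma> s"
    and tr: "\<And>s. s \<in> {0<..<1} \<Longrightarrow> \<exists>v. (\<sigma> has_vector_derivative v) (at s) \<and>
         fst (loud (D, F) (\<sigma> s)) * snd v - snd (loud (D, F) (\<sigma> s)) * fst v \<noteq> 0"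
    using \<Gamma>(1) unfolding analytic_orbit_parametrization_def annulus_orbits by blast
  have G: "0 < en (\<sigma> t) \<and> en (\<sigma> t) < c \<and> \<Gamma> t = orbit (en (\<sigma> t)) \<and> fst (\<sigma> t) < xmax" if "t \<in> {0<..<1}" for t
  proof -
    have "\<Gamma> t \<in> orbit ` {0<..<c}" using bij_betwE[OF bij] that by blast
    then obtain \<eta> where "0 < \<eta>" "\<eta> < c" "\<Gamma> t = orbit \<eta>" by auto
    then show ?thesis using \<sigma>[OF that] by (simp add: orbit_eq)
  qed
  obtain w where w: "(\<sigma> has_vector_derivative w) (at s)"
    "fst (loud (D, F) (\<sigma> s)) * snd w - snd (loud (D, F) (\<sigma> s)) * fst w \<noteq> 0"
    using tr[OF \<Gamma>(2)] by blast
  define h' where "h' = 2 * (1 / (1 - fst (\<sigma> s))) powr (m + 3) *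
     (fst (loud (D, F) (\<sigma> s)) * snd w - snd (loud (D, F) (\<sigma> s)) * fst w)"
  have x1: "fst (\<sigma> s) < 1" using G[OF \<Gamma>(2)] xmax by linarith
  have dh: "((\<lambda>s. en (\<sigma> s)) has_real_derivative h') (at s)"
    unfolding h'_def by (rule en_has_derivative[OF w(1) x1])
  have h': "h' \<noteq> 0" using w(2) x1 by (simp add: h'_def)
  have "\<forall>\<^sub>F t in nhds s. t \<in> {0<..<1}" using \<Gamma>(2) by (intro eventually_nhds_in_open) auto
  then have ev: "\<forall>\<^sub>F t in nhds s. minimal_period (loud (D, F)) (\<Gamma> t) = period (en (\<sigma> t))"
    by eventually_elim (use G in \<open>simp add: period_def\<close>)
  then have dP: "((\<lambda>t. period (en (\<sigma> t))) has_real_derivative 0) (at s)"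
    using d0 by (simp only: DERIV_cong_ev[OF refl ev refl])
  show ?thesis
  proof (rule that[of "en (\<sigma> s)"])
    fix d assume "(period has_real_derivative d) (at (en (\<sigma> s)))"
    then have "((\<lambda>t. period (en (\<sigma> t))) has_real_derivative d * h') (at s)" by (rule DERIV_chain2[OF _ dh])
    from DERIV_unique[OF this dP] h' show "d = 0" by simp
  qed (use G[OF \<Gamma>(2)] \<Gamma>(3) in auto)
qed

lemma critical_orbitI:
  assumes \<eta>: "0 < \<eta>" "\<eta> < c" and d: "(period has_real_derivative 0) (at \<eta>)"
  shows "critical_periodic_orbit (loud (D, F)) (orbit \<eta>)"
proof -
  define \<Gamma> where "\<Gamma> s = orbit (e (1 - s))" for s
  define \<sigma> where "\<sigma> s = (1 - 1 / (1 - s), 0 :: real)" for s :: real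
  define s0 where "s0 = 1 - vl \<eta>"
  note l = vl[OF \<eta>]
  have es: "0 < e (1 - s) \<and> e (1 - s) < c" if "s \<in> {0<..<1}" for s
  proof -
    have "1 - s \<in> {0<..<1}" using that by auto
    then have "e (1 - s) \<in> e ` {0<..<1}" by blast
    then show ?thesis unfolding e_image by simp
  qed
  have "bij_betw \<Gamma> {0<..<1} (orbit ` {0<..<c})"
  proof (rule bij_betw_imageI)
    show "inj_on \<Gamma> {0<..<1}"
    proof (rule inj_onI)
      fix s t assume st: "s \<in> {0<..<1}" "t \<in> {0<..<1}" "\<Gamma> s = \<Gamma> t"
      have "orbit (e (1 - s)) = orbit (e (1 - t))" using st(3) by (simp only: \<Gamma>_def)
      then have "e (1 - s) = e (1 - t)" 
        by (rule orbit_inj[OF es[OF st(1), THEN conjunct1] es[OF st(1), THEN conjunct2]])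
      then have "1 - s = 1 - t" by (rule inj_onD[OF inj_e(1)]) (use st(1,2) in auto)
      then show "s = t" by simp
    qed
    have "(\<lambda>s. 1 - s) ` {0<..<1 :: real} = {0<..<1}"
    proof (intro equalityI subsetI)
      fix x :: real assume "x \<in> {0<..<1}"
      then show "x \<in> (\<lambda>s. 1 - s) ` {0<..<1}" by (intro image_eqI[of _ _ "1 - x"]) auto
    qed auto
    then have "(\<lambda>s. e (1 - s)) ` {0<..<1} = {0<..<c}"
      using e_image(1) image_image[of e "\<lambda>s. 1 - s" "{0<..<1}"] by (simp only:)
    then show "\<Gamma> ` {0<..<1} = orbit ` {0<..<c}"
      using image_image[of orbit "\<lambda>s. e (1 - s)" "{0<..<1}"] by (simp only: \<Gamma>_def[abs_def])
  qed
  moreover have "\<sigma> s \<in> \<Gamma> s \<and> (\<exists>v. (\<sigma> has_vector_derivative v) (at s) \<and>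
         fst (loud (D, F) (\<sigma> s)) * snd v - snd (loud (D, F) (\<sigma> s)) * fst v \<noteq> 0)" if s: "s \<in> {0<..<1}" for s
  proof (intro conjI exI[of _ "(- (1 / (1 - s)\<^sup>2), 0)"])
    show "\<sigma> s \<in> \<Gamma> s" unfolding \<sigma>_def \<Gamma>_def using s vmax_gt_1 by (intro axis_orbit) auto
    have "((\<lambda>s. 1 - 1 / (1 - s)) has_real_derivative - (1 / (1 - s)\<^sup>2)) (at s)"
      using s by (auto intro!: derivative_eq_intros simp: power2_eq_square)
    from has_vector_derivative_Pair[OF this[unfolded has_real_derivative_iff_has_vector_derivative] has_vector_derivative_const]
    show "(\<sigma> has_vector_derivative (- (1 / (1 - s)\<^sup>2), 0)) (at s)" by (simp add: \<sigma>_def[abs_def])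
    define x where "x = 1 - 1 / (1 - s)"
    have x: "x < 0" using s by (simp add: x_def field_simps)
    \<comment> \<open>On the axis \<open>y = 0\<close> the field is vertical, with second component
      \<open>x * (1 + D * x)\<close>; for \<open>x < 0\<close> and \<open>D < 0\<close> the bracket
      exceeds 1, so the horizontal curve is transverse.\<close>
    have "x + D * x\<^sup>2 = x * (1 + D * x)" by (simp add: algebra_simps power2_eq_square)
    moreover have "D * x > 0" using D x by (simp add: mult_neg_neg)
    ultimately have "x + D * x\<^sup>2 \<noteq> 0" using x by simp
    then show "fst (loud (D, F) (\<sigma> s)) * snd (- (1 / (1 - s)\<^sup>2), 0) -
        snd (loud (D, F) (\<sigma> s)) * fst (- (1 / (1 - s)\<^sup>2), 0) \<noteq> 0"
      using s by (simp add: loud_def \<sigma>_def x_def)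
  qed
  ultimately have "analytic_orbit_parametrization (loud (D, F)) \<Gamma>"
    unfolding analytic_orbit_parametrization_def annulus_orbits
    using real_analytic_axis by (intro conjI exI[of _ \<sigma>]) (auto simp: \<sigma>_def[abs_def])
  moreover have s0: "s0 \<in> {0<..<1}" "e (1 - s0) = \<eta>" using l by (auto simp: s0_def)
  moreover have "((\<lambda>s. minimal_period (loud (D, F)) (\<Gamma> s)) has_real_derivative 0) (at s0)"
  proof -
    have "((\<lambda>s. 1 - s) has_real_derivative -1) (at s0)" by (auto intro!: derivative_eq_intros)
    from DERIV_chain2[OF e_deriv this] obtain d' where "((\<lambda>s. e (1 - s)) has_real_derivative d') (at s0)"
      using s0 by auto
    from DERIV_chain2[of period, OF _ this] d have "((\<lambda>s. period (e (1 - s))) has_real_derivative 0) (at s0)"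
      using s0(2) by fastforce
    then show ?thesis by (simp add: \<Gamma>_def[abs_def] period_def)
  qed
  ultimately show ?thesis unfolding critical_periodic_orbit_def
    by (intro exI[of _ \<Gamma>] exI[of _ s0]) (simp add: \<Gamma>_def)
qed

end

section \<open>Derivatives of the period with respect to the energy\<close>

definition loud_N' :: "real \<Rightarrow> real \<Rightarrow> real" where
  "loud_N' D v = 1 + 2 * D - 2 * (1 + D) * v"

text \<open>The factor that remains of \<open>loud_H1\<close> when the power of \<open>v\<close> is
  taken out. Its value at \<open>v = 0\<close> is \<open>(2 - F) / D^2\<close>, which vanishes
  precisely at \<open>F = 2\<close>.\<close>

definition loud_r :: "real \<Rightarrow> real \<Rightarrow> real \<Rightarrow> real" where
  "loud_r D F v = (2 - F) / (loud_N D v)\<^sup>2 - v * loud_N' D v / (loud_N D v) ^ 3"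

definition loud_r' :: "real \<Rightarrow> real \<Rightarrow> real \<Rightarrow> real" where
  "loud_r' D F v = - (2 * (2 - F) + 1) * loud_N' D v / (loud_N D v) ^ 3 +
     2 * (1 + D) * v / (loud_N D v) ^ 3 + 3 * v * (loud_N' D v)\<^sup>2 / (loud_N D v) ^ 4"

text \<open>With \<open>e\<close> the energy on the axis \<open>p = 0\<close>, \<open>H0 = v powr (m / 2) / e'\<close> is the integrand of the period
  with respect to \<open>e\<close>, and \<open>H1 = H0' / e'\<close> and \<open>H2 = H1' / e'\<close> are its derivatives along \<open>e\<close>.\<close>

definition loud_H0 :: "real \<Rightarrow> real \<Rightarrow> real \<Rightarrow> real" where
  "loud_H0 D F v = v powr (2 - F) / (2 * loud_N D v)"

definition loud_H1 :: "real \<Rightarrow> real \<Rightarrow> real \<Rightarrow> real" where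
  "loud_H1 D F v = v powr (4 - 3 * F) * loud_r D F v / 4"

definition loud_H2 :: "real \<Rightarrow> real \<Rightarrow> real \<Rightarrow> real" where
  "loud_H2 D F v = ((4 - 3 * F) * v powr (3 - 3 * F) * loud_r D F v + v powr (4 - 3 * F) * loud_r' D F v) / 4
     / (2 * v powr (2 * F - 3) * loud_N D v)"

text \<open>The remainder in \<open>loud_b_identity\<close>. Unlike \<open>loud_H1\<close> and
  \<open>loud_H2\<close> it contains no power of \<open>v\<close> with variable exponent and stays
  continuous down to \<open>v = 0\<close>.\<close>

definition loud_b :: "real \<Rightarrow> real \<Rightarrow> real \<Rightarrow> real" where
  "loud_b D F v = (3 * F - 4) * loud_q' D F v * loud_r D F v / (2 * (2 * F - 2) * loud_N D v) +
     loud_q D F v * loud_r' D F v / (2 * loud_N D v)"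

lemma loud_N_deriv: "(loud_N D has_real_derivative loud_N' D v) (at v)"
  unfolding loud_N_def[abs_def] loud_N'_def
  by (auto intro!: derivative_eq_intros simp: algebra_simps)

lemma loud_N'_deriv: "(loud_N' D has_real_derivative - 2 * (1 + D)) (at v)"
  unfolding loud_N'_def[abs_def] by (auto intro!: derivative_eq_intros)

lemma loud_r_deriv:
  assumes "loud_N D v \<noteq> 0"
  shows "(loud_r D F has_real_derivative loud_r' D F v) (at v)"
proof -
  define n n' where "n = loud_N D v" and "n' = loud_N' D v"
  have n: "n \<noteq> 0" using assms by (simp add: n_def)
  have 1: "((\<lambda>v. (2 - F) / (loud_N D v)\<^sup>2) has_real_derivative - (2 - F) * (2 * n * n') / (n\<^sup>2 * n\<^sup>2)) (at v)"
    using assms unfolding n_def n'_def by (auto intro!: derivative_eq_intros loud_N_deriv simp: algebra_simps)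
  have 2: "((\<lambda>v. v * loud_N' D v / (loud_N D v) ^ 3) has_real_derivative
     ((n' + v * (- 2 * (1 + D))) * n ^ 3 - (v * n') * (3 * n\<^sup>2 * n')) / (n ^ 3 * n ^ 3)) (at v)"
    using assms unfolding n_def n'_def by (auto intro!: derivative_eq_intros loud_N_deriv loud_N'_deriv)
  have "- (2 - F) * (2 * n * n') / (n\<^sup>2 * n\<^sup>2) - ((n' + v * (- 2 * (1 + D))) * n ^ 3 - (v * n') * (3 * n\<^sup>2 * n')) / (n ^ 3 * n ^ 3)
     = loud_r' D F v"
    unfolding loud_r'_def n_def[symmetric] n'_def[symmetric] using n
    by (simp add: field_simps power2_eq_square power3_eq_cube power4_eq_xxxx)
  with DERIV_diff[OF 1 2] show ?thesis unfolding loud_r_def[abs_def] by simp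
qed

lemma loud_H0_deriv:
  assumes v: "v > 0" and n: "loud_N D v \<noteq> 0"
  shows "(loud_H0 D F has_real_derivative 2 * v powr (2 * F - 3) * loud_N D v * loud_H1 D F v) (at v)"
proof -
  have "(loud_H0 D F has_real_derivative ((2 - F) * v powr (2 - F - 1) * (2 * loud_N D v) -
      v powr (2 - F) * (2 * loud_N' D v)) / ((2 * loud_N D v) * (2 * loud_N D v))) (at v)"
    unfolding loud_H0_def[abs_def]
    by (intro DERIV_divide has_real_derivative_powr DERIV_cmult loud_N_deriv) (use v n in auto)
  moreover have "((2 - F) * v powr (2 - F - 1) * (2 * loud_N D v) -
      v powr (2 - F) * (2 * loud_N' D v)) / ((2 * loud_N D v) * (2 * loud_N D v)) =
      2 * v powr (2 * F - 3) * loud_N D v * loud_H1 D F v"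
  proof -
    define P n n' where "P = v powr (2 - F - 1)" and "n = loud_N D v" and "n' = loud_N' D v"
    have n0: "n \<noteq> 0" using n by (simp add: n_def)
    have "v powr (2 - F) = v powr ((2 - F - 1) + 1)" by simp
    also have "\<dots> = P * v" using v unfolding P_def by (simp only: powr_add powr_one)
    finally have p1: "v powr (2 - F) = P * v" .
    have "(2 * F - 3) + (4 - 3 * F) = 2 - F - 1" by simp
    then have p2: "v powr (2 * F - 3) * v powr (4 - 3 * F) = P"
      unfolding P_def by (simp only: powr_add[symmetric])
    have "2 * v powr (2 * F - 3) * n * loud_H1 D F v =
        (v powr (2 * F - 3) * v powr (4 - 3 * F)) * (n * loud_r D F v / 2)"
      by (simp add: loud_H1_def)
    also have "n * loud_r D F v = (2 - F) / n - v * n' / n\<^sup>2"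
      using n0 unfolding loud_r_def n_def[symmetric] n'_def[symmetric]
      by (simp add: field_simps power2_eq_square power3_eq_cube)
    finally have "2 * v powr (2 * F - 3) * n * loud_H1 D F v = P * (((2 - F) / n - v * n' / n\<^sup>2) / 2)"
      unfolding p2 .
    also have "\<dots> = ((2 - F) * P * (2 * n) - P * v * (2 * n')) / ((2 * n) * (2 * n))"
      using n0 by (simp add: field_simps power2_eq_square)
    finally show ?thesis
      unfolding p1 P_def[symmetric] n_def[symmetric] n'_def[symmetric] by simp
  qed
  ultimately show ?thesis by (simp only:)
qed

lemma loud_H1_deriv:
  assumes v: "v > 0" and n: "loud_N D v \<noteq> 0"
  shows "(loud_H1 D F has_real_derivative 2 * v powr (2 * F - 3) * loud_N D v * loud_H2 D F v) (at v)"
proof -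
  have "(loud_H1 D F has_real_derivative ((4 - 3 * F) * v powr (4 - 3 * F - 1) * loud_r D F v +
      loud_r' D F v * v powr (4 - 3 * F)) / 4) (at v)"
    unfolding loud_H1_def[abs_def]
    by (intro DERIV_cdivide DERIV_mult has_real_derivative_powr loud_r_deriv v n)
  moreover have "2 * v powr (2 * F - 3) * loud_N D v * loud_H2 D F v =
      ((4 - 3 * F) * v powr (4 - 3 * F - 1) * loud_r D F v + loud_r' D F v * v powr (4 - 3 * F)) / 4"
    using v n by (simp add: loud_H2_def mult.commute)
  ultimately show ?thesis by (simp only:)
qed

section \<open>The period as a function of the energy and its first two derivatives\<close>

context loud_center
begin

text \<open>The coefficient equals \<open>(3 * F - 4) / m\<close>, so the terms with
  \<open>r\<close> combine into the bracket \<open>1 / m - q / (2 * n)\<close>. By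
  \<open>q_N\<close> this bracket is \<open>v * q' / (2 * m * n)\<close>: a whole power of
  \<open>v\<close> is gained over each summand.\<close>

lemma loud_b_identity:
  assumes v: "v > 0" and n: "loud_N D v \<noteq> 0"
  shows "e v * loud_H2 D F v + (3 / 2 - 1 / m) * loud_H1 D F v = v powr (5 - 3 * F) * loud_b D F v / 4"
proof -
  define n q q' r r' where "n = loud_N D v" and "q = loud_q D F v" and "q' = loud_q' D F v"
    and "r = loud_r D F v" and "r' = loud_r' D F v"
  define P where "P = v powr (4 - 3 * F)"
  have n0: "n \<noteq> 0" using n by (simp add: n_def)
  have P: "v powr (3 - 3 * F) = P / v" "v powr (5 - 3 * F) = P * v"
    using v powr_diff[of v "4 - 3 * F" 1] powr_add[of v "4 - 3 * F" 1] by (simp_all add: P_def)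
  have "v powr m = v powr (2 * F - 3) * v"
    using v powr_add[of v "2 * F - 3" 1] by (simp add: m_def)
  moreover have "v powr (2 * F - 3) > 0" using v by simp
  ultimately have eH2: "e v * loud_H2 D F v = v * q * (((4 - 3 * F) * (P / v) * r + P * r') / 4 / (2 * n))"
    unfolding e_def loud_H2_def P q_def n_def[symmetric] r_def[symmetric] r'_def[symmetric] P_def[symmetric]
    by simp
  have m0: "m \<noteq> 0" using m by simp
  have mq: "q = (2 * n - v * q') / m" using q_N[of v] m0 by (simp add: q_def q'_def n_def field_simps)
  have k: "3 / 2 - 1 / m = (3 * F - 4) / m" using m0 by (simp add: m_def field_simps)
  have "v * q * (((4 - 3 * F) * (P / v) * r + P * r') / 4 / (2 * n)) + (3 * F - 4) / m * (P * r / 4) =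
     P * ((3 * F - 4) * r * (1 / m - q / (2 * n)) + v * q * r' / (2 * n)) / 4"
    using v n0 m0 by (simp add: field_simps)
  also have "1 / m - q / (2 * n) = v * q' / (2 * m * n)"
    unfolding mq using n0 m0 by (simp add: field_simps)
  also have "P * ((3 * F - 4) * r * (v * q' / (2 * m * n)) + v * q * r' / (2 * n)) / 4 =
     P * v * ((3 * F - 4) * q' * r / (2 * m * n) + q * r' / (2 * n)) / 4"
    using n0 m0 by (simp add: field_simps)
  finally show ?thesis
    unfolding eH2 k P(2) loud_H1_def loud_b_def P_def[symmetric] n_def[symmetric] q_def[symmetric]
      q'_def[symmetric] r_def[symmetric] r'_def[symmetric] m_def[symmetric] .
qed

lemma branch_composition_deriv:
  assumes \<eta>: "0 < \<eta>" "\<eta> < c"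
    and H: "\<And>v. v > 0 \<Longrightarrow> loud_N D v \<noteq> 0 \<Longrightarrow>
      (H has_real_derivative 2 * v powr (2 * F - 3) * loud_N D v * H' v) (at v)"
  shows "((\<lambda>\<eta>. H (vl \<eta>)) has_real_derivative H' (vl \<eta>)) (at \<eta>)"
    and "((\<lambda>\<eta>. H (vr \<eta>)) has_real_derivative H' (vr \<eta>)) (at \<eta>)"
proof -
  have m1: "m - 1 = 2 * F - 3" by (simp add: m_def)
  have l: "vl \<eta> > 0" "loud_N D (vl \<eta>) \<noteq> 0" using vl[OF \<eta>] N_pos[of "vl \<eta>"] by auto
  from DERIV_chain2[OF H[OF l] vl_deriv[OF \<eta>]]
  show "((\<lambda>\<eta>. H (vl \<eta>)) has_real_derivative H' (vl \<eta>)) (at \<eta>)"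
    using l by (simp add: m1)
  have r: "vr \<eta> > 0" "loud_N D (vr \<eta>) \<noteq> 0" using vr[OF \<eta>] N_neg[of "vr \<eta>"] by auto
  from DERIV_chain2[OF H[OF r] vr_deriv[OF \<eta>]]
  show "((\<lambda>\<eta>. H (vr \<eta>)) has_real_derivative H' (vr \<eta>)) (at \<eta>)"
    using r by (simp add: m1)
qed

text \<open>The exponent \<open>k\<close> keeps the family closed under differentiation: each
  derivative in \<open>\<eta>\<close> raises \<open>k\<close> by 2.\<close>

definition mid :: "nat \<Rightarrow> real \<Rightarrow> real \<Rightarrow> real \<Rightarrow> real" where
  "mid k va vb \<eta> = integral {va..vb} (\<lambda>v. v powr (m / 2) / sqrt (e v - \<eta>) ^ k)"

lemma sqrt_gq:
  assumes "v > 0"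
  shows "1 / sqrt (gq \<eta> v) = v powr (m / 2) / sqrt (e v - \<eta>)"
proof -
  have "sqrt (v powr (- m)) = v powr (- m / 2)" using assms by (simp add: powr_half_sqrt[symmetric] powr_powr)
  then have "sqrt (gq \<eta> v) = v powr (- m / 2) * sqrt (e v - \<eta>)"
    using assms by (simp only: gq_e real_sqrt_mult)
  moreover have "v powr (- m / 2) = 1 / v powr (m / 2)" by (simp add: powr_minus_divide[symmetric])
  ultimately show ?thesis by simp
qed

text \<open>The time function is cut at \<open>va\<close> and \<open>vb\<close>. Next to a turning
  point \<open>e\<close> is the variable and the contribution is an Abel integral; in between
  \<open>v\<close> itself is kept, because \<open>e\<close> is not invertible at 1. The right branch
  enters with a minus sign since \<open>e\<close> decreases there and \<open>loud_H0\<close> is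
  negative.\<close>

lemma period_split:
  assumes va: "0 < va" "va < 1" and vb: "1 < vb" "vb < loud_vmax D F"
    and \<eta>: "0 < \<eta>" "\<eta> < e va" "\<eta> < e vb"
  shows "period \<eta> = 2 * (abel (e va) (\<lambda>x. loud_H0 D F (vl x)) \<eta> + mid 1 va vb \<eta> -
     abel (e vb) (\<lambda>x. loud_H0 D F (vr x)) \<eta>)"
proof -
  have c: "e va < c" "e vb < c" using e_le_c[of va] e_le_c[of vb] va vb vmax_gt_1
    by (auto simp: less_le)
  have \<eta>c: "0 < \<eta>" "\<eta> < c" using \<eta> c by auto
  obtain t where t: "continuous_on {vl \<eta>..vr \<eta>} t" "t (vl \<eta>) = 0" "t (vr \<eta>) = period \<eta> / 2"
    "\<And>v. vl \<eta> < v \<Longrightarrow> v < vr \<eta> \<Longrightarrow> (t has_real_derivative 1 / sqrt (gq \<eta> v)) (at v)"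
    by (rule period_time[OF \<eta>c]) (rule that; assumption)
  have ba: "vl \<eta> < va" "va < vr \<eta>" using e_gt_iff(1)[OF \<eta>c, of va] \<eta> va vmax_gt_1 by auto
  have bb: "vl \<eta> < vb" "vb < vr \<eta>" using e_gt_iff(1)[OF \<eta>c, of vb] \<eta> vb by auto
  \<comment> \<open>Applied with \<open>w = vl\<close> and with \<open>w = vr\<close>.\<close>
  have branch: "((\<lambda>x. 2 * sqrt (e0 - \<eta>) * loud_H0 D F (w (\<eta> + (e0 - \<eta>) * x\<^sup>2))) has_integral
       t (w e0) - t (w \<eta>)) {0..1}"
    if e0: "\<eta> < e0" "e0 < c"
      and w: "\<And>x. \<eta> \<le> x \<Longrightarrow> x < c \<Longrightarrow> vl \<eta> \<le> w x \<and> w x \<le> vr \<eta> \<and> e (w x) = x"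
      and wd: "\<And>x. 0 < x \<Longrightarrow> x < c \<Longrightarrow>
         (w has_real_derivative 1 / (2 * w x powr (m - 1) * loud_N D (w x))) (at x)" for e0 w
  proof -
    let ?e = "\<lambda>x. \<eta> + (e0 - \<eta>) * x\<^sup>2"
    have r: "\<eta> \<le> ?e x \<and> ?e x < c" if "x \<in> {0..1}" for x
      using abel_arg(1,2)[OF \<eta>(1) e0(1) that] e0 by simp
    have "((\<lambda>x. 2 * sqrt (e0 - \<eta>) * loud_H0 D F (w (?e x))) has_integral t (w (?e 1)) - t (w (?e 0))) {0..1}"
    proof (rule fundamental_theorem_of_calculus_interior[where f="\<lambda>x. t (w (?e x))"])
      have "isCont w x" if "x \<in> {0<..<c}" for x using wd[of x] that by (auto intro: DERIV_isCont)
      then have cw: "continuous_on {0<..<c} w" by (simp add: continuous_at_imp_continuous_on)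
      have ce: "continuous_on {0..1} ?e" by (intro continuous_intros)
      have "?e x \<in> {0<..<c}" if "x \<in> {0..1}" for x using r[OF that] \<eta>(1) by auto
      then have cwe: "continuous_on {0..1} (\<lambda>x. w (?e x))"
        by (intro continuous_on_compose2[OF cw ce] image_subsetI)
      have "w (?e x) \<in> {vl \<eta>..vr \<eta>}" if "x \<in> {0..1}" for x
        using w[of "?e x"] r[OF that] by auto
      then show "continuous_on {0..1} (\<lambda>x. t (w (?e x)))"
        by (intro continuous_on_compose2[OF t(1) cwe] image_subsetI)
      fix x :: real assume x: "x \<in> {0<..<1}"
      define v where "v = w (?e x)"
      have x2: "x\<^sup>2 > 0" "x\<^sup>2 < 1" using x by (simp_all add: abs_square_less_1)
      have ex: "\<eta> < ?e x" "?e x < c" using x2(1) r[of x] x e0 by auto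
      have v: "vl \<eta> \<le> v" "v \<le> vr \<eta>" "e v = ?e x" using w[of "?e x"] ex by (auto simp: v_def)
      have v0: "v > 0" "v \<le> loud_vmax D F" using v vl[OF \<eta>c] vr[OF \<eta>c] by auto
      have vi: "vl \<eta> < v" "v < vr \<eta>" using e_gt_iff(1)[OF \<eta>c v0] v(3) ex by auto
      have "((\<lambda>x. ?e x) has_real_derivative (e0 - \<eta>) * (2 * x)) (at x)" by (auto intro!: derivative_eq_intros)
      from DERIV_chain2[OF wd[of "?e x"] this]
      have "((\<lambda>x. w (?e x)) has_real_derivative 1 / (2 * v powr (m - 1) * loud_N D v) * ((e0 - \<eta>) * (2 * x))) (at x)"
        using ex \<eta> by (simp add: v_def)
      from DERIV_chain2[OF t(4)[OF vi, unfolded v_def] this]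
      have "((\<lambda>x. t (w (?e x))) has_real_derivative 1 / sqrt (gq \<eta> v) *
          (1 / (2 * v powr (m - 1) * loud_N D v) * ((e0 - \<eta>) * (2 * x)))) (at x)" by (simp add: v_def)
      moreover have "1 / sqrt (gq \<eta> v) * (1 / (2 * v powr (m - 1) * loud_N D v) * ((e0 - \<eta>) * (2 * x))) =
          2 * sqrt (e0 - \<eta>) * loud_H0 D F v"
      proof -
        define s where "s = sqrt (e0 - \<eta>)"
        have s: "s > 0" "e0 - \<eta> = s * s" using e0 by (simp_all add: s_def)
        have "sqrt (e v - \<eta>) = s * x"
          unfolding v(3) s(2) using s(1) x by (simp add: real_sqrt_mult)
        then have "1 / sqrt (gq \<eta> v) = v powr (m / 2) / (s * x)" by (simp add: sqrt_gq[OF v0(1)])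
        \<comment> \<open>From \<open>dv = de / (2 * v powr (m - 1) * loud_N D v)\<close>; the
          quotient of the two powers is the \<open>v powr (2 - F)\<close> of
          \<open>loud_H0\<close>.\<close>
        moreover have "m / 2 = (m - 1) + (2 - F)" by (simp add: m_def field_simps)
        then have "v powr (m / 2) = v powr (m - 1) * v powr (2 - F)" by (simp only: powr_add)
        ultimately show ?thesis
          unfolding s_def[symmetric] s(2) loud_H0_def using x s(1) v0(1) by simp
      qed
      ultimately show "((\<lambda>x. t (w (?e x))) has_vector_derivative 2 * sqrt (e0 - \<eta>) * loud_H0 D F (w (?e x))) (at x)"
        by (simp add: has_real_derivative_iff_has_vector_derivative v_def)
    qed simp
    then show ?thesis by simp
  qed
  have wl: "vl \<eta> \<le> vl x \<and> vl x \<le> vr \<eta> \<and> e (vl x) = x" if "\<eta> \<le> x" "x < c" for x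
  proof -
    have x: "0 < x" "x < c" using that \<eta> by auto
    show ?thesis using e_gt_iff(2)[OF \<eta>c, of "vl x"] vl[OF x] that vmax_gt_1 by auto
  qed
  have wr: "vl \<eta> \<le> vr x \<and> vr x \<le> vr \<eta> \<and> e (vr x) = x" if "\<eta> \<le> x" "x < c" for x
  proof -
    have x: "0 < x" "x < c" using that \<eta> by auto
    show ?thesis using e_gt_iff(2)[OF \<eta>c, of "vr x"] vr[OF x] that by auto
  qed
  have L: "abel (e va) (\<lambda>x. loud_H0 D F (vl x)) \<eta> = t va"
    using integral_unique[OF branch[OF \<eta>(2) c(1) wl vl_deriv]] vl_e[OF va] t(2)
    by (simp add: abel_def)
  have R: "abel (e vb) (\<lambda>x. loud_H0 D F (vr x)) \<eta> = t vb - period \<eta> / 2"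
    using integral_unique[OF branch[OF \<eta>(3) c(2) wr vr_deriv]] vr_e[OF vb] t(3)
    by (simp add: abel_def)
  have "((\<lambda>v. v powr (m / 2) / sqrt (e v - \<eta>)) has_integral t vb - t va) {va..vb}"
  proof (rule fundamental_theorem_of_calculus)
    fix v assume v: "v \<in> {va..vb}"
    then have "(t has_real_derivative v powr (m / 2) / sqrt (e v - \<eta>)) (at v)"
      using t(4)[of v] ba bb va sqrt_gq[of v \<eta>] by auto
    then show "(t has_vector_derivative v powr (m / 2) / sqrt (e v - \<eta>)) (at v within {va..vb})"
      by (simp add: has_real_derivative_iff_has_vector_derivative has_vector_derivative_at_within)
  qed (use va vb in auto)
  then have "mid 1 va vb \<eta> = t vb - t va" by (simp add: mid_def integral_unique)
  then show ?thesis using L R by simp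
qed

end

lemma inverse_sqrt_power_deriv:
  fixes a \<eta> :: real
  assumes "\<eta> < a"
  shows "((\<lambda>\<eta>. x / sqrt (a - \<eta>) ^ k) has_real_derivative (real k / 2) * (x / sqrt (a - \<eta>) ^ (k + 2))) (at \<eta>)"
proof -
  define w where "w = inverse (sqrt (a - \<eta>))"
  have pos: "a - \<eta> > 0" using assms by simp
  have "((\<lambda>\<eta>. a - \<eta>) has_real_derivative -1) (at \<eta>)" by (auto intro!: derivative_eq_intros)
  from DERIV_chain2[where f=sqrt and g="\<lambda>\<eta>. a - \<eta>", OF DERIV_real_sqrt[OF pos] this]
  have "((\<lambda>\<eta>. sqrt (a - \<eta>)) has_real_derivative w / 2 * (-1)) (at \<eta>)" by (simp only: w_def)
  from DERIV_inverse'[OF this] pos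
  have "((\<lambda>\<eta>. inverse (sqrt (a - \<eta>))) has_real_derivative - (w * (w / 2 * (-1)) * w)) (at \<eta>)"
    by (simp only: w_def) simp
  from DERIV_cmult[OF DERIV_power[OF this, of k], of x]
  have "((\<lambda>\<eta>. x * inverse (sqrt (a - \<eta>)) ^ k) has_real_derivative
      x * (real k * (- (w * (w / 2 * (-1)) * w) * w ^ (k - Suc 0)))) (at \<eta>)"
    by (simp only: w_def)
  moreover have "x * (real k * (- (w * (w / 2 * (-1)) * w) * w ^ (k - Suc 0))) = real k / 2 * (x * w ^ (k + 2))"
  proof (cases k)
    case 0
    then show ?thesis by simp
  next
    case (Suc n)
    have p: "w ^ (k + 2) = w * w * w * w ^ n" by (simp add: Suc)
    have p': "w ^ (k - Suc 0) = w ^ n" by (simp add: Suc)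
    have h: "- (w * (w / 2 * (-1)) * w) = w * w * w * (1 / 2)" "real k / 2 = real k * (1 / 2)" by simp_all
    show ?thesis unfolding p p' h by (simp only: mult_ac)
  qed
  ultimately show ?thesis by (simp only: w_def divide_inverse power_inverse)
qed

lemma integral_inverse_sqrt_power_deriv:
  fixes f g :: "real \<Rightarrow> real"
  assumes f: "continuous_on {a..b} f" and g: "continuous_on {a..b} g"
    and L: "\<And>v. v \<in> {a..b} \<Longrightarrow> L \<le> g v" and \<eta>: "\<eta> < L"
  shows "((\<lambda>\<eta>. integral {a..b} (\<lambda>v. f v / sqrt (g v - \<eta>) ^ k)) has_real_derivative
     (real k / 2) * integral {a..b} (\<lambda>v. f v / sqrt (g v - \<eta>) ^ (k + 2))) (at \<eta>)"
proof -
  have "((\<lambda>\<eta>. integral (cbox a b) (\<lambda>v. f v / sqrt (g v - \<eta>) ^ k)) has_field_derivative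
     integral (cbox a b) (\<lambda>v. (real k / 2) * (f v / sqrt (g v - \<eta>) ^ (k + 2)))) (at \<eta> within {..<L})"
  proof (rule leibniz_rule_field_derivative)
    fix t v assume "t \<in> {..<L}" "v \<in> cbox a b"
    then have "t < g v" using L[of v] by auto
    from inverse_sqrt_power_deriv[OF this, of "f v" k]
    show "((\<lambda>t. f v / sqrt (g v - t) ^ k) has_real_derivative
        (real k / 2) * (f v / sqrt (g v - t) ^ (k + 2))) (at t within {..<L})"
      by (rule has_field_derivative_at_within)
  next
    fix t assume t: "t \<in> {..<L}"
    have "continuous_on {a..b} (\<lambda>v. f v / sqrt (g v - t) ^ k)"
      using L t by (intro continuous_intros f g) fastforce
    then show "(\<lambda>v. f v / sqrt (g v - t) ^ k) integrable_on cbox a b"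
      by (simp add: integrable_continuous_real)
  next
    have "continuous_on ({..<L} \<times> {a..b}) (\<lambda>z. (real k / 2) * (f (snd z) / sqrt (g (snd z) - fst z) ^ (k + 2)))"
      by (intro continuous_intros continuous_on_compose2[OF f] continuous_on_compose2[OF g]) (use L in fastforce)+
    then show "continuous_on ({..<L} \<times> cbox a b) (\<lambda>(t, v). (real k / 2) * (f v / sqrt (g v - t) ^ (k + 2)))"
      by (simp add: case_prod_unfold)
  qed (use \<eta> in auto)
  moreover have "at \<eta> within {..<L} = at \<eta>" using \<eta> by (intro at_within_open) auto
  ultimately show ?thesis by (simp only: integral_mult_right box_real)
qed

context loud_center
begin

context
  fixes va vb :: real
  assumes va: "0 < va" "va < 1" and vb: "1 < vb" "vb < loud_vmax D F"
begin

text \<open>\<open>e\<close> increases up to 1 and decreases afterwards, so its minimum over the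
  interval sits at an end.\<close>

lemma e_mid:
  assumes "v \<in> {va..vb}"
  shows "min (e va) (e vb) \<le> e v"
  using e_strict_mono[of va v] e_strict_antimono[of v vb] assms va vb
  by (cases "v \<le> 1"; cases "v = va"; cases "v = vb") (auto simp: min_le_iff_disj)

lemma e_ab: "0 < e va" "e va < c" "0 < e vb" "e vb < c"
  using e_pos[of va] e_pos[of vb] e_le_c[of va] e_le_c[of vb] va vb vmax_gt_1 by (auto simp: less_le)

lemma mid_deriv:
  assumes "\<eta> < e va" "\<eta> < e vb"
  shows "(mid k va vb has_real_derivative real k / 2 * mid (k + 2) va vb \<eta>) (at \<eta>)"
  unfolding mid_def[abs_def]
proof (rule integral_inverse_sqrt_power_deriv[where g=e and f="\<lambda>v. v powr (m / 2)", OF _ _ e_mid])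
  show "continuous_on {va..vb} (\<lambda>v. v powr (m / 2))" using va by (intro continuous_intros) auto
  show "continuous_on {va..vb} e" by (rule continuous_on_subset[OF e_cont]) (use va in auto)
qed (use assms in auto)

text \<open>The terms with \<open>loud_H0\<close> are the boundary terms of
  \<open>abel_has_derivative\<close> at the two cuts. The exponent \<open>^ 1\<close> is kept so
  that \<open>inverse_sqrt_power_deriv\<close> applies to them with \<open>k = 1\<close>.\<close>

definition "period1 \<eta> = 2 * (abel (e va) (\<lambda>x. loud_H1 D F (vl x)) \<eta> - loud_H0 D F va / sqrt (e va - \<eta>) ^ 1
   + 1 / 2 * mid 3 va vb \<eta> - abel (e vb) (\<lambda>x. loud_H1 D F (vr x)) \<eta> + loud_H0 D F vb / sqrt (e vb - \<eta>) ^ 1)"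

definition "period2 \<eta> = 2 * (abel (e va) (\<lambda>x. loud_H2 D F (vl x)) \<eta> - loud_H1 D F va / sqrt (e va - \<eta>) ^ 1
   - 1 / 2 * (loud_H0 D F va / sqrt (e va - \<eta>) ^ 3)
   + 3 / 4 * mid 5 va vb \<eta> - abel (e vb) (\<lambda>x. loud_H2 D F (vr x)) \<eta> + loud_H1 D F vb / sqrt (e vb - \<eta>) ^ 1
   + 1 / 2 * (loud_H0 D F vb / sqrt (e vb - \<eta>) ^ 3))"

lemma H_branch_deriv:
  assumes "0 < x" "x < c"
  shows "((\<lambda>x. loud_H0 D F (vl x)) has_real_derivative loud_H1 D F (vl x)) (at x)"
    "((\<lambda>x. loud_H0 D F (vr x)) has_real_derivative loud_H1 D F (vr x)) (at x)"
    "((\<lambda>x. loud_H1 D F (vl x)) has_real_derivative loud_H2 D F (vl x)) (at x)"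
    "((\<lambda>x. loud_H1 D F (vr x)) has_real_derivative loud_H2 D F (vr x)) (at x)"
  by (rule branch_composition_deriv[OF assms]; rule loud_H0_deriv loud_H1_deriv; assumption)+

lemma branch_cont: "continuous_on {0<..<c} vl" "continuous_on {0<..<c} vr"
  using vl_deriv vr_deriv by (auto intro!: continuous_at_imp_continuous_on DERIV_isCont)

lemma H2_cont: "continuous_on {0<..<c} (\<lambda>x. loud_H2 D F (vl x))" "continuous_on {0<..<c} (\<lambda>x. loud_H2 D F (vr x))"
proof -
  have N: "continuous_on UNIV (loud_N D)" unfolding loud_N_def by (intro continuous_intros)
  have N': "continuous_on UNIV (loud_N' D)" unfolding loud_N'_def by (intro continuous_intros)
  have H2: "continuous_on S (loud_H2 D F)" if "\<And>v. v \<in> S \<Longrightarrow> v > 0 \<and> loud_N D v \<noteq> 0" for S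
    unfolding loud_H2_def loud_r_def loud_r'_def
    by (intro continuous_intros continuous_on_subset[OF N] continuous_on_subset[OF N']) (use that in force)+
  have 1: "v > 0 \<and> loud_N D v \<noteq> 0" if "v \<in> {0<..<1}" for v using N_pos[of v] that by auto
  have 2: "v > 0 \<and> loud_N D v \<noteq> 0" if "v \<in> {1<..<loud_vmax D F}" for v using N_neg[of v] that by auto
  show "continuous_on {0<..<c} (\<lambda>x. loud_H2 D F (vl x))"
    by (intro continuous_on_compose2[OF H2[of "{0<..<1}", OF 1] branch_cont(1)] image_subsetI) (simp_all add: vl)
  show "continuous_on {0<..<c} (\<lambda>x. loud_H2 D F (vr x))"
    by (intro continuous_on_compose2[OF H2[of "{1<..<loud_vmax D F}", OF 2] branch_cont(2)] image_subsetI) (simp_all add: vr)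
qed

lemma H1_cont: "continuous_on {0<..<c} (\<lambda>x. loud_H1 D F (vl x))" "continuous_on {0<..<c} (\<lambda>x. loud_H1 D F (vr x))"
  using H_branch_deriv(3,4) by (auto intro!: continuous_at_imp_continuous_on DERIV_isCont)

lemma period_deriv:
  assumes \<eta>: "0 < \<eta>" "\<eta> < e va" "\<eta> < e vb"
  shows "(period has_real_derivative period1 \<eta>) (at \<eta>)" "(period1 has_real_derivative period2 \<eta>) (at \<eta>)"
proof -
  have sub: "{0<..e va} \<subseteq> {0<..<c}" "{0<..e vb} \<subseteq> {0<..<c}" using e_ab by auto
  have s: "vl (e va) = va" "vr (e vb) = vb" using vl_e va vr_e vb by auto
  have da: "(abel (e va) (\<lambda>x. loud_H0 D F (vl x)) has_real_derivative
      abel (e va) (\<lambda>x. loud_H1 D F (vl x)) \<eta> - loud_H0 D F va / sqrt (e va - \<eta>)) (at \<eta>)"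
    "(abel (e va) (\<lambda>x. loud_H1 D F (vl x)) has_real_derivative
      abel (e va) (\<lambda>x. loud_H2 D F (vl x)) \<eta> - loud_H1 D F va / sqrt (e va - \<eta>)) (at \<eta>)"
    using abel_has_derivative[OF \<eta>(1,2), of "\<lambda>x. loud_H0 D F (vl x)" "\<lambda>x. loud_H1 D F (vl x)"]
      abel_has_derivative[OF \<eta>(1,2), of "\<lambda>x. loud_H1 D F (vl x)" "\<lambda>x. loud_H2 D F (vl x)"]
      H_branch_deriv(1,3) sub H1_cont H2_cont s e_ab
    by (auto intro: continuous_on_subset)
  have db: "(abel (e vb) (\<lambda>x. loud_H0 D F (vr x)) has_real_derivative
      abel (e vb) (\<lambda>x. loud_H1 D F (vr x)) \<eta> - loud_H0 D F vb / sqrt (e vb - \<eta>)) (at \<eta>)"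
    "(abel (e vb) (\<lambda>x. loud_H1 D F (vr x)) has_real_derivative
      abel (e vb) (\<lambda>x. loud_H2 D F (vr x)) \<eta> - loud_H1 D F vb / sqrt (e vb - \<eta>)) (at \<eta>)"
    using abel_has_derivative[OF \<eta>(1,3), of "\<lambda>x. loud_H0 D F (vr x)" "\<lambda>x. loud_H1 D F (vr x)"]
      abel_has_derivative[OF \<eta>(1,3), of "\<lambda>x. loud_H1 D F (vr x)" "\<lambda>x. loud_H2 D F (vr x)"]
      H_branch_deriv(2,4) sub H1_cont H2_cont s e_ab
    by (auto intro: continuous_on_subset)
  note dm = mid_deriv[OF \<eta>(2,3)]
  have dm1: "(mid 1 va vb has_real_derivative 1 / 2 * mid 3 va vb \<eta>) (at \<eta>)"
    using dm[of 1] by (simp add: numeral_3_eq_3)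
  define Q where "Q \<eta> = 2 * (abel (e va) (\<lambda>x. loud_H0 D F (vl x)) \<eta> + mid 1 va vb \<eta> -
     abel (e vb) (\<lambda>x. loud_H0 D F (vr x)) \<eta>)" for \<eta>
  have "(Q has_real_derivative 2 * ((abel (e va) (\<lambda>x. loud_H1 D F (vl x)) \<eta> - loud_H0 D F va / sqrt (e va - \<eta>))
      + 1 / 2 * mid 3 va vb \<eta> - (abel (e vb) (\<lambda>x. loud_H1 D F (vr x)) \<eta> - loud_H0 D F vb / sqrt (e vb - \<eta>)))) (at \<eta>)"
    unfolding Q_def[abs_def] by (intro DERIV_cmult DERIV_diff DERIV_add da db dm1)
  then have "(Q has_real_derivative period1 \<eta>) (at \<eta>)" by (simp add: period1_def algebra_simps)
  moreover have "\<forall>\<^sub>F x in nhds \<eta>. x \<in> {0<..<min (e va) (e vb)}"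
    using \<eta> by (intro eventually_nhds_in_open) auto
  then have "\<forall>\<^sub>F x in nhds \<eta>. period x = Q x"
    by eventually_elim (use period_split[OF va vb] in \<open>simp add: Q_def\<close>)
  ultimately show "(period has_real_derivative period1 \<eta>) (at \<eta>)"
    by (simp only: DERIV_cong_ev[OF refl _ refl])
  have k: "(1 :: nat) + 2 = 3" "(3 :: nat) + 2 = 5" "real 1 = 1" "real 3 = 3" by simp_all
  note ds = inverse_sqrt_power_deriv[of _ _ _ 1, unfolded k] and dm3 = dm[of 3, unfolded k]
  have "(period1 has_real_derivative 2 * ((abel (e va) (\<lambda>x. loud_H2 D F (vl x)) \<eta> - loud_H1 D F va / sqrt (e va - \<eta>))
      - 1 / 2 * (loud_H0 D F va / sqrt (e va - \<eta>) ^ 3)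
      + 1 / 2 * (3 / 2 * mid 5 va vb \<eta>)
      - (abel (e vb) (\<lambda>x. loud_H2 D F (vr x)) \<eta> - loud_H1 D F vb / sqrt (e vb - \<eta>))
      + 1 / 2 * (loud_H0 D F vb / sqrt (e vb - \<eta>) ^ 3))) (at \<eta>)"
    unfolding period1_def[abs_def]
    by (intro DERIV_cmult DERIV_diff DERIV_add da db dm3 ds \<eta>)
  then show "(period1 has_real_derivative period2 \<eta>) (at \<eta>)"
    by (rule DERIV_cong) (simp add: period2_def algebra_simps)
qed

text \<open>\<open>abel_scaling\<close> adds 1/2 to the coefficient \<open>1 - 1 / m\<close>, which
  yields exactly the \<open>3 / 2 - 1 / m\<close> of \<open>loud_b_identity\<close>.\<close>

lemma period_S_left:
  assumes \<eta>: "0 < \<eta>" "\<eta> < e va"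
  shows "\<eta> * abel (e va) (\<lambda>x. loud_H2 D F (vl x)) \<eta> + (1 - 1 / m) * abel (e va) (\<lambda>x. loud_H1 D F (vl x)) \<eta> =
    abel (e va) (\<lambda>x. vl x powr (5 - 3 * F) * loud_b D F (vl x) / 4) \<eta> - sqrt (e va - \<eta>) * loud_H1 D F va"
proof -
  have sub: "{0<..e va} \<subseteq> {0<..<c}" using e_ab by auto
  have c1: "continuous_on {0<..e va} (\<lambda>x. loud_H1 D F (vl x))" "continuous_on {0<..e va} (\<lambda>x. loud_H2 D F (vl x))"
    using H1_cont(1) H2_cont(1) sub by (auto intro: continuous_on_subset)
  have "\<eta> * abel (e va) (\<lambda>x. loud_H2 D F (vl x)) \<eta> = abel (e va) (\<lambda>x. x * loud_H2 D F (vl x)) \<eta> +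
      abel (e va) (\<lambda>x. loud_H1 D F (vl x)) \<eta> / 2 - sqrt (e va - \<eta>) * loud_H1 D F (vl (e va))"
    by (rule abel_scaling[OF \<eta> _ c1(2)]) (use H_branch_deriv(3) sub in auto)
  moreover have "abel (e va) (\<lambda>x. x * loud_H2 D F (vl x) + (3 / 2 - 1 / m) * loud_H1 D F (vl x)) \<eta> =
      abel (e va) (\<lambda>x. x * loud_H2 D F (vl x)) \<eta> + (3 / 2 - 1 / m) * abel (e va) (\<lambda>x. loud_H1 D F (vl x)) \<eta>"
    by (subst abel_add[OF \<eta>]) (auto intro!: continuous_intros c1 simp: abel_cmult)
  moreover have "abel (e va) (\<lambda>x. x * loud_H2 D F (vl x) + (3 / 2 - 1 / m) * loud_H1 D F (vl x)) \<eta> =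
      abel (e va) (\<lambda>x. vl x powr (5 - 3 * F) * loud_b D F (vl x) / 4) \<eta>"
  proof -
    have "x * loud_H2 D F (vl x) + (3 / 2 - 1 / m) * loud_H1 D F (vl x) = vl x powr (5 - 3 * F) * loud_b D F (vl x) / 4"
      if "x \<in> {0<..e va}" for x
      using loud_b_identity[of "vl x"] vl[of x] N_pos[of "vl x"] that sub by force
    then show ?thesis unfolding abel_def using abel_arg(3)[OF \<eta>]
      by (intro arg_cong2[where f=times] refl integral_cong) blast
  qed
  ultimately show ?thesis using vl_e[OF va] by (simp add: algebra_simps)
qed

lemma b_cont: "continuous_on {0<..e va} (\<lambda>x. vl x powr (5 - 3 * F) * loud_b D F (vl x) / 4)"
proof -
  have sub: "{0<..e va} \<subseteq> {0<..<c}" using e_ab by auto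
  have "continuous_on {0<..e va} (\<lambda>x. x * loud_H2 D F (vl x) + (3 / 2 - 1 / m) * loud_H1 D F (vl x))"
    by (intro continuous_intros continuous_on_subset[OF H1_cont(1) sub] continuous_on_subset[OF H2_cont(1) sub])
  moreover have "x * loud_H2 D F (vl x) + (3 / 2 - 1 / m) * loud_H1 D F (vl x) = vl x powr (5 - 3 * F) * loud_b D F (vl x) / 4"
    if "x \<in> {0<..e va}" for x
    using loud_b_identity[of "vl x"] vl[of x] N_pos[of "vl x"] that sub by force
  ultimately show ?thesis by (simp cong: continuous_on_cong_simp)
qed

end

end

section \<open>Estimates near the outer boundary\<close>

text \<open>With \<open>a = sqrt \<eta>\<close> and \<open>b = sqrt e0\<close>, the argument
  \<open>\<eta> + (e0 - \<eta>) * x\<^sup>2\<close> is at most \<open>(a + b * x)\<^sup>2\<close>.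
  The exponent is nonpositive, so the integrand is at least a power of \<open>a + b * x\<close>,
  which integrates explicitly. The prefactor is at least \<open>b\<close> because
  \<open>\<eta> \<le> e0 / 2\<close>.\<close>

lemma abel_powr_lower:
  fixes \<eta> e0 \<nu> :: real
  assumes \<eta>: "0 < \<eta>" "\<eta> \<le> e0 / 2" and \<nu>: "0 < \<nu>" "\<nu> \<le> 1 / 2"
  shows "abel e0 (\<lambda>x. x powr (\<nu> - 1 / 2)) \<eta> \<ge> (e0 powr \<nu> - \<eta> powr \<nu>) / (2 * \<nu>)"
proof -
  have e0: "e0 > 0" "\<eta> < e0" using \<eta> by auto
  define a b where "a = sqrt \<eta>" and "b = sqrt e0"
  have ab: "a > 0" "b > 0" using \<eta> e0 by (simp_all add: a_def b_def)
  have d: "((\<lambda>x. (a + b * x) powr (2 * \<nu> - 1)) has_integral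
      (a + b * 1) powr (2 * \<nu>) / (2 * \<nu> * b) - (a + b * 0) powr (2 * \<nu>) / (2 * \<nu> * b)) {0..1}"
  proof (rule fundamental_theorem_of_calculus[where f="\<lambda>x. (a + b * x) powr (2 * \<nu>) / (2 * \<nu> * b)"])
    fix x :: real assume x: "x \<in> {0..1}"
    have p: "a + b * x > 0" using ab x by (simp add: add_pos_nonneg)
    have "((\<lambda>x. a + b * x) has_real_derivative b) (at x)" by (auto intro!: derivative_eq_intros)
    from DERIV_cdivide[OF DERIV_chain2[where f="\<lambda>y. y powr (2 * \<nu>)", OF has_real_derivative_powr[OF p] this], of "2 * \<nu> * b"]
    have "((\<lambda>x. (a + b * x) powr (2 * \<nu>) / (2 * \<nu> * b)) has_real_derivative (a + b * x) powr (2 * \<nu> - 1)) (at x)"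
      using \<nu> ab by simp
    then show "((\<lambda>x. (a + b * x) powr (2 * \<nu>) / (2 * \<nu> * b)) has_vector_derivative (a + b * x) powr (2 * \<nu> - 1)) (at x within {0..1})"
      by (simp add: has_real_derivative_iff_has_vector_derivative has_vector_derivative_at_within)
  qed simp
  have c: "continuous_on {0<..e0} (\<lambda>x. x powr (\<nu> - 1 / 2))" by (intro continuous_intros) auto
  have "integral {0..1} (\<lambda>x. (a + b * x) powr (2 * \<nu> - 1)) \<le>
      integral {0..1} (\<lambda>x. (\<eta> + (e0 - \<eta>) * x\<^sup>2) powr (\<nu> - 1 / 2))"
  proof (rule integral_le)
    show "(\<lambda>x. (a + b * x) powr (2 * \<nu> - 1)) integrable_on {0..1}" using d by (rule has_integral_integrable)
    show "(\<lambda>x. (\<eta> + (e0 - \<eta>) * x\<^sup>2) powr (\<nu> - 1 / 2)) integrable_on {0..1}"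
      by (rule abel_integrable(2)[OF \<eta>(1) e0(2) c])
    fix x :: real assume x: "x \<in> {0..1}"
    have p: "a + b * x > 0" using ab x by (simp add: add_pos_nonneg)
    have l: "\<eta> + (e0 - \<eta>) * x\<^sup>2 > 0" using abel_arg(3)[OF \<eta>(1) e0(2) x] by simp
    have "\<eta> + (e0 - \<eta>) * x\<^sup>2 \<le> \<eta> + e0 * x\<^sup>2"
      using \<eta>(1) by (intro add_left_mono mult_right_mono) auto
    also have "\<dots> = a\<^sup>2 + b\<^sup>2 * x\<^sup>2" using \<eta> e0 by (simp add: a_def b_def)
    also have "\<dots> \<le> (a + b * x)\<^sup>2" using ab x by (simp add: power2_sum power_mult_distrib)
    finally have le: "\<eta> + (e0 - \<eta>) * x\<^sup>2 \<le> (a + b * x)\<^sup>2" .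
    have "(a + b * x) powr (2 * \<nu> - 1) = ((a + b * x) powr 2) powr (\<nu> - 1 / 2)"
      unfolding powr_powr by (simp add: right_diff_distrib)
    also have "(a + b * x) powr 2 = (a + b * x)\<^sup>2" using p by simp
    also have "((a + b * x)\<^sup>2) powr (\<nu> - 1 / 2) \<le> (\<eta> + (e0 - \<eta>) * x\<^sup>2) powr (\<nu> - 1 / 2)"
      using \<nu> l le by (intro powr_mono2') auto
    finally show "(a + b * x) powr (2 * \<nu> - 1) \<le> (\<eta> + (e0 - \<eta>) * x\<^sup>2) powr (\<nu> - 1 / 2)" .
  qed
  moreover have "integral {0..1} (\<lambda>x. (a + b * x) powr (2 * \<nu> - 1)) =
      ((a + b) powr (2 * \<nu>) - a powr (2 * \<nu>)) / (2 * \<nu> * b)"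
    using integral_unique[OF d] by (simp add: diff_divide_distrib)
  moreover have "a powr (2 * \<nu>) = \<eta> powr \<nu>" "b powr (2 * \<nu>) = e0 powr \<nu>"
    using \<eta> e0 by (simp_all add: a_def b_def powr_half_sqrt[symmetric] powr_powr)
  moreover have "b powr (2 * \<nu>) \<le> (a + b) powr (2 * \<nu>)" using ab \<nu> by (intro powr_mono2) auto
  ultimately have I: "integral {0..1} (\<lambda>x. (\<eta> + (e0 - \<eta>) * x\<^sup>2) powr (\<nu> - 1 / 2)) \<ge>
      (e0 powr \<nu> - \<eta> powr \<nu>) / (2 * \<nu> * b)"
    using \<nu> ab by (smt (verit) divide_right_mono mult_pos_pos)
  have pos: "(e0 powr \<nu> - \<eta> powr \<nu>) / (2 * \<nu>) \<ge> 0"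
    using \<eta> e0 \<nu> by (intro divide_nonneg_nonneg) (auto intro: powr_mono2)
  have "b / 2 \<le> sqrt (e0 - \<eta>)"
  proof -
    have "(b / 2)\<^sup>2 \<le> e0 - \<eta>" using \<eta> e0 by (simp add: b_def power_divide)
    then show ?thesis by (rule real_le_rsqrt)
  qed
  then have "b \<le> 2 * sqrt (e0 - \<eta>)" by simp
  then have "b * ((e0 powr \<nu> - \<eta> powr \<nu>) / (2 * \<nu> * b)) \<le>
     2 * sqrt (e0 - \<eta>) * integral {0..1} (\<lambda>x. (\<eta> + (e0 - \<eta>) * x\<^sup>2) powr (\<nu> - 1 / 2))"
    using I pos ab \<nu> e0 by (intro mult_mono) (auto simp: zero_le_divide_iff)
  then show ?thesis using ab by (simp add: abel_def)
qed

text \<open>\<open>\<nu>\<close> and \<open>\<eta>0\<close> depend only on \<open>K\<close> and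
  \<open>el\<close>. The uniformity in \<open>e0\<close> is used later, since the energy at the cut
  varies with the parameters.\<close>

lemma abel_powr_unbounded:
  fixes K el :: real
  assumes el: "0 < el" "el \<le> 1"
  obtains \<nu> \<eta>0 where "0 < \<nu>" "\<nu> \<le> 1 / 8" "0 < \<eta>0" "\<eta>0 \<le> el / 2"
    "\<And>\<eta> e0. 0 < \<eta> \<Longrightarrow> \<eta> \<le> \<eta>0 \<Longrightarrow> el \<le> e0 \<Longrightarrow> K \<le> abel e0 (\<lambda>x. x powr (\<nu> - 1 / 2)) \<eta>"
proof -
  \<comment> \<open>Makes \<open>el / 2 / (2 * \<nu>)\<close> equal to
    \<open>\<bar>K\<bar> + 2\<close>; together with \<open>el \<le> 1\<close> it also gives
    \<open>\<nu> \<le> 1 / 8\<close>.\<close>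
  define \<nu> where "\<nu> = el / (8 + 4 * \<bar>K\<bar>)"
  have p: "8 + 4 * \<bar>K\<bar> > 0" "8 * el \<le> 8 + 4 * \<bar>K\<bar>" using el by linarith+
  then have \<nu>: "0 < \<nu>" "\<nu> \<le> 1 / 8" using el by (simp_all add: \<nu>_def pos_divide_le_eq)
  \<comment> \<open>The second entry forces
    \<open>\<eta> powr \<nu> \<le> el powr \<nu> / 2\<close>, so that at least half of the numerator
    in \<open>abel_powr_lower\<close> survives.\<close>
  define \<eta>0 where "\<eta>0 = min (el / 2) ((el powr \<nu> / 2) powr (1 / \<nu>))"
  have \<eta>0: "0 < \<eta>0" "\<eta>0 \<le> el / 2" using el by (simp_all add: \<eta>0_def)
  have "K \<le> abel e0 (\<lambda>x. x powr (\<nu> - 1 / 2)) \<eta>" if \<eta>: "0 < \<eta>" "\<eta> \<le> \<eta>0" and e0: "el \<le> e0" for \<eta> e0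
  proof -
    have "\<eta> powr \<nu> \<le> ((el powr \<nu> / 2) powr (1 / \<nu>)) powr \<nu>"
      using \<eta> \<nu> by (intro powr_mono2) (auto simp: \<eta>0_def)
    also have "\<dots> = el powr \<nu> / 2" using \<nu> by (simp add: powr_powr)
    finally have 1: "\<eta> powr \<nu> \<le> el powr \<nu> / 2" .
    have 2: "el powr \<nu> \<le> e0 powr \<nu>" using el e0 \<nu> by (intro powr_mono2) auto
    have 3: "el \<le> el powr \<nu>" using powr_mono'[of \<nu> 1 el] el \<nu> by simp
    have "K \<le> \<bar>K\<bar> + 2" by linarith
    also have "\<dots> = el / 2 / (2 * \<nu>)" using el by (simp add: \<nu>_def field_simps)
    also have "\<dots> \<le> (e0 powr \<nu> - \<eta> powr \<nu>) / (2 * \<nu>)"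
      using 1 2 3 \<nu> by (intro divide_right_mono) auto
    also have "\<dots> \<le> abel e0 (\<lambda>x. x powr (\<nu> - 1 / 2)) \<eta>"
      using \<eta> \<eta>0 e0 \<nu> el by (intro abel_powr_lower) auto
    finally show ?thesis .
  qed
  with \<nu> \<eta>0 show ?thesis by (rule that)
qed

text \<open>Collects what has to hold with the same constants \<open>va\<close>, \<open>vb\<close>,
  \<open>C\<close>, \<open>el\<close>, \<open>\<beta>\<close>, \<open>\<sigma>\<close> for all
  parameters near \<open>(D, 2)\<close>. Quantities built from these constants alone can then be
  fixed before the parameter. The sign \<open>\<sigma>\<close> is that of \<open>loud_b\<close> near
  \<open>v = 0\<close>, and lets the two signs of \<open>1 + 2 * D\<close> be treated
  together.\<close>

locale loud_bounds = loud_center +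
  fixes va vb C el \<beta> \<sigma> :: real
  assumes va: "0 < va" "va < 1" and vb: "1 < vb" "vb < loud_vmax D F"
    and F2: "\<bar>F - 2\<bar> \<le> 1 / 20"
    and el: "0 < el" "el \<le> e va" "e va \<le> 1" "el \<le> e vb" "e vb \<le> 1"
    and C: "1 \<le> C"
    and H_va: "\<bar>loud_H0 D F va\<bar> \<le> C" "\<bar>loud_H1 D F va\<bar> \<le> C"
    and H_vb: "\<bar>loud_H0 D F vb\<bar> \<le> C"
    and H_right: "\<And>v. vb \<le> v \<Longrightarrow> v \<le> loud_vmax D F \<Longrightarrow> \<bar>loud_H1 D F v\<bar> \<le> C \<and> \<bar>loud_H2 D F v\<bar> \<le> C"
    and q_bounds: "\<And>v. 0 \<le> v \<Longrightarrow> v \<le> va \<Longrightarrow> 1 / C \<le> loud_q D F v \<and> loud_q D F v \<le> C"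
    and mid_pw: "\<And>v. va \<le> v \<Longrightarrow> v \<le> vb \<Longrightarrow> v powr (F - 1) \<le> C"
    and \<sigma>: "\<bar>\<sigma>\<bar> = 1" and \<beta>: "0 < \<beta>"
    and b_bound: "\<And>v. 0 \<le> v \<Longrightarrow> v \<le> va \<Longrightarrow> \<beta> \<le> \<sigma> * loud_b D F v"
    and k_bound: "\<And>v. 0 \<le> v \<Longrightarrow> v \<le> va \<Longrightarrow>
      \<beta> \<le> \<sigma> * (- loud_N' D v / loud_N D v ^ 3) \<and> \<sigma> * (- loud_N' D v / loud_N D v ^ 3) \<le> C"
    and N_bound: "\<And>v. 0 \<le> v \<Longrightarrow> v \<le> va \<Longrightarrow> 1 / C \<le> 1 / (loud_N D v)\<^sup>2 \<and> 1 / (loud_N D v)\<^sup>2 \<le> C"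
begin

abbreviation "P1 \<equiv> period1 va vb"
abbreviation "P2 \<equiv> period2 va vb"

lemma F_bounds: "39 / 20 \<le> F" "F \<le> 41 / 20"
  using F2 by linarith+

definition "B = 1 / sqrt (el / 2)"

lemma B: "B > 0" using el by (simp add: B_def)

lemma inverse_sqrt_le:
  assumes "0 < \<eta>" "\<eta> \<le> el / 2" "el \<le> x"
  shows "sqrt (x - \<eta>) > 0" "1 / sqrt (x - \<eta>) ^ k \<le> B ^ k"
proof -
  have "sqrt (el / 2) \<le> sqrt (x - \<eta>)" using assms by (intro real_sqrt_le_mono) linarith
  moreover have s: "sqrt (el / 2) > 0" using el by simp
  ultimately show "sqrt (x - \<eta>) > 0" by linarith
  have "1 / sqrt (x - \<eta>) \<le> B" unfolding B_def
    using \<open>sqrt (el / 2) \<le> sqrt (x - \<eta>)\<close> s by (intro divide_left_mono) auto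
  then have "(1 / sqrt (x - \<eta>)) ^ k \<le> B ^ k"
    using \<open>sqrt (x - \<eta>) > 0\<close> by (intro power_mono) auto
  then show "1 / sqrt (x - \<eta>) ^ k \<le> B ^ k" by (simp add: power_one_over)
qed

lemma divide_sqrt_bound:
  assumes "0 < \<eta>" "\<eta> \<le> el / 2" "el \<le> x" "\<bar>h\<bar> \<le> C"
  shows "\<bar>h / sqrt (x - \<eta>) ^ k\<bar> \<le> C * B ^ k"
proof -
  have "\<bar>h / sqrt (x - \<eta>) ^ k\<bar> = \<bar>h\<bar> * (1 / sqrt (x - \<eta>) ^ k)"
    using inverse_sqrt_le(1)[OF assms(1-3)] by (simp add: abs_divide)
  also have "\<dots> \<le> C * B ^ k"
    using assms(4) inverse_sqrt_le[OF assms(1-3)] C by (intro mult_mono) auto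
  finally show ?thesis .
qed

lemma mid_bound:
  assumes \<eta>: "0 < \<eta>" "\<eta> \<le> el / 2"
  shows "\<bar>mid k va vb \<eta>\<bar> \<le> C * B ^ k * (vb - va)"
proof -
  have ev: "el \<le> e v" if "v \<in> {va..vb}" for v
    using e_mid[OF va vb that] el by linarith
  have Fm: "m / 2 = F - 1" by (simp add: m_def)
  have c: "continuous_on {va..vb} e" by (rule continuous_on_subset[OF e_cont]) (use va in auto)
  have "continuous_on {va..vb} (\<lambda>v. v powr (m / 2) / sqrt (e v - \<eta>) ^ k)"
  proof (intro continuous_intros c ballI)
    fix v assume v: "v \<in> {va..vb}"
    show "v \<noteq> 0" using va v by auto
    show "sqrt (e v - \<eta>) ^ k \<noteq> 0" using inverse_sqrt_le(1)[OF \<eta> ev[OF v]] by simp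
  qed
  then have hi: "((\<lambda>v. v powr (m / 2) / sqrt (e v - \<eta>) ^ k) has_integral mid k va vb \<eta>) {va..vb}"
    unfolding mid_def by (intro integrable_integral integrable_continuous_real)
  have bd: "norm (v powr (m / 2) / sqrt (e v - \<eta>) ^ k) \<le> C * B ^ k" if "v \<in> {va..vb} - {}" for v
  proof -
    have v: "v \<in> {va..vb}" using that by simp
    have "\<bar>v powr (m / 2)\<bar> \<le> C" using mid_pw[of v] v unfolding Fm by simp
    from divide_sqrt_bound[OF \<eta> ev[OF v] this] show ?thesis by simp
  qed
  have "0 \<le> C * B ^ k" using C B by simp
  from has_integral_bound_real[OF this finite.emptyI hi bd]
  show ?thesis using va vb by simp
qed

lemma e_sub: "{0<..e va} \<subseteq> {0<..<c}" "{0<..e vb} \<subseteq> {0<..<c}"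
  using e_ab[OF va vb] by auto

text \<open>On the right \<open>v\<close> stays away from 0, so the integrand is bounded up to the
  turning point; the factor 2 uses \<open>e vb \<le> 1\<close>.\<close>

lemma right_abel_bound:
  assumes \<eta>: "0 < \<eta>" "\<eta> \<le> el / 2" and H: "continuous_on {0<..<c} (\<lambda>x. H (vr x))"
    and HC: "\<And>v. vb \<le> v \<Longrightarrow> v \<le> loud_vmax D F \<Longrightarrow> \<bar>H v\<bar> \<le> C"
  shows "\<bar>abel (e vb) (\<lambda>x. H (vr x)) \<eta>\<bar> \<le> 2 * C"
proof -
  have lt: "\<eta> < e vb" using \<eta> el by linarith
  have "\<bar>abel (e vb) (\<lambda>x. H (vr x)) \<eta>\<bar> \<le> 2 * sqrt (e vb) * C"
  proof (rule abel_bound[OF \<eta>(1) lt])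
    show "continuous_on {0<..e vb} (\<lambda>x. H (vr x))" by (rule continuous_on_subset[OF H e_sub(2)])
    fix x assume x: "\<eta> \<le> x" "x \<le> e vb"
    then have x0: "0 < x" "x < c" using \<eta> e_ab[OF va vb] by linarith+
    have "vb \<le> vr x"
      using e_gt_iff(2)[OF x0, of vb] x vb by auto
    then show "\<bar>H (vr x)\<bar> \<le> C" using HC vr[OF x0] by auto
  qed
  also have "2 * sqrt (e vb) * C \<le> 2 * 1 * C" using el C by (intro mult_right_mono mult_left_mono) auto
  finally show ?thesis by simp
qed

text \<open>The summands account for the two boundary terms, for \<open>mid 3\<close> and for the
  right Abel integral, in this order.\<close>

definition "K1 = C * (2 * B + B ^ 3 * (vb - va) + 2)"

lemma period1_rest:
  assumes \<eta>: "0 < \<eta>" "\<eta> \<le> el / 2"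
  shows "\<bar>P1 \<eta> / 2 - abel (e va) (\<lambda>x. loud_H1 D F (vl x)) \<eta>\<bar> \<le> K1"
proof -
  have "\<bar>loud_H0 D F va / sqrt (e va - \<eta>) ^ 1\<bar> \<le> C * B ^ 1" "\<bar>loud_H0 D F vb / sqrt (e vb - \<eta>) ^ 1\<bar> \<le> C * B ^ 1"
    using divide_sqrt_bound[OF \<eta>] el H_va H_vb by blast+
  moreover have "\<bar>mid 3 va vb \<eta>\<bar> \<le> C * B ^ 3 * (vb - va)" by (rule mid_bound[OF \<eta>])
  moreover have "\<bar>abel (e vb) (\<lambda>x. loud_H1 D F (vr x)) \<eta>\<bar> \<le> 2 * C"
    by (rule right_abel_bound[OF \<eta> H1_cont(2)[OF va vb]]) (use H_right in blast)
  moreover have "K1 = C * B ^ 1 + C * B ^ 1 + C * B ^ 3 * (vb - va) + 2 * C"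
    by (simp add: K1_def algebra_simps)
  moreover have "\<bar>2 * (A - x + 1 / 2 * y - z + w) / 2 - A\<bar> \<le> k"
    if "\<bar>x\<bar> \<le> a" "\<bar>w\<bar> \<le> a" "\<bar>y\<bar> \<le> b" "\<bar>z\<bar> \<le> d" "k = a + a + b + d" for A x y z w k a b d :: real
  proof -
    have "2 * (A - x + 1 / 2 * y - z + w) / 2 - A = w - x - z + y / 2" by (simp add: field_simps)
    also have "\<bar>\<dots>\<bar> \<le> \<bar>w\<bar> + \<bar>x\<bar> + \<bar>z\<bar> + \<bar>y\<bar> / 2" by linarith
    also have "\<dots> \<le> k" using that abs_ge_zero[of y] by linarith
    finally show ?thesis .
  qed
  ultimately show ?thesis unfolding period1_def[OF va vb] by blast
qed

text \<open>\<open>K1\<close> bounds the part with \<open>P1\<close>, as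
  \<open>0 < 1 - 1 / m < 1\<close>; the middle summand bounds the regular part of \<open>P2\<close>,
  multiplied by \<open>\<eta> \<le> 1\<close>; the last \<open>2 * C\<close> leaves ample room for
  the boundary term of \<open>period_S_left\<close>.\<close>

definition "K2 = K1 + C * (2 + 2 * B + B ^ 3 + B ^ 5 * (vb - va)) + 2 * C"

lemma period2_rest:
  assumes \<eta>: "0 < \<eta>" "\<eta> \<le> el / 2"
  shows "\<bar>(\<eta> * P2 \<eta> + (1 - 1 / m) * P1 \<eta>) / 2 -
    abel (e va) (\<lambda>x. vl x powr (5 - 3 * F) * loud_b D F (vl x) / 4) \<eta>\<bar> \<le> K2"
proof -
  define A1 A2 where "A1 = abel (e va) (\<lambda>x. loud_H1 D F (vl x)) \<eta>" and "A2 = abel (e va) (\<lambda>x. loud_H2 D F (vl x)) \<eta>"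
  define R1 where "R1 = P1 \<eta> / 2 - A1"
  define R2 where "R2 = P2 \<eta> / 2 - A2"
  have m: "0 < 1 - 1 / m" "1 - 1 / m < 1" using F_bounds by (simp_all add: m_def)
  have \<eta>1: "\<eta> \<le> 1" "\<eta> < e va" using \<eta> el by linarith+
  have R1: "\<bar>R1\<bar> \<le> K1" unfolding R1_def A1_def by (rule period1_rest[OF \<eta>])
  have H1vb: "\<bar>loud_H1 D F vb\<bar> \<le> C" using H_right[of vb] vb by simp
  have "\<bar>loud_H1 D F va / sqrt (e va - \<eta>) ^ 1\<bar> \<le> C * B ^ 1" "\<bar>loud_H1 D F vb / sqrt (e vb - \<eta>) ^ 1\<bar> \<le> C * B ^ 1"
    "\<bar>loud_H0 D F va / sqrt (e va - \<eta>) ^ 3\<bar> \<le> C * B ^ 3" "\<bar>loud_H0 D F vb / sqrt (e vb - \<eta>) ^ 3\<bar> \<le> C * B ^ 3"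
    using divide_sqrt_bound[OF \<eta>] el H_va H_vb H1vb by blast+
  moreover have "\<bar>mid 5 va vb \<eta>\<bar> \<le> C * B ^ 5 * (vb - va)" by (rule mid_bound[OF \<eta>])
  moreover have "\<bar>abel (e vb) (\<lambda>x. loud_H2 D F (vr x)) \<eta>\<bar> \<le> 2 * C"
    by (rule right_abel_bound[OF \<eta> H2_cont(2)[OF va vb]]) (use H_right in blast)
  moreover have "\<bar>2 * (A - x - 1 / 2 * x' + 3 / 4 * y - z + w + 1 / 2 * w') / 2 - A\<bar> \<le> a + a + a' + b + d"
    if "\<bar>x\<bar> \<le> a" "\<bar>w\<bar> \<le> a" "\<bar>x'\<bar> \<le> a'" "\<bar>w'\<bar> \<le> a'" "\<bar>y\<bar> \<le> b" "\<bar>z\<bar> \<le> d"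
    for A x y z w x' w' a a' b d :: real
  proof -
    have "2 * (A - x - 1 / 2 * x' + 3 / 4 * y - z + w + 1 / 2 * w') / 2 - A =
        (w - x) + (w' / 2 - x' / 2) + (3 / 4 * y - z)" by (simp add: field_simps)
    also have "\<bar>\<dots>\<bar> \<le> \<bar>w - x\<bar> + \<bar>w' / 2 - x' / 2\<bar> + \<bar>3 / 4 * y - z\<bar>" by linarith
    also have "\<bar>w - x\<bar> \<le> a + a" using that(1,2) by linarith
    also have "\<bar>w' / 2 - x' / 2\<bar> \<le> a'" using that(3,4) by linarith
    also have "\<bar>3 / 4 * y - z\<bar> \<le> b + d" using that(5,6) by linarith
    finally show ?thesis by simp
  qed
  ultimately have "\<bar>R2\<bar> \<le> C * B ^ 1 + C * B ^ 1 + C * B ^ 3 + C * B ^ 5 * (vb - va) + 2 * C"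
    unfolding R2_def A2_def period2_def[OF va vb] by blast
  then have R2: "\<bar>R2\<bar> \<le> C * (2 + 2 * B + B ^ 3 + B ^ 5 * (vb - va))"
    by (simp add: algebra_simps)
  have "\<bar>\<eta> * R2\<bar> \<le> 1 * \<bar>R2\<bar>" unfolding abs_mult using \<eta> \<eta>1 by (intro mult_right_mono) auto
  moreover have "\<bar>(1 - 1 / m) * R1\<bar> \<le> 1 * \<bar>R1\<bar>" unfolding abs_mult using m by (intro mult_right_mono) auto
  moreover have "\<bar>sqrt (e va - \<eta>) * loud_H1 D F va\<bar> \<le> 1 * C"
    unfolding abs_mult using \<eta> \<eta>1 el H_va C by (intro mult_mono) auto
  moreover have "(\<eta> * P2 \<eta> + (1 - 1 / m) * P1 \<eta>) / 2 =
      (\<eta> * A2 + (1 - 1 / m) * A1) + \<eta> * R2 + (1 - 1 / m) * R1"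
    unfolding R1_def R2_def by (simp add: algebra_simps add_divide_distrib diff_divide_distrib)
  moreover have "\<eta> * A2 + (1 - 1 / m) * A1 =
      abel (e va) (\<lambda>x. vl x powr (5 - 3 * F) * loud_b D F (vl x) / 4) \<eta> - sqrt (e va - \<eta>) * loud_H1 D F va"
    unfolding A1_def A2_def by (rule period_S_left[OF va vb \<eta>(1) \<eta>1(2)])
  ultimately show ?thesis using R1 R2 C unfolding K2_def by linarith
qed

lemma vl_le: "0 < x \<Longrightarrow> x \<le> e va \<Longrightarrow> 0 < vl x \<and> vl x \<le> va \<and> x = vl x powr m * loud_q D F (vl x)"
proof -
  assume x: "0 < x" "x \<le> e va"
  then have xc: "x < c" using e_ab[OF va vb] by linarith
  have l: "0 < vl x" "vl x < 1" "e (vl x) = x" using vl[OF x(1) xc] by auto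
  have "vl x \<le> va" using e_gt_iff(2)[OF x(1) xc, of va] x va vmax_gt_1 by auto
  then show ?thesis using l by (simp add: e_def)
qed

text \<open>Since \<open>x = v powr m * loud_q D F v\<close> at \<open>v = vl x\<close> and
  \<open>loud_q\<close> is at least \<open>1 / C\<close>, powers of \<open>x\<close> and of
  \<open>v\<close> are comparable; lowering the exponent to \<open>t\<close> is allowed because
  \<open>v < 1\<close>.\<close>

lemma vl_powr_lower:
  assumes x: "0 < x" "x \<le> e va" and \<nu>: "0 < \<nu>" "\<nu> \<le> 1 / 2" and t: "t \<le> m * (\<nu> - 1 / 2)"
  shows "x powr (\<nu> - 1 / 2) / C \<le> vl x powr t"
proof -
  define v where "v = vl x"
  have v: "0 < v" "v \<le> va" "x = v powr m * loud_q D F v" using vl_le[OF x] by (auto simp: v_def)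
  have q: "1 / C \<le> loud_q D F v" using q_bounds[of v] v by auto
  have C0: "C > 0" using C by linarith
  have q0: "loud_q D F v > 0" using q C0 by (smt (verit) zero_less_divide_1_iff)
  have "loud_q D F v powr (\<nu> - 1 / 2) \<le> (1 / C) powr (\<nu> - 1 / 2)"
    using q C0 \<nu> by (intro powr_mono2') auto
  also have "(1 / C) powr (\<nu> - 1 / 2) = C powr (1 / 2 - \<nu>)"
    using C0 by (simp add: powr_divide powr_minus_divide[symmetric])
  also have "\<dots> \<le> C powr 1" using C \<nu> by (intro powr_mono) auto
  finally have q1: "loud_q D F v powr (\<nu> - 1 / 2) \<le> C" using C0 by simp
  have "x powr (\<nu> - 1 / 2) = v powr (m * (\<nu> - 1 / 2)) * loud_q D F v powr (\<nu> - 1 / 2)"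
    unfolding v(3) using q0 by (simp add: powr_mult powr_powr)
  also have "\<dots> \<le> v powr t * C"
    using q1 v va t by (intro mult_mono powr_mono') auto
  finally show ?thesis unfolding v_def using C0 by (simp add: field_simps)
qed

text \<open>The Abel integral of \<open>loud_b\<close> has the sign \<open>\<sigma>\<close> and, by
  the assumption on the comparison integral, modulus at least \<open>K2 + 1\<close>, which beats
  everything collected in \<open>period2_rest\<close>.\<close>

lemma period_S_sign:
  assumes \<eta>: "0 < \<eta>" "\<eta> \<le> el / 2" and \<nu>: "0 < \<nu>" "\<nu> \<le> 1 / 8" "\<bar>F - 2\<bar> \<le> \<nu> / 2"
    and K: "4 * C * (K2 + 1) / \<beta> \<le> abel (e va) (\<lambda>x. x powr (\<nu> - 1 / 2)) \<eta>"
  shows "0 < \<sigma> * (\<eta> * P2 \<eta> + (1 - 1 / m) * P1 \<eta>)"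
proof -
  have C0: "C > 0" using C by linarith
  \<comment> \<open>Since \<open>m = 2 * (F - 1)\<close>, the claim is equivalent to
    \<open>2 - F \<le> (F - 1) * \<nu>\<close>, and \<open>F - 1 \<ge> 1 / 2\<close>. This is why
    the closeness condition reads \<open>\<nu> / 2\<close>.\<close>
  have t: "5 - 3 * F \<le> m * (\<nu> - 1 / 2)"
  proof -
    have "2 - F \<le> \<nu> / 2" using \<nu> by linarith
    also have "\<dots> = (1 / 2) * \<nu>" by simp
    also have "\<dots> \<le> (F - 1) * \<nu>" using F_bounds \<nu> by (intro mult_right_mono) auto
    finally show ?thesis by (simp add: m_def algebra_simps)
  qed
  have lt: "\<eta> < e va" using \<eta> el by linarith
  define G where "G = (\<lambda>x. vl x powr (5 - 3 * F) * loud_b D F (vl x) / 4)"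
  have "abel (e va) (\<lambda>x. \<beta> / (4 * C) * (x powr (\<nu> - 1 / 2))) \<eta> \<le> abel (e va) (\<lambda>x. \<sigma> * G x) \<eta>"
  proof (rule abel_mono[OF \<eta>(1) lt])
    show "continuous_on {0<..e va} (\<lambda>x. \<beta> / (4 * C) * (x powr (\<nu> - 1 / 2)))"
      by (intro continuous_intros) auto
    show "continuous_on {0<..e va} (\<lambda>x. \<sigma> * G x)" unfolding G_def
      by (intro continuous_intros b_cont[OF va vb])
    fix x assume "\<eta> \<le> x" "x \<le> e va"
    then have x: "0 < x" "x \<le> e va" using \<eta> by auto
    have v: "0 < vl x" "vl x \<le> va" using vl_le[OF x] by auto
    have "x powr (\<nu> - 1 / 2) / C * \<beta> \<le> vl x powr (5 - 3 * F) * (\<sigma> * loud_b D F (vl x))"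
      using vl_powr_lower[OF x \<nu>(1) _ t] \<nu> b_bound[of "vl x"] v \<beta> C0
      by (intro mult_mono) auto
    then show "\<beta> / (4 * C) * (x powr (\<nu> - 1 / 2)) \<le> \<sigma> * G x"
      unfolding G_def using C0 by (simp add: field_simps)
  qed
  then have "\<beta> / (4 * C) * abel (e va) (\<lambda>x. x powr (\<nu> - 1 / 2)) \<eta> \<le> \<sigma> * abel (e va) G \<eta>"
    by (simp only: abel_cmult)
  moreover have "\<beta> / (4 * C) * (4 * C * (K2 + 1) / \<beta>) \<le> \<beta> / (4 * C) * abel (e va) (\<lambda>x. x powr (\<nu> - 1 / 2)) \<eta>"
    using K \<beta> C0 by (intro mult_left_mono) auto
  moreover have "\<beta> / (4 * C) * (4 * C * (K2 + 1) / \<beta>) = K2 + 1" using \<beta> C0 by simp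
  ultimately have A: "K2 + 1 \<le> \<sigma> * abel (e va) G \<eta>" by linarith
  define S where "S = (\<eta> * P2 \<eta> + (1 - 1 / m) * P1 \<eta>) / 2"
  have "\<bar>\<sigma> * (S - abel (e va) G \<eta>)\<bar> \<le> K2"
    using period2_rest[OF \<eta>] \<sigma> unfolding S_def G_def abs_mult by simp
  then have "0 < \<sigma> * S" using A unfolding right_diff_distrib by linarith
  then show ?thesis by (simp add: S_def)
qed

text \<open>The derivative of \<open>\<eta> powr (1 - 1 / m) * P1 \<eta>\<close> is a positive
  factor times the combination in \<open>period_S_sign\<close>. After multiplication by
  \<open>\<sigma>\<close> the product is strictly increasing and cannot vanish twice.\<close>

lemma period1_zero_unique:
  assumes \<eta>0: "\<eta>0 \<le> el / 2" and \<nu>: "0 < \<nu>" "\<nu> \<le> 1 / 8" "\<bar>F - 2\<bar> \<le> \<nu> / 2"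
    and K: "\<And>\<eta>. 0 < \<eta> \<Longrightarrow> \<eta> \<le> \<eta>0 \<Longrightarrow> 4 * C * (K2 + 1) / \<beta> \<le> abel (e va) (\<lambda>x. x powr (\<nu> - 1 / 2)) \<eta>"
    and z: "0 < \<eta>1" "\<eta>1 < \<eta>2" "\<eta>2 \<le> \<eta>0" "P1 \<eta>1 = 0" "P1 \<eta>2 = 0"
  shows False
proof -
  define M where "M \<eta> = \<sigma> * (\<eta> powr (1 - 1 / m) * P1 \<eta>)" for \<eta>
  have "M \<eta>1 < M \<eta>2"
  proof (rule DERIV_pos_imp_increasing[OF z(2)])
    fix \<eta> assume "\<eta>1 \<le> \<eta>" "\<eta> \<le> \<eta>2"
    then have \<eta>: "0 < \<eta>" "\<eta> \<le> \<eta>0" "\<eta> \<le> el / 2" "\<eta> < e va" "\<eta> < e vb" using z \<eta>0 el by linarith+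
    have "(M has_real_derivative \<sigma> * ((1 - 1 / m) * \<eta> powr (1 - 1 / m - 1) * P1 \<eta> + P2 \<eta> * \<eta> powr (1 - 1 / m))) (at \<eta>)"
      unfolding M_def[abs_def]
      by (intro DERIV_cmult DERIV_mult has_real_derivative_powr \<eta> period_deriv(2)[OF va vb])
    moreover have "\<eta> powr (1 - 1 / m) = \<eta> powr (1 - 1 / m - 1) * \<eta>"
      using \<eta> powr_add[of \<eta> "1 - 1 / m - 1" 1] by simp
    then have "\<sigma> * ((1 - 1 / m) * \<eta> powr (1 - 1 / m - 1) * P1 \<eta> + P2 \<eta> * \<eta> powr (1 - 1 / m)) =
        \<eta> powr (1 - 1 / m - 1) * (\<sigma> * (\<eta> * P2 \<eta> + (1 - 1 / m) * P1 \<eta>))"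
      by (simp only:) (simp add: algebra_simps)
    moreover have "\<dots> > 0"
      using \<eta> period_S_sign[OF \<eta>(1,3) \<nu> K[OF \<eta>(1,2)]] by simp
    ultimately show "\<exists>y. (M has_real_derivative y) (at \<eta>) \<and> 0 < y" by metis
  qed
  then show False by (simp add: M_def z)
qed

text \<open>Separates the more singular term, whose sign flips at \<open>F = 2\<close>, from the
  term whose sign is fixed by \<open>k_bound\<close>.\<close>

lemma H1_split:
  assumes "v > 0" "v \<le> va"
  shows "\<sigma> * loud_H1 D F v = (\<sigma> * (2 - F)) * (1 / (loud_N D v)\<^sup>2) * v powr (4 - 3 * F) / 4 +
    \<sigma> * (- loud_N' D v / loud_N D v ^ 3) * v powr (5 - 3 * F) / 4"
proof -
  have "v powr (5 - 3 * F) = v powr ((4 - 3 * F) + 1)" by simp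
  also have "\<dots> = v powr (4 - 3 * F) * v" using assms by (simp only: powr_add powr_one)
  finally show ?thesis by (simp add: loud_H1_def loud_r_def algebra_simps diff_divide_distrib)
qed

text \<open>At a fixed \<open>\<eta>\<close> the sign-changing term is harmless once
  \<open>F\<close> is close to 2: on \<open>x \<ge> \<eta>\<close> one has
  \<open>v powr (4 - 3 * F) \<le> (C / \<eta>)\<^sup>2\<close>, so it contributes at least -1 to the
  integrand and at least -2 to the Abel integral. The remaining term then decides the sign, with
  \<open>K1 + 3\<close> as the required margin.\<close>

lemma period1_positive:
  assumes \<eta>: "0 < \<eta>" "\<eta> \<le> el / 2" and \<nu>: "0 < \<nu>" "\<nu> \<le> 1 / 8" "\<bar>F - 2\<bar> \<le> \<nu> / 2"
    and K: "4 * C * (K1 + 3) / \<beta> \<le> abel (e va) (\<lambda>x. x powr (\<nu> - 1 / 2)) \<eta>"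
    and F\<eta>: "\<bar>F - 2\<bar> * C * (C / \<eta>)\<^sup>2 \<le> 4"
  shows "0 < \<sigma> * P1 \<eta>"
proof -
  have C0: "C > 0" using C by linarith
  have t: "5 - 3 * F \<le> m * (\<nu> - 1 / 2)"
  proof -
    have "2 - F \<le> \<nu> / 2" using \<nu> by linarith
    also have "\<dots> = (1 / 2) * \<nu>" by simp
    also have "\<dots> \<le> (F - 1) * \<nu>" using F_bounds \<nu> by (intro mult_right_mono) auto
    finally show ?thesis by (simp add: m_def algebra_simps)
  qed
  have lt: "\<eta> < e va" using \<eta> el by linarith
  define G where "G = (\<lambda>x. loud_H1 D F (vl x))"
  have cp: "continuous_on {0<..e va} (\<lambda>x. x powr (\<nu> - 1 / 2))" by (intro continuous_intros) auto
  have "abel (e va) (\<lambda>x. \<beta> / (4 * C) * (x powr (\<nu> - 1 / 2)) + (-1)) \<eta> \<le> abel (e va) (\<lambda>x. \<sigma> * G x) \<eta>"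
  proof (rule abel_mono[OF \<eta>(1) lt])
    show "continuous_on {0<..e va} (\<lambda>x. \<beta> / (4 * C) * (x powr (\<nu> - 1 / 2)) + (-1))"
      by (intro continuous_intros cp)
    show "continuous_on {0<..e va} (\<lambda>x. \<sigma> * G x)" unfolding G_def
      by (intro continuous_intros continuous_on_subset[OF H1_cont(1)[OF va vb] e_sub(1)])
    fix x assume x\<eta>: "\<eta> \<le> x" "x \<le> e va"
    then have x: "0 < x" "x \<le> e va" using \<eta> by auto
    define v where "v = vl x"
    have v: "0 < v" "v \<le> va" "x = v powr m * loud_q D F v" using vl_le[OF x] by (auto simp: v_def)
    have lw: "x powr (\<nu> - 1 / 2) / C \<le> v powr (5 - 3 * F)"
      using vl_powr_lower[OF x \<nu>(1) _ t] \<nu> by (simp add: v_def)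
    have kb: "\<beta> \<le> \<sigma> * (- loud_N' D v / loud_N D v ^ 3)" using k_bound[of v] v by simp
    have "x powr (\<nu> - 1 / 2) / C * \<beta> \<le> v powr (5 - 3 * F) * (\<sigma> * (- loud_N' D v / loud_N D v ^ 3))"
      by (rule mult_mono[OF lw kb]) (use \<beta> in simp_all)
    then have 1: "\<beta> / (4 * C) * (x powr (\<nu> - 1 / 2)) \<le>
       \<sigma> * (- loud_N' D v / loud_N D v ^ 3) * v powr (5 - 3 * F) / 4"
      using C0 by (simp add: field_simps)
    have vm: "v powr m \<ge> \<eta> / C"
    proof -
      have "\<eta> \<le> v powr m * loud_q D F v" using x\<eta> v by simp
      also have "\<dots> \<le> v powr m * C" using q_bounds[of v] v by (intro mult_left_mono) auto
      finally show ?thesis using C0 by (simp add: field_simps)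
    qed
    have \<eta>C: "0 < \<eta> / C" "\<eta> / C \<le> 1" using \<eta> C el by (auto simp: divide_le_eq)
    have m0: "m > 0" by (rule m)
    \<comment> \<open>The quotient is \<open>1 / m - 3 / 2\<close>. Rounding it down to -2 gives a
      bound that does not involve \<open>F\<close>.\<close>
    have ex: "- 2 \<le> (4 - 3 * F) / m" "(4 - 3 * F) / m \<le> 0"
      using F_bounds m0 by (simp_all add: pos_le_divide_eq pos_divide_le_eq) (simp_all add: m_def)
    have "v powr (4 - 3 * F) = (v powr m) powr ((4 - 3 * F) / m)" using m0 by (simp add: powr_powr)
    also have "\<dots> \<le> (\<eta> / C) powr ((4 - 3 * F) / m)" using vm \<eta>C ex by (intro powr_mono2') auto
    also have "\<dots> \<le> (\<eta> / C) powr (- 2)" using \<eta>C ex by (intro powr_mono') auto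
    also have "\<dots> = (C / \<eta>)\<^sup>2" using \<eta> C0 by (simp add: powr_minus_divide power_divide)
    finally have v4: "v powr (4 - 3 * F) \<le> (C / \<eta>)\<^sup>2" .
    have "\<bar>(\<sigma> * (2 - F)) * (1 / (loud_N D v)\<^sup>2) * v powr (4 - 3 * F)\<bar> \<le> \<bar>F - 2\<bar> * C * (C / \<eta>)\<^sup>2"
    proof -
      have s: "\<bar>\<sigma> * (2 - F)\<bar> \<le> \<bar>F - 2\<bar>" using \<sigma> by (simp add: abs_mult abs_minus_commute)
      have n: "\<bar>1 / (loud_N D v)\<^sup>2\<bar> \<le> C" using N_bound[of v] v by simp
      have p: "\<bar>v powr (4 - 3 * F)\<bar> \<le> (C / \<eta>)\<^sup>2" using v4 by simp
      have "\<bar>(\<sigma> * (2 - F)) * (1 / (loud_N D v)\<^sup>2) * v powr (4 - 3 * F)\<bar> =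
          \<bar>\<sigma> * (2 - F)\<bar> * \<bar>1 / (loud_N D v)\<^sup>2\<bar> * \<bar>v powr (4 - 3 * F)\<bar>"
        by (simp only: abs_mult)
      also have "\<dots> \<le> \<bar>F - 2\<bar> * C * (C / \<eta>)\<^sup>2"
        by (rule mult_mono[OF mult_mono[OF s n] p]) (use C0 in simp_all)
      finally show ?thesis .
    qed
    from order_trans[OF this F\<eta>]
    have "- ((\<sigma> * (2 - F)) * (1 / (loud_N D v)\<^sup>2) * v powr (4 - 3 * F)) \<le> 4"
      by (simp only: abs_le_iff)
    then have "(\<sigma> * (2 - F)) * (1 / (loud_N D v)\<^sup>2) * v powr (4 - 3 * F) / 4 \<ge> -1" by simp
    then show "\<beta> / (4 * C) * (x powr (\<nu> - 1 / 2)) + (-1) \<le> \<sigma> * G x"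
      unfolding G_def using H1_split[OF v(1,2)] 1 by (simp only: v_def)
  qed
  moreover have "abel (e va) (\<lambda>x. \<beta> / (4 * C) * (x powr (\<nu> - 1 / 2)) + (-1)) \<eta> =
     \<beta> / (4 * C) * abel (e va) (\<lambda>x. x powr (\<nu> - 1 / 2)) \<eta> + 2 * sqrt (e va - \<eta>) * (-1)"
    using abel_add[OF \<eta>(1) lt continuous_on_mult_left[OF cp] continuous_on_const]
    by (simp only: abel_cmult abel_const)
  moreover have "sqrt (e va - \<eta>) \<le> 1" using el \<eta> by simp
  moreover have "\<beta> / (4 * C) * (4 * C * (K1 + 3) / \<beta>) \<le> \<beta> / (4 * C) * abel (e va) (\<lambda>x. x powr (\<nu> - 1 / 2)) \<eta>"
    using K \<beta> C0 by (intro mult_left_mono) auto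
  moreover have "\<beta> / (4 * C) * (4 * C * (K1 + 3) / \<beta>) = K1 + 3" using \<beta> C0 by simp
  moreover have "abel (e va) (\<lambda>x. \<sigma> * G x) \<eta> = \<sigma> * abel (e va) G \<eta>" by (rule abel_cmult)
  ultimately have A: "K1 + 1 \<le> \<sigma> * abel (e va) G \<eta>" by linarith
  have "\<bar>\<sigma> * (P1 \<eta> / 2 - abel (e va) G \<eta>)\<bar> \<le> K1"
    using period1_rest[OF \<eta>] \<sigma> unfolding G_def abs_mult by simp
  then have "0 < \<sigma> * (P1 \<eta> / 2)" using A unfolding right_diff_distrib by linarith
  then show ?thesis by simp
qed

text \<open>For a fixed \<open>F\<close> on this side of 2 the term with
  \<open>v powr (4 - 3 * F)\<close> is more singular than the one with
  \<open>v powr (5 - 3 * F)\<close> and wins as \<open>\<eta>\<close> tends to 0. No uniformity in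
  \<open>F\<close> is claimed.\<close>

lemma period1_negative:
  assumes sg: "\<sigma> * (2 - F) < 0" and \<eta>s: "0 < \<eta>s"
  obtains \<eta> where "0 < \<eta>" "\<eta> < \<eta>s" "\<eta> \<le> el / 2" "\<sigma> * P1 \<eta> < 0"
proof -
  have C0: "C > 0" using C by linarith
  define d where "d = - (\<sigma> * (2 - F))"
  have d: "d > 0" using sg by (simp add: d_def)
  \<comment> \<open>Up to \<open>v1\<close> the term with the extra factor \<open>v\<close> is at
    most half of the lower bound \<open>d / C\<close> for the leading one.\<close>
  define v1 where "v1 = d / (2 * C\<^sup>2)"
  have v1: "v1 > 0" using d C0 by (simp add: v1_def)
  \<comment> \<open>The surviving half of \<open>d / C\<close>, divided by the 4 in
    \<open>loud_H1\<close>. Beyond \<open>v1\<close> all powers are bounded, and \<open>M\<close>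
    absorbs the rest.\<close>
  define c0 where "c0 = d / (8 * C)"
  have c0: "c0 > 0" using d C0 by (simp add: c0_def)
  define M where "M = C * v1 powr (5 - 3 * F) / 4 + c0 * v1 powr (4 - 3 * F)"
  have F3: "5 - 3 * F < 0" "4 - 3 * F < 0" using F_bounds by simp_all
  have main: "\<sigma> * loud_H1 D F v \<le> - c0 * v powr (4 - 3 * F) + M" if v: "0 < v" "v \<le> va" for v
  proof -
    define k where "k = \<sigma> * (- loud_N' D v / loud_N D v ^ 3)"
    define n where "n = 1 / (loud_N D v)\<^sup>2"
    have k: "k \<le> C" using k_bound[of v] v by (simp add: k_def)
    have n: "1 / C \<le> n" using N_bound[of v] v by (simp add: n_def)
    define p where "p = v powr (4 - 3 * F)"
    have p: "p > 0" using v by (simp add: p_def)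
    have "v powr (5 - 3 * F) = v powr ((4 - 3 * F) + 1)" by simp
    also have "\<dots> = p * v" using v unfolding p_def by (simp only: powr_add powr_one)
    finally have p5: "v powr (5 - 3 * F) = p * v" .
    have sd: "\<sigma> * (2 - F) = - d" by (simp add: d_def)
    have H: "\<sigma> * loud_H1 D F v = - (d * n * p) / 4 + k * (p * v) / 4"
      using H1_split[OF v] unfolding p5 k_def[symmetric] n_def[symmetric] p_def[symmetric] sd by simp
    show ?thesis
    proof (cases "v \<le> v1")
      case True
      have "d * (1 / C) * p \<le> d * n * p" using n d p by (intro mult_right_mono mult_left_mono) auto
      moreover have "k * (p * v) \<le> C * (p * v)" using k p v by (intro mult_right_mono) auto
      moreover have "C * (p * v) \<le> C * (p * v1)" using True p C0 by (intro mult_left_mono) auto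
      moreover have "C * (p * v1) = d * (1 / C) * p / 2" using C0 by (simp add: v1_def power2_eq_square field_simps)
      moreover have "c0 * p = d * (1 / C) * p / 8" by (simp add: c0_def)
      moreover have "M \<ge> 0" using C0 c0 by (simp add: M_def)
      moreover have "- a / 4 + y / 4 \<le> - r + M"
        if "E \<le> a" "y \<le> z" "z \<le> w" "w = E / 2" "r = E / 8" "0 \<le> M" for a y z w r E :: real
        using that by linarith
      ultimately show ?thesis unfolding H p_def[symmetric] mult_minus_left by blast
    next
      case False
      have "d * n * p \<ge> 0" using d p n C0 by (intro mult_nonneg_nonneg) (auto intro: order_trans[of _ "1 / C"])
      moreover have "k * (p * v) \<le> C * (p * v)" using k p v by (intro mult_right_mono) auto
      moreover have "p * v \<le> v1 powr (5 - 3 * F)" unfolding p5[symmetric]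
        using False v1 F3 by (intro powr_mono2') auto
      then have "C * (p * v) \<le> C * v1 powr (5 - 3 * F)" using C0 by (intro mult_left_mono) auto
      moreover have "p \<le> v1 powr (4 - 3 * F)" unfolding p_def using False v1 F3 by (intro powr_mono2') auto
      then have "c0 * p \<le> c0 * v1 powr (4 - 3 * F)" using c0 by (intro mult_left_mono) auto
      ultimately show ?thesis unfolding H p_def[symmetric] M_def mult_minus_left by linarith
    qed
  qed
  have M0: "M \<ge> 0" using C0 c0 by (simp add: M_def)
  obtain \<nu> \<eta>0 where \<nu>: "0 < \<nu>" "\<nu> \<le> 1 / 8" and \<eta>0: "0 < \<eta>0" "\<eta>0 \<le> el / 2"
    and K: "\<And>\<eta> e0. 0 < \<eta> \<Longrightarrow> \<eta> \<le> \<eta>0 \<Longrightarrow> el \<le> e0 \<Longrightarrow> C / c0 * (2 * M + K1 + 1) \<le> abel e0 (\<lambda>x. x powr (\<nu> - 1 / 2)) \<eta>"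
    using abel_powr_unbounded[OF el(1) order_trans[OF el(2,3)], of "C / c0 * (2 * M + K1 + 1)"] by blast
  define \<eta> where "\<eta> = min \<eta>0 (\<eta>s / 2)"
  have \<eta>: "0 < \<eta>" "\<eta> < \<eta>s" "\<eta> \<le> \<eta>0" "\<eta> \<le> el / 2" using \<eta>0 \<eta>s by (auto simp: \<eta>_def)
  have lt: "\<eta> < e va" using \<eta> el by linarith
  \<comment> \<open>There is room to spare: already for \<open>\<nu> = 0\<close> the right side is
    \<open>1 - F\<close>, so here \<open>\<nu>\<close> need not be related to
    \<open>F - 2\<close>.\<close>
  have t: "4 - 3 * F \<le> m * (\<nu> - 1 / 2)"
  proof -
    have "m * (0 - 1 / 2) = 1 - F" by (simp add: m_def field_simps)
    then have "4 - 3 * F \<le> m * (0 - 1 / 2)" using F_bounds by linarith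
    also have "\<dots> \<le> m * (\<nu> - 1 / 2)" using \<nu> m by (intro mult_left_mono) auto
    finally show ?thesis .
  qed
  define G where "G = (\<lambda>x. loud_H1 D F (vl x))"
  have cp: "continuous_on {0<..e va} (\<lambda>x. x powr (\<nu> - 1 / 2))" by (intro continuous_intros) auto
  have "abel (e va) (\<lambda>x. \<sigma> * G x) \<eta> \<le> abel (e va) (\<lambda>x. - c0 / C * (x powr (\<nu> - 1 / 2)) + M) \<eta>"
  proof (rule abel_mono[OF \<eta>(1) lt])
    show "continuous_on {0<..e va} (\<lambda>x. - c0 / C * (x powr (\<nu> - 1 / 2)) + M)"
      by (intro continuous_intros cp)
    show "continuous_on {0<..e va} (\<lambda>x. \<sigma> * G x)" unfolding G_def
      by (intro continuous_intros continuous_on_subset[OF H1_cont(1)[OF va vb] e_sub(1)])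
    fix x assume "\<eta> \<le> x" "x \<le> e va"
    then have x: "0 < x" "x \<le> e va" using \<eta> by auto
    have v: "0 < vl x" "vl x \<le> va" using vl_le[OF x] by auto
    have "c0 * (x powr (\<nu> - 1 / 2) / C) \<le> c0 * vl x powr (4 - 3 * F)"
      using vl_powr_lower[OF x \<nu>(1) _ t] \<nu> c0 by (intro mult_left_mono) auto
    then show "\<sigma> * G x \<le> - c0 / C * (x powr (\<nu> - 1 / 2)) + M"
      unfolding G_def using main[OF v] by simp
  qed
  moreover have "abel (e va) (\<lambda>x. - c0 / C * (x powr (\<nu> - 1 / 2)) + M) \<eta> =
     - c0 / C * abel (e va) (\<lambda>x. x powr (\<nu> - 1 / 2)) \<eta> + 2 * sqrt (e va - \<eta>) * M"
    using abel_add[OF \<eta>(1) lt continuous_on_mult_left[OF cp] continuous_on_const]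
    by (simp only: abel_cmult abel_const)
  moreover have "2 * sqrt (e va - \<eta>) * M \<le> 2 * 1 * M" using el \<eta> M0 by (intro mult_right_mono mult_left_mono) auto
  moreover have "c0 / C * (C / c0 * (2 * M + K1 + 1)) \<le> c0 / C * abel (e va) (\<lambda>x. x powr (\<nu> - 1 / 2)) \<eta>"
    using K[OF \<eta>(1,3) el(2)] c0 C0 by (intro mult_left_mono) auto
  moreover have "c0 / C * (C / c0 * (2 * M + K1 + 1)) = 2 * M + K1 + 1" using c0 C0 by simp
  moreover have "abel (e va) (\<lambda>x. \<sigma> * G x) \<eta> = \<sigma> * abel (e va) G \<eta>" by (rule abel_cmult)
  ultimately have A: "\<sigma> * abel (e va) G \<eta> \<le> - K1 - 1" by simp
  have "\<bar>\<sigma> * (P1 \<eta> / 2 - abel (e va) G \<eta>)\<bar> \<le> K1"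
    using period1_rest[OF \<eta>(1,4)] \<sigma> unfolding G_def abs_mult by simp
  then have "\<sigma> * (P1 \<eta> / 2) < 0" using A unfolding right_diff_distrib by linarith
  then show ?thesis using that[OF \<eta>(1,2,4)] by simp
qed

end

section \<open>Uniformity in the parameters\<close>

text \<open>The tube lemma along the compact factor \<open>K\<close>; it turns pointwise facts at
  \<open>\<mu>0\<close> into bounds on a whole neighbourhood.\<close>

lemma eventually_close:
  fixes f :: "'a::topological_space \<times> real \<Rightarrow> real"
  assumes "continuous_on (U \<times> K) f" "open U" "\<mu>0 \<in> U" "compact K" "\<epsilon> > 0"
  shows "\<forall>\<^sub>F \<mu> in nhds \<mu>0. \<forall>v\<in>K. \<bar>f (\<mu>, v) - f (\<mu>0, v)\<bar> \<le> \<epsilon>"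
proof -
  obtain X0 where X0: "\<mu>0 \<in> X0" "open X0" "\<forall>x\<in>X0 \<inter> U. \<forall>t\<in>K. dist (f (x, t)) (f (\<mu>0, t)) \<le> \<epsilon>"
    by (rule continuous_on_prod_compactE[OF assms(1,4,3,5)])
  then have "\<forall>\<^sub>F \<mu> in nhds \<mu>0. \<mu> \<in> X0 \<inter> U"
    using assms by (intro eventually_nhds_in_open) auto
  then show ?thesis by eventually_elim (use X0 in \<open>auto simp: dist_real_def\<close>)
qed

lemma continuous_on_slice:
  fixes f :: "'a::topological_space \<times> real \<Rightarrow> real"
  assumes "continuous_on (U \<times> K) f" "\<mu>0 \<in> U"
  shows "continuous_on K (\<lambda>v. f (\<mu>0, v))"
  by (rule continuous_on_compose2[OF assms(1)]) (use assms in \<open>auto intro!: continuous_intros\<close>)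

lemma eventually_bounded:
  fixes f :: "'a::topological_space \<times> real \<Rightarrow> real"
  assumes "continuous_on (U \<times> K) f" "open U" "\<mu>0 \<in> U" "compact K"
  obtains C where "\<forall>\<^sub>F \<mu> in nhds \<mu>0. \<forall>v\<in>K. \<bar>f (\<mu>, v)\<bar> \<le> C"
proof -
  have "bounded ((\<lambda>v. f (\<mu>0, v)) ` K)"
    using continuous_on_slice[OF assms(1,3)] assms(4)
    by (intro compact_imp_bounded compact_continuous_image)
  then obtain C where C: "\<forall>v\<in>K. \<bar>f (\<mu>0, v)\<bar> \<le> C" by (auto simp: bounded_iff)
  have "\<forall>\<^sub>F \<mu> in nhds \<mu>0. \<forall>v\<in>K. \<bar>f (\<mu>, v) - f (\<mu>0, v)\<bar> \<le> 1"
    by (rule eventually_close[OF assms]) simp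
  then have "\<forall>\<^sub>F \<mu> in nhds \<mu>0. \<forall>v\<in>K. \<bar>f (\<mu>, v)\<bar> \<le> C + 1"
  proof eventually_elim
    case (elim \<mu>)
    show ?case
    proof
      fix v assume "v \<in> K"
      with elim C have "\<bar>f (\<mu>, v) - f (\<mu>0, v)\<bar> \<le> 1" "\<bar>f (\<mu>0, v)\<bar> \<le> C" by auto
      then show "\<bar>f (\<mu>, v)\<bar> \<le> C + 1" by linarith
    qed
  qed
  then show ?thesis by (rule that)
qed

lemma eventually_lower_bound:
  fixes f :: "'a::topological_space \<times> real \<Rightarrow> real"
  assumes "continuous_on (U \<times> K) f" "open U" "\<mu>0 \<in> U" "compact K"
    and pos: "\<And>v. v \<in> K \<Longrightarrow> f (\<mu>0, v) > 0"
  obtains \<beta> where "\<beta> > 0" "\<forall>\<^sub>F \<mu> in nhds \<mu>0. \<forall>v\<in>K. \<beta> \<le> f (\<mu>, v)"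
proof (cases "K = {}")
  case False
  obtain w where w: "w \<in> K" "\<And>v. v \<in> K \<Longrightarrow> f (\<mu>0, w) \<le> f (\<mu>0, v)"
    using continuous_attains_inf[OF assms(4) False continuous_on_slice[OF assms(1,3)]] by blast
  define \<beta> where "\<beta> = f (\<mu>0, w) / 2"
  have \<beta>: "\<beta> > 0" using pos[OF w(1)] by (simp add: \<beta>_def)
  have "\<forall>\<^sub>F \<mu> in nhds \<mu>0. \<forall>v\<in>K. \<bar>f (\<mu>, v) - f (\<mu>0, v)\<bar> \<le> \<beta>"
    by (rule eventually_close[OF assms(1-4) \<beta>])
  then have "\<forall>\<^sub>F \<mu> in nhds \<mu>0. \<forall>v\<in>K. \<beta> \<le> f (\<mu>, v)"
  proof eventually_elim
    case (elim \<mu>)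
    show ?case
    proof
      fix v assume v: "v \<in> K"
      with elim have "\<bar>f (\<mu>, v) - f (\<mu>0, v)\<bar> \<le> \<beta>" by auto
      then show "\<beta> \<le> f (\<mu>, v)" using w(2)[OF v] unfolding \<beta>_def by linarith
    qed
  qed
  with \<beta> show ?thesis by (rule that)
qed (use that[of 1] in auto)

lemma loud_params_iff: "(D, F) \<in> loud_params \<longleftrightarrow> loud_center D F"
  by (auto simp: loud_params_def loud_center_def)

lemma open_loud_params: "open loud_params"
proof -
  have "loud_params = {z. snd z > 1 \<and> fst z < 0 \<and> fst z + snd z > 0}"
    by (auto simp: loud_params_def)
  moreover have "open {z :: real \<times> real. snd z > 1 \<and> fst z < 0 \<and> fst z + snd z > 0}"
    by (intro open_Collect_conj open_Collect_less continuous_intros)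
  ultimately show ?thesis by simp
qed

lemma loud_params_F: "\<mu> \<in> loud_params \<Longrightarrow> snd \<mu> > 1 \<and> fst \<mu> < 0"
  by (auto simp: loud_params_def)

lemma cont_N: "continuous_on S (\<lambda>z. loud_N (fst (fst z)) (snd z))"
  unfolding loud_N_def by (intro continuous_intros)

lemma cont_N': "continuous_on S (\<lambda>z. loud_N' (fst (fst z)) (snd z))"
  unfolding loud_N'_def by (intro continuous_intros)

lemma cont_q:
  assumes "\<And>z. z \<in> S \<Longrightarrow> fst z \<in> loud_params"
  shows "continuous_on S (\<lambda>z. loud_q (fst (fst z)) (snd (fst z)) (snd z))"
  unfolding loud_q_def using assms[THEN loud_params_F]
  by (intro continuous_intros ballI) fastforce+

lemma cont_q':
  assumes "\<And>z. z \<in> S \<Longrightarrow> fst z \<in> loud_params"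
  shows "continuous_on S (\<lambda>z. loud_q' (fst (fst z)) (snd (fst z)) (snd z))"
  unfolding loud_q'_def using assms[THEN loud_params_F]
  by (intro continuous_intros ballI) fastforce+

lemma cont_r:
  assumes "\<And>z. z \<in> S \<Longrightarrow> loud_N (fst (fst z)) (snd z) \<noteq> 0"
  shows "continuous_on S (\<lambda>z. loud_r (fst (fst z)) (snd (fst z)) (snd z))"
    "continuous_on S (\<lambda>z. loud_r' (fst (fst z)) (snd (fst z)) (snd z))"
  unfolding loud_r_def loud_r'_def
  by (intro continuous_intros cont_N cont_N' ballI; use assms in force)+

lemma cont_H:
  assumes "\<And>z. z \<in> S \<Longrightarrow> loud_N (fst (fst z)) (snd z) \<noteq> 0 \<and> snd z > 0"
  shows "continuous_on S (\<lambda>z. loud_H0 (fst (fst z)) (snd (fst z)) (snd z))"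
    "continuous_on S (\<lambda>z. loud_H1 (fst (fst z)) (snd (fst z)) (snd z))"
    "continuous_on S (\<lambda>z. loud_H2 (fst (fst z)) (snd (fst z)) (snd z))"
  unfolding loud_H0_def loud_H1_def loud_H2_def
  by (intro continuous_intros cont_N cont_N' cont_r ballI; use assms in force)+

lemma cont_b:
  assumes "\<And>z. z \<in> S \<Longrightarrow> fst z \<in> loud_params \<and> loud_N (fst (fst z)) (snd z) \<noteq> 0"
  shows "continuous_on S (\<lambda>z. loud_b (fst (fst z)) (snd (fst z)) (snd z))"
  unfolding loud_b_def
  by (intro continuous_intros cont_N cont_q cont_q' cont_r ballI; use assms[THEN conjunct1, THEN loud_params_F] assms in force)

definition loud_e :: "real \<Rightarrow> real \<Rightarrow> real \<Rightarrow> real" where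
  "loud_e D F v = v powr (2 * F - 2) * loud_q D F v"

lemma (in loud_center) e_loud_e: "e = loud_e D F"
  by (auto simp: e_def loud_e_def m_def)

lemma cont_e:
  assumes "\<And>z. z \<in> S \<Longrightarrow> fst z \<in> loud_params \<and> snd z \<ge> 0"
  shows "continuous_on S (\<lambda>z. loud_e (fst (fst z)) (snd (fst z)) (snd z))"
  unfolding loud_e_def
proof (intro continuous_on_mult continuous_on_powr' cont_q continuous_intros ballI)
  fix z assume z: "z \<in> S"
  show "0 \<le> snd z \<and> (snd z = 0 \<longrightarrow> 0 < 2 * snd (fst z) - 2)"
    using assms[OF z] loud_params_F[of "fst z"] by auto
qed (use assms in auto)

lemma cont_vmax: "continuous_on loud_params (\<lambda>\<mu>. loud_vmax (fst \<mu>) (snd \<mu>))"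
  unfolding loud_vmax_def
proof (intro continuous_intros ballI)
  fix \<mu> assume \<mu>: "\<mu> \<in> loud_params"
  then interpret loud_center "fst \<mu>" "snd \<mu>" by (simp add: loud_params_iff[symmetric])
  show "- ((2 + 4 * fst \<mu>) / (2 * snd \<mu> - 1)) + sqrt (((2 + 4 * fst \<mu>) / (2 * snd \<mu> - 1))\<^sup>2 +
     4 * (- fst \<mu> / (snd \<mu> - 1)) * ((1 + fst \<mu>) / snd \<mu>)) \<noteq> 0"
    using vmax_gt_1 unfolding loud_vmax_def by (metis div_by_0 not_one_less_zero)
qed (use loud_params_F in fastforce)+

lemma continuous_pos_right:
  fixes f :: "real \<Rightarrow> real"
  assumes "isCont f a" "f a > 0"
  obtains d where "d > 0" "\<And>x. \<bar>x - a\<bar> \<le> d \<Longrightarrow> f x > 0"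
proof -
  have "\<forall>\<^sub>F x in nhds a. f x > 0"
    using assms order_tendstoD(1)[of f "f a" "nhds a" 0] by (simp add: isCont_def tendsto_at_iff_tendsto_nhds)
  then obtain d where "d > 0" "\<And>x. dist x a < d \<Longrightarrow> f x > 0" by (auto simp: eventually_nhds_metric)
  then show ?thesis by (intro that[of "d / 2"]) (auto simp: dist_real_def)
qed

text \<open>Each bound holds at \<open>(D, 2)\<close> by continuity on a compact range of
  \<open>v\<close> and persists nearby by the tube lemma. The cut \<open>va\<close> must be so close
  to 0 that \<open>loud_b\<close> and the coefficient in \<open>k_bound\<close> keep on
  \<open>{0..va}\<close> the signs they have at 0.\<close>

theorem loud_bounds_eventually:
  assumes Dh: "- 2 < D" "D < 0" "D \<noteq> - 1 / 2"
  obtains va vb C el \<beta> \<sigma> where "\<bar>\<sigma>\<bar> = 1"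
    "\<forall>\<^sub>F \<mu> in nhds (D, 2). loud_bounds (fst \<mu>) (snd \<mu>) va vb C el \<beta> \<sigma>"
proof -
  interpret loud_center D 2 using Dh by unfold_locales auto
  define \<mu>0 where "\<mu>0 = (D, 2 :: real)"
  \<comment> \<open>Opposite to the sign of \<open>loud_N' D 0 = 1 + 2 * D\<close>, which is nonzero
    by \<open>D \<noteq> - 1 / 2\<close>.\<close>
  define \<sigma> :: real where "\<sigma> = (if 1 + 2 * D < 0 then 1 else - 1)"
  have "1 + 2 * D \<noteq> 0" using Dh(3) by auto
  then have \<sigma>: "\<bar>\<sigma>\<bar> = 1" "\<sigma> * (1 + 2 * D) < 0" by (auto simp: \<sigma>_def)
  have \<mu>0: "\<mu>0 \<in> loud_params" using Dh by (simp add: \<mu>0_def loud_params_def)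
  have inL: "\<forall>\<^sub>F \<mu> in nhds \<mu>0. \<mu> \<in> loud_params" using \<mu>0 open_loud_params by (intro eventually_nhds_in_open)
  have N0: "loud_N D 0 = - D" "loud_N' D 0 = 1 + 2 * D" by (simp_all add: loud_N_def loud_N'_def)
  define k where "k D v = - loud_N' D v / loud_N D v ^ 3" for D v
  have cN: "isCont (loud_N D) v" "isCont (loud_N' D) v" for v D
    unfolding loud_N_def loud_N'_def by (intro continuous_intros)+
  have k0: "\<sigma> * k D 0 > 0"
  proof -
    have "\<sigma> * k D 0 = - (\<sigma> * (1 + 2 * D)) / (- D) ^ 3"
      by (simp only: k_def N0 times_divide_eq_right mult_minus_right)
    moreover have "(- D) ^ 3 > 0" using Dh by simp
    ultimately show ?thesis using \<sigma>(2) by (metis divide_pos_pos neg_0_less_iff_less)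
  qed
  \<comment> \<open>At \<open>F = 2\<close> the value of \<open>loud_r\<close> at 0 vanishes and
    removes the first summand of \<open>loud_b\<close>; in the second one \<open>loud_q\<close> and
    \<open>loud_N\<close> both equal \<open>- D\<close> at 0 and cancel.\<close>
  have b0: "\<sigma> * loud_b D 2 0 > 0"
  proof -
    have q: "loud_q D 2 0 = - D" by (simp add: loud_q_def)
    have r: "loud_r D 2 0 = 0" "loud_r' D 2 0 = k D 0" by (simp_all add: loud_r_def loud_r'_def k_def)
    have "loud_b D 2 0 = k D 0 / 2" using Dh by (simp add: loud_b_def r q N0)
    then have "\<sigma> * loud_b D 2 0 = \<sigma> * k D 0 / 2" by (simp only: times_divide_eq_right)
    then show ?thesis using k0 by linarith
  qed
  have ck: "isCont (\<lambda>v. \<sigma> * k D v) 0" unfolding k_def using Dh by (intro continuous_intros cN) (simp add: N0)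
  have cb: "isCont (\<lambda>v. \<sigma> * loud_b D 2 v) 0"
    unfolding loud_b_def loud_r_def loud_r'_def loud_q_def loud_q'_def
    using Dh by (intro continuous_intros cN) (simp_all add: N0)
  obtain d1 where d1: "d1 > 0" "\<And>x. \<bar>x - 0\<bar> \<le> d1 \<Longrightarrow> \<sigma> * k D x > 0" by (rule continuous_pos_right[OF ck k0]) blast
  obtain d2 where d2: "d2 > 0" "\<And>x. \<bar>x - 0\<bar> \<le> d2 \<Longrightarrow> \<sigma> * loud_b D 2 x > 0" by (rule continuous_pos_right[OF cb b0]) blast
  have "c > 0" by (rule c_pos)
  \<comment> \<open>Below \<open>c\<close>, so that the branches are defined at \<open>h\<close>,
    and below 1, so that the energies at both cuts are less than 1.\<close>
  define h where "h = min (1 / 2) (c / 2)"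
  have h: "0 < h" "h < c" "h < 1" using \<open>c > 0\<close> by (auto simp: h_def)
  have vlh: "0 < vl h" "vl h < 1" "e (vl h) = h" using vl[OF h(1,2)] by auto
  define va where "va = min (min d1 d2) (vl h)"
  have va: "0 < va" "va < 1" "va \<le> d1" "va \<le> d2" "va \<le> vl h"
    using d1(1) d2(1) vlh by (auto simp: va_def)
  have eva: "0 < e va" "e va < 1"
  proof -
    show "0 < e va" using va vmax_gt_1 by (intro e_pos) auto
    have "e va \<le> e (vl h)" using e_strict_mono[of va "vl h"] va vlh by (cases "va = vl h") auto
    then show "e va < 1" using vlh h by simp
  qed
  define vb where "vb = vr h"
  have vb: "1 < vb" "vb < loud_vmax D 2" "0 < e vb" "e vb < 1" using vr[OF h(1,2)] h by (auto simp: vb_def)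
  obtain d3 where d3: "d3 > 0" "\<And>x. \<bar>x - loud_vmax D 2\<bar> \<le> d3 \<Longrightarrow> - loud_N D x > 0"
    using continuous_pos_right[where f="\<lambda>x. - loud_N D x" and a="loud_vmax D 2"] N_neg[of "loud_vmax D 2"] vmax_gt_1 cN
    by (auto intro: continuous_intros)
  \<comment> \<open>The endpoint \<open>loud_vmax\<close> moves with the parameter, so the right
    interval is extended slightly beyond it, to where \<open>loud_N\<close> is still
    negative.\<close>
  define vc where "vc = loud_vmax D 2 + d3"
  have vc: "loud_vmax D 2 < vc" using d3 by (simp add: vc_def)
  have Nvc: "- loud_N D v > 0" if "v \<in> {vb..vc}" for v
    using N_neg[of v] d3(2)[of v] that vb by (cases "v \<le> loud_vmax D 2") (auto simp: vc_def)
  have ev_vmax: "\<forall>\<^sub>F \<mu> in nhds \<mu>0. loud_vmax (fst \<mu>) (snd \<mu>) \<in> {vb<..<vc}"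
  proof -
    have "isCont (\<lambda>\<mu>. loud_vmax (fst \<mu>) (snd \<mu>)) \<mu>0"
      using cont_vmax open_loud_params \<mu>0 by (simp add: continuous_on_eq_continuous_at)
    then have "((\<lambda>\<mu>. loud_vmax (fst \<mu>) (snd \<mu>)) \<longlongrightarrow> loud_vmax (fst \<mu>0) (snd \<mu>0)) (nhds \<mu>0)"
      using tendsto_at_iff_tendsto_nhds[of "\<lambda>\<mu>. loud_vmax (fst \<mu>) (snd \<mu>)" \<mu>0] by (simp only: isCont_def)
    then show ?thesis by (rule topological_tendstoD) (use vb vc in \<open>auto simp: \<mu>0_def\<close>)
  qed
  obtain \<beta>N where \<beta>N: "\<beta>N > 0" "\<forall>\<^sub>F \<mu> in nhds \<mu>0. \<forall>v\<in>{vb..vc}. \<beta>N \<le> - loud_N (fst \<mu>) v"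
    by (rule eventually_lower_bound[of UNIV "{vb..vc}" "\<lambda>z. - loud_N (fst (fst z)) (snd z)" \<mu>0])
       (use Nvc in \<open>auto intro!: continuous_intros cont_N simp: \<mu>0_def\<close>)
  \<comment> \<open>Beyond \<open>loud_vmax\<close> the sign of \<open>loud_N\<close> is not covered
    by \<open>N_neg\<close>; on this smaller neighbourhood \<open>loud_N\<close> has no zero on
    \<open>{vb..vc}\<close>, which makes the \<open>loud_H\<close> functions jointly continuous
    there.\<close>
  obtain X0 where X0: "open X0" "\<mu>0 \<in> X0" "\<And>\<mu> v. \<mu> \<in> X0 \<Longrightarrow> v \<in> {vb..vc} \<Longrightarrow> \<beta>N \<le> - loud_N (fst \<mu>) v"
    using \<beta>N(2) unfolding eventually_nhds by blast
  have NX: "loud_N (fst (fst z)) (snd z) \<noteq> 0 \<and> snd z > 0" if "z \<in> X0 \<times> {vb..vc}" for z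
    using X0(3)[of "fst z" "snd z"] that \<beta>N(1) vb by auto
  have NL: "loud_N (fst (fst z)) (snd z) \<noteq> 0" if "z \<in> loud_params \<times> {0..va}" for z
  proof -
    interpret z: loud_center "fst (fst z)" "snd (fst z)" using that by (auto simp: loud_params_iff[symmetric])
    show ?thesis using z.N_pos[of "snd z"] that va by auto
  qed
  note open_loud_params [simp] and \<mu>0 [simp] and X0(1,2) [simp]
  have cvb: "{vb} \<subseteq> {vb..vc}" using vb vc by auto
  obtain C1 where C1: "\<forall>\<^sub>F \<mu> in nhds \<mu>0. \<forall>v\<in>{vb..vc}. \<bar>loud_H1 (fst \<mu>) (snd \<mu>) v\<bar> \<le> C1"
    by (rule eventually_bounded[of X0 "{vb..vc}" "\<lambda>z. loud_H1 (fst (fst z)) (snd (fst z)) (snd z)" \<mu>0, OF cont_H(2)[OF NX]]) simp_all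
  obtain C2 where C2: "\<forall>\<^sub>F \<mu> in nhds \<mu>0. \<forall>v\<in>{vb..vc}. \<bar>loud_H2 (fst \<mu>) (snd \<mu>) v\<bar> \<le> C2"
    by (rule eventually_bounded[of X0 "{vb..vc}" "\<lambda>z. loud_H2 (fst (fst z)) (snd (fst z)) (snd z)" \<mu>0, OF cont_H(3)[OF NX]]) simp_all
  obtain C3 where C3: "\<forall>\<^sub>F \<mu> in nhds \<mu>0. \<forall>v\<in>{vb..vc}. \<bar>loud_H0 (fst \<mu>) (snd \<mu>) v\<bar> \<le> C3"
    by (rule eventually_bounded[of X0 "{vb..vc}" "\<lambda>z. loud_H0 (fst (fst z)) (snd (fst z)) (snd z)" \<mu>0, OF cont_H(1)[OF NX]]) simp_all
  have NA: "loud_N (fst (fst z)) (snd z) \<noteq> 0 \<and> snd z > 0" if "z \<in> loud_params \<times> {va}" for z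
    using NL[of z] that va by auto
  obtain C4 where C4: "\<forall>\<^sub>F \<mu> in nhds \<mu>0. \<forall>v\<in>{va}. \<bar>loud_H0 (fst \<mu>) (snd \<mu>) v\<bar> \<le> C4"
    by (rule eventually_bounded[of loud_params "{va}" "\<lambda>z. loud_H0 (fst (fst z)) (snd (fst z)) (snd z)" \<mu>0, OF cont_H(1)[OF NA]]) simp_all
  obtain C5 where C5: "\<forall>\<^sub>F \<mu> in nhds \<mu>0. \<forall>v\<in>{va}. \<bar>loud_H1 (fst \<mu>) (snd \<mu>) v\<bar> \<le> C5"
    by (rule eventually_bounded[of loud_params "{va}" "\<lambda>z. loud_H1 (fst (fst z)) (snd (fst z)) (snd z)" \<mu>0, OF cont_H(2)[OF NA]]) simp_all
  have cq: "continuous_on (loud_params \<times> {0..va}) (\<lambda>z. loud_q (fst (fst z)) (snd (fst z)) (snd z))" by (rule cont_q) auto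
  obtain C6 where C6: "\<forall>\<^sub>F \<mu> in nhds \<mu>0. \<forall>v\<in>{0..va}. \<bar>loud_q (fst \<mu>) (snd \<mu>) v\<bar> \<le> C6"
    by (rule eventually_bounded[OF cq open_loud_params \<mu>0 compact_Icc]) simp_all
  have pos: "0 < loud_q (fst (fst (\<mu>0, w))) (snd (fst (\<mu>0, w))) (snd (\<mu>0, w))" if "w \<in> {0..va}" for w
    using q_pos[of w] va vmax_gt_1 that by (simp add: \<mu>0_def)
  obtain \<beta>q where \<beta>q: "\<beta>q > 0" "\<forall>\<^sub>F \<mu> in nhds \<mu>0. \<forall>v\<in>{0..va}. \<beta>q \<le> loud_q (fst \<mu>) (snd \<mu>) v"
    by (rule eventually_lower_bound[OF cq open_loud_params \<mu>0 compact_Icc pos]) simp_all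
  obtain C7 where C7: "\<forall>\<^sub>F \<mu> in nhds \<mu>0. \<forall>v\<in>{va..vb}. \<bar>v powr (snd \<mu> - 1)\<bar> \<le> C7"
  proof (rule eventually_bounded[of UNIV "{va..vb}" "\<lambda>z. snd z powr (snd (fst z) - 1)" \<mu>0])
    show "continuous_on (UNIV \<times> {va..vb}) (\<lambda>z :: (real \<times> real) \<times> real. snd z powr (snd (fst z) - 1))"
      using va by (intro continuous_intros) auto
  qed simp_all
  have cN2: "continuous_on (loud_params \<times> {0..va}) (\<lambda>z. 1 / (loud_N (fst (fst z)) (snd z))\<^sup>2)"
    by (intro continuous_intros cont_N ballI) (use NL in auto)
  obtain C8 where C8: "\<forall>\<^sub>F \<mu> in nhds \<mu>0. \<forall>v\<in>{0..va}. \<bar>1 / (loud_N (fst \<mu>) v)\<^sup>2\<bar> \<le> C8"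
    by (rule eventually_bounded[OF cN2 open_loud_params \<mu>0 compact_Icc]) simp_all
  have pos: "0 < 1 / (loud_N (fst (fst (\<mu>0, w))) (snd (\<mu>0, w)))\<^sup>2" if "w \<in> {0..va}" for w
    using NL[of "(\<mu>0, w)"] that by simp
  obtain \<beta>n where \<beta>n: "\<beta>n > 0" "\<forall>\<^sub>F \<mu> in nhds \<mu>0. \<forall>v\<in>{0..va}. \<beta>n \<le> 1 / (loud_N (fst \<mu>) v)\<^sup>2"
    by (rule eventually_lower_bound[OF cN2 open_loud_params \<mu>0 compact_Icc pos]) simp_all
  have ckk: "continuous_on (loud_params \<times> {0..va}) (\<lambda>z. \<sigma> * (- loud_N' (fst (fst z)) (snd z) / loud_N (fst (fst z)) (snd z) ^ 3))"
    by (intro continuous_intros cont_N cont_N' ballI) (use NL in auto)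
  obtain C9 where C9: "\<forall>\<^sub>F \<mu> in nhds \<mu>0. \<forall>v\<in>{0..va}. \<bar>\<sigma> * (- loud_N' (fst \<mu>) v / loud_N (fst \<mu>) v ^ 3)\<bar> \<le> C9"
    by (rule eventually_bounded[OF ckk open_loud_params \<mu>0 compact_Icc]) simp_all
  have pos: "0 < \<sigma> * (- loud_N' (fst (fst (\<mu>0, w))) (snd (\<mu>0, w)) / loud_N (fst (fst (\<mu>0, w))) (snd (\<mu>0, w)) ^ 3)" if "w \<in> {0..va}" for w
    using d1(2)[of w] that va by (simp add: \<mu>0_def k_def)
  obtain \<beta>k where \<beta>k: "\<beta>k > 0" "\<forall>\<^sub>F \<mu> in nhds \<mu>0. \<forall>v\<in>{0..va}. \<beta>k \<le> \<sigma> * (- loud_N' (fst \<mu>) v / loud_N (fst \<mu>) v ^ 3)"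
    by (rule eventually_lower_bound[OF ckk open_loud_params \<mu>0 compact_Icc pos]) simp_all
  have cbb: "continuous_on (loud_params \<times> {0..va}) (\<lambda>z. \<sigma> * loud_b (fst (fst z)) (snd (fst z)) (snd z))"
    by (intro continuous_intros cont_b) (use NL in auto)
  have pos: "0 < \<sigma> * loud_b (fst (fst (\<mu>0, w))) (snd (fst (\<mu>0, w))) (snd (\<mu>0, w))" if "w \<in> {0..va}" for w
    using d2(2)[of w] that va by (simp add: \<mu>0_def)
  obtain \<beta>b where \<beta>b: "\<beta>b > 0" "\<forall>\<^sub>F \<mu> in nhds \<mu>0. \<forall>v\<in>{0..va}. \<beta>b \<le> \<sigma> * loud_b (fst \<mu>) (snd \<mu>) v"
    by (rule eventually_lower_bound[OF cbb open_loud_params \<mu>0 compact_Icc pos]) simp_all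
  have ee: "\<exists>el>0. \<forall>\<^sub>F \<mu> in nhds \<mu>0. el \<le> loud_e (fst \<mu>) (snd \<mu>) v \<and> loud_e (fst \<mu>) (snd \<mu>) v \<le> 1"
    if v: "0 < v" "0 < e v" "e v < 1" for v
  proof -
    have ce: "continuous_on (loud_params \<times> {v}) (\<lambda>z. loud_e (fst (fst z)) (snd (fst z)) (snd z))"
      using v by (intro cont_e) auto
    have ev: "e v = loud_e D 2 v" by (simp add: e_loud_e)
    have pos: "0 < loud_e (fst (fst (\<mu>0, w))) (snd (fst (\<mu>0, w))) (snd (\<mu>0, w))" if "w \<in> {v}" for w
      using v ev that by (simp add: \<mu>0_def)
    obtain el where el: "el > 0" "\<forall>\<^sub>F \<mu> in nhds \<mu>0. \<forall>v\<in>{v}. el \<le> loud_e (fst \<mu>) (snd \<mu>) v"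
      by (rule eventually_lower_bound[OF ce open_loud_params \<mu>0 compact_sing pos]) simp_all
    have ce': "continuous_on (loud_params \<times> {v}) (\<lambda>z. 1 - loud_e (fst (fst z)) (snd (fst z)) (snd z))"
      by (intro continuous_intros ce)
    have pos: "0 < 1 - loud_e (fst (fst (\<mu>0, w))) (snd (fst (\<mu>0, w))) (snd (\<mu>0, w))" if "w \<in> {v}" for w
      using v ev that by (simp add: \<mu>0_def)
    obtain el' where el': "el' > 0" "\<forall>\<^sub>F \<mu> in nhds \<mu>0. \<forall>v\<in>{v}. el' \<le> 1 - loud_e (fst \<mu>) (snd \<mu>) v"
      by (rule eventually_lower_bound[OF ce' open_loud_params \<mu>0 compact_sing pos]) simp_all
    have "\<forall>\<^sub>F \<mu> in nhds \<mu>0. el \<le> loud_e (fst \<mu>) (snd \<mu>) v \<and> loud_e (fst \<mu>) (snd \<mu>) v \<le> 1"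
      using el(2) el'(2) by eventually_elim (use el'(1) in auto)
    then show ?thesis using el(1) by blast
  qed
  obtain ea where ea: "ea > 0" "\<forall>\<^sub>F \<mu> in nhds \<mu>0. ea \<le> loud_e (fst \<mu>) (snd \<mu>) va \<and> loud_e (fst \<mu>) (snd \<mu>) va \<le> 1"
    using ee[OF va(1) eva] by blast
  obtain eb where eb: "eb > 0" "\<forall>\<^sub>F \<mu> in nhds \<mu>0. eb \<le> loud_e (fst \<mu>) (snd \<mu>) vb \<and> loud_e (fst \<mu>) (snd \<mu>) vb \<le> 1"
    using ee[of vb] vb by auto
  have evF: "\<forall>\<^sub>F \<mu> in nhds \<mu>0. \<bar>snd \<mu> - 2\<bar> \<le> 1 / 20"
  proof -
    have "\<forall>\<^sub>F \<mu> in nhds \<mu>0. dist \<mu> \<mu>0 < 1 / 20" by (auto simp: eventually_nhds_metric intro: exI[of _ "1 / 20"])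
    then show ?thesis
    proof eventually_elim
      case (elim \<mu>)
      then have "dist (snd \<mu>) (snd \<mu>0) < 1 / 20" using dist_snd_le[of \<mu> \<mu>0] by linarith
      then show ?case by (simp add: \<mu>0_def dist_real_def)
    qed
  qed
  \<comment> \<open>The reciprocals are included so that the lower bounds on \<open>loud_q\<close>
    and on \<open>1 / loud_N^2\<close> take the form \<open>1 / C\<close>.\<close>
  define C where "C = Max {1, C1, C2, C3, C4, C5, C6, C7, C8, C9, 1 / \<beta>q, 1 / \<beta>n}"
  define el where "el = min ea eb"
  define \<beta> where "\<beta> = min \<beta>b \<beta>k"
  have Cge: "1 \<le> C" "C1 \<le> C" "C2 \<le> C" "C3 \<le> C" "C4 \<le> C" "C5 \<le> C" "C6 \<le> C" "C7 \<le> C" "C8 \<le> C" "C9 \<le> C"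
    "1 / \<beta>q \<le> C" "1 / \<beta>n \<le> C"
    unfolding C_def by (rule Max_ge; simp)+
  have inv: "1 / C \<le> \<beta>q" "1 / C \<le> \<beta>n"
    using Cge \<beta>q(1) \<beta>n(1) by (simp_all add: field_simps)
  have "\<forall>\<^sub>F \<mu> in nhds \<mu>0. loud_bounds (fst \<mu>) (snd \<mu>) va vb C el \<beta> \<sigma>"
    using inL ev_vmax C1 C2 C3 C4 C5 C6 \<beta>q(2) C7 C8 \<beta>n(2) C9 \<beta>k(2) \<beta>b(2) ea(2) eb(2) evF
  proof eventually_elim
    case (elim \<mu>)
    interpret u: loud_center "fst \<mu>" "snd \<mu>" using elim(1) by (simp add: loud_params_iff[symmetric])
    have range: "loud_vmax (fst \<mu>) (snd \<mu>) < vc" using elim(2) by simp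
    show ?case
    proof unfold_locales
      show "vb < loud_vmax (fst \<mu>) (snd \<mu>)" using elim(2) by simp
      show "0 < el" "0 < \<beta>" using ea(1) eb(1) \<beta>b(1) \<beta>k(1) by (simp_all add: el_def \<beta>_def)
      show "el \<le> u.e va" "u.e va \<le> 1" "el \<le> u.e vb" "u.e vb \<le> 1"
        using elim(16,17) by (auto simp: u.e_loud_e el_def)
      show "\<bar>loud_H0 (fst \<mu>) (snd \<mu>) va\<bar> \<le> C" using elim(6) Cge(5) by auto
      show "\<bar>loud_H1 (fst \<mu>) (snd \<mu>) va\<bar> \<le> C" using elim(7) Cge(6) by auto
      show "\<bar>loud_H0 (fst \<mu>) (snd \<mu>) vb\<bar> \<le> C" using elim(5) Cge(4) vb vc by force
      fix v
      show "\<bar>loud_H1 (fst \<mu>) (snd \<mu>) v\<bar> \<le> C \<and> \<bar>loud_H2 (fst \<mu>) (snd \<mu>) v\<bar> \<le> C"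
        if "vb \<le> v" "v \<le> loud_vmax (fst \<mu>) (snd \<mu>)"
      proof -
        have "v \<in> {vb..vc}" using that range by simp
        then have "\<bar>loud_H1 (fst \<mu>) (snd \<mu>) v\<bar> \<le> C1" "\<bar>loud_H2 (fst \<mu>) (snd \<mu>) v\<bar> \<le> C2"
          using elim(3,4) by blast+
        then show ?thesis using Cge(2,3) by linarith
      qed
      show "v powr (snd \<mu> - 1) \<le> C" if "va \<le> v" "v \<le> vb"
      proof -
        have "\<bar>v powr (snd \<mu> - 1)\<bar> \<le> C7" using elim(10) that by simp
        then show ?thesis using Cge(8) by linarith
      qed
      assume "0 \<le> v" "v \<le> va"
      then have v: "v \<in> {0..va}" by simp
      have "\<bar>loud_q (fst \<mu>) (snd \<mu>) v\<bar> \<le> C6" "\<beta>q \<le> loud_q (fst \<mu>) (snd \<mu>) v" using elim(8,9) v by blast+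
      then show "1 / C \<le> loud_q (fst \<mu>) (snd \<mu>) v \<and> loud_q (fst \<mu>) (snd \<mu>) v \<le> C"
        using Cge(7) inv(1) by linarith
      have "\<bar>1 / (loud_N (fst \<mu>) v)\<^sup>2\<bar> \<le> C8" "\<beta>n \<le> 1 / (loud_N (fst \<mu>) v)\<^sup>2" using elim(11,12) v by blast+
      then show "1 / C \<le> 1 / (loud_N (fst \<mu>) v)\<^sup>2 \<and> 1 / (loud_N (fst \<mu>) v)\<^sup>2 \<le> C"
        using Cge(9) inv(2) by linarith
      have "\<bar>\<sigma> * (- loud_N' (fst \<mu>) v / loud_N (fst \<mu>) v ^ 3)\<bar> \<le> C9"
        "\<beta>k \<le> \<sigma> * (- loud_N' (fst \<mu>) v / loud_N (fst \<mu>) v ^ 3)" using elim(13,14) v by blast+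
      then show "\<beta> \<le> \<sigma> * (- loud_N' (fst \<mu>) v / loud_N (fst \<mu>) v ^ 3) \<and>
          \<sigma> * (- loud_N' (fst \<mu>) v / loud_N (fst \<mu>) v ^ 3) \<le> C"
        using Cge(10) unfolding \<beta>_def by linarith
      have "\<beta>b \<le> \<sigma> * loud_b (fst \<mu>) (snd \<mu>) v" using elim(15) v by blast
      then show "\<beta> \<le> \<sigma> * loud_b (fst \<mu>) (snd \<mu>) v" unfolding \<beta>_def by linarith
    qed (use va vb Cge(1) \<sigma>(1) elim(18) in simp_all)
  qed
  then show ?thesis using that[OF \<sigma>(1)] by (simp add: \<mu>0_def)
qed

section \<open>Critical orbits near the outer boundary\<close>

lemma (in loud_center) critical_orbit_period1:
  assumes va: "0 < va" "va < 1" and vb: "1 < vb" "vb < loud_vmax D F"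
    and \<eta>: "0 < \<eta>" "\<eta> < e va" "\<eta> < e vb"
  shows "critical_periodic_orbit (loud (D, F)) (orbit \<eta>) \<longleftrightarrow> period1 va vb \<eta> = 0"
proof
  have \<eta>c: "\<eta> < c" using \<eta> e_ab[OF va vb] by linarith
  note d = period_deriv(1)[OF va vb \<eta>]
  assume "critical_periodic_orbit (loud (D, F)) (orbit \<eta>)"
  then obtain \<eta>' where \<eta>': "0 < \<eta>'" "\<eta>' < c" "orbit \<eta> = orbit \<eta>'"
    "\<And>d. (period has_real_derivative d) (at \<eta>') \<Longrightarrow> d = 0"
    by (rule critical_orbit_energy) blast
  have "\<eta> = \<eta>'" by (rule orbit_inj[OF \<eta>(1) \<eta>c \<eta>'(3)])
  then show "period1 va vb \<eta> = 0" using \<eta>'(4) d by blast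
next
  have \<eta>c: "\<eta> < c" using \<eta> e_ab[OF va vb] by linarith
  assume "period1 va vb \<eta> = 0"
  then show "critical_periodic_orbit (loud (D, F)) (orbit \<eta>)"
    using period_deriv(1)[OF va vb \<eta>] by (intro critical_orbitI \<eta>(1) \<eta>c) simp
qed

text \<open>\<open>K2\<close> involves only constants that are fixed on a neighbourhood, so
  \<open>\<nu>\<close> and \<open>\<eta>0\<close> can be chosen before the parameter; afterwards the
  neighbourhood is shrunk to \<open>\<bar>F - 2\<bar> \<le> \<nu> / 2\<close>.\<close>

theorem critical_orbit_unique_near_boundary:
  assumes D: "- 2 < D" "D < 0" "D \<noteq> - 1 / 2"
  obtains \<eta>0 where "\<eta>0 > 0"
    "\<forall>\<^sub>F \<mu> in nhds (D, 2). \<mu> \<in> loud_params \<and> (\<forall>\<eta>1 \<eta>2. 0 < \<eta>1 \<and> \<eta>1 < \<eta>2 \<and> \<eta>2 \<le> \<eta>0 \<longrightarrow>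
       \<not> (critical_periodic_orbit (loud \<mu>) (loud_center.orbit (fst \<mu>) (snd \<mu>) \<eta>1) \<and>
         critical_periodic_orbit (loud \<mu>) (loud_center.orbit (fst \<mu>) (snd \<mu>) \<eta>2)))"
proof -
  obtain va vb C el \<beta> \<sigma> where \<sigma>: "\<bar>\<sigma>\<bar> = 1"
    and ev: "\<forall>\<^sub>F \<mu> in nhds (D, 2). loud_bounds (fst \<mu>) (snd \<mu>) va vb C el \<beta> \<sigma>"
    by (rule loud_bounds_eventually[OF D])
  from eventually_nhds_x_imp_x[OF ev] interpret b0: loud_bounds D 2 va vb C el \<beta> \<sigma> by simp
  obtain \<nu> \<eta>0 where \<nu>: "0 < \<nu>" "\<nu> \<le> 1 / 8" and \<eta>0: "0 < \<eta>0" "\<eta>0 \<le> el / 2"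
    and K: "\<And>\<eta> e0. 0 < \<eta> \<Longrightarrow> \<eta> \<le> \<eta>0 \<Longrightarrow> el \<le> e0 \<Longrightarrow>
       4 * C * (loud_bounds.K2 va vb C el + 1) / \<beta> \<le> abel e0 (\<lambda>x. x powr (\<nu> - 1 / 2)) \<eta>"
    using abel_powr_unbounded[OF b0.el(1) order_trans[OF b0.el(2,3)], of "4 * C * (loud_bounds.K2 va vb C el + 1) / \<beta>"]
    by blast
  have evF: "\<forall>\<^sub>F \<mu> in nhds (D, 2). \<bar>snd \<mu> - 2\<bar> \<le> \<nu> / 2"
  proof -
    have "\<forall>\<^sub>F \<mu> in nhds (D, 2 :: real). dist \<mu> (D, 2) < \<nu> / 2" using \<nu> by (auto simp: eventually_nhds_metric intro: exI[of _ "\<nu> / 2"])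
    then show ?thesis
    proof eventually_elim
      case (elim \<mu>)
      then have "dist (snd \<mu>) (snd (D, 2 :: real)) < \<nu> / 2" using dist_snd_le[of \<mu> "(D, 2)"] by linarith
      then show ?case by (simp add: dist_real_def)
    qed
  qed
  have "\<forall>\<^sub>F \<mu> in nhds (D, 2). \<mu> \<in> loud_params \<and> (\<forall>\<eta>1 \<eta>2. 0 < \<eta>1 \<and> \<eta>1 < \<eta>2 \<and> \<eta>2 \<le> \<eta>0 \<longrightarrow>
       \<not> (critical_periodic_orbit (loud \<mu>) (loud_center.orbit (fst \<mu>) (snd \<mu>) \<eta>1) \<and>
         critical_periodic_orbit (loud \<mu>) (loud_center.orbit (fst \<mu>) (snd \<mu>) \<eta>2)))"
    using ev evF
  proof eventually_elim
    case (elim \<mu>)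
    interpret u: loud_bounds "fst \<mu>" "snd \<mu>" va vb C el \<beta> \<sigma> by (rule elim(1))
    have "\<mu> \<in> loud_params" using u.loud_center_axioms loud_params_iff[of "fst \<mu>" "snd \<mu>"] by simp
    moreover have False if \<eta>: "0 < \<eta>1" "\<eta>1 < \<eta>2" "\<eta>2 \<le> \<eta>0"
      and c: "critical_periodic_orbit (loud \<mu>) (u.orbit \<eta>1)" "critical_periodic_orbit (loud \<mu>) (u.orbit \<eta>2)" for \<eta>1 \<eta>2
    proof -
      have b: "0 < \<eta>1" "\<eta>1 < u.e va" "\<eta>1 < u.e vb" "0 < \<eta>2" "\<eta>2 < u.e va" "\<eta>2 < u.e vb"
        using \<eta> \<eta>0 u.el by linarith+
      have "u.P1 \<eta>1 = 0" "u.P1 \<eta>2 = 0"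
        using u.critical_orbit_period1[OF u.va u.vb b(1-3)] u.critical_orbit_period1[OF u.va u.vb b(4-6)] c by simp_all
      then show False
        using u.period1_zero_unique[OF \<eta>0(2) \<nu> elim(2) K[OF _ _ u.el(2)] \<eta>] by blast
    qed
    ultimately show ?case by blast
  qed
  with \<eta>0(1) show ?thesis by (rule that)
qed

text \<open>Two scales are played against each other. The energy \<open>\<eta>2\<close> is fixed
  first, then \<open>F\<close> is brought so close to 2 that \<open>\<sigma> * P1\<close> is
  positive there; for that \<open>F\<close>, \<open>period1_negative\<close> supplies a much smaller
  energy with the opposite sign. The predicate \<open>P\<close> lets the caller impose further
  conditions that hold near \<open>(D, 2)\<close>.\<close>

theorem critical_orbit_exists_near_boundary:
  assumes D: "- 2 < D" "D < 0" "D \<noteq> - 1 / 2" and \<eta>s: "\<eta>s > 0"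
    and nb: "\<forall>\<^sub>F \<mu> in nhds (D, 2). P \<mu>"
  obtains \<mu> \<eta> where "\<mu> \<in> loud_params" "P \<mu>" "0 < \<eta>" "\<eta> < \<eta>s" "\<eta> < loud_center.c (fst \<mu>) (snd \<mu>)"
    "critical_periodic_orbit (loud \<mu>) (loud_center.orbit (fst \<mu>) (snd \<mu>) \<eta>)"
proof -
  obtain va vb C el \<beta> \<sigma> where \<sigma>: "\<bar>\<sigma>\<bar> = 1"
    and ev: "\<forall>\<^sub>F \<mu> in nhds (D, 2). loud_bounds (fst \<mu>) (snd \<mu>) va vb C el \<beta> \<sigma>"
    by (rule loud_bounds_eventually[OF D])
  from eventually_nhds_x_imp_x[OF ev] interpret b0: loud_bounds D 2 va vb C el \<beta> \<sigma> by simp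
  have C0: "C > 0" using b0.C by linarith
  obtain \<nu> \<eta>0 where \<nu>: "0 < \<nu>" "\<nu> \<le> 1 / 8" and \<eta>0: "0 < \<eta>0" "\<eta>0 \<le> el / 2"
    and K: "\<And>\<eta> e0. 0 < \<eta> \<Longrightarrow> \<eta> \<le> \<eta>0 \<Longrightarrow> el \<le> e0 \<Longrightarrow>
       4 * C * (loud_bounds.K1 va vb C el + 3) / \<beta> \<le> abel e0 (\<lambda>x. x powr (\<nu> - 1 / 2)) \<eta>"
    using abel_powr_unbounded[OF b0.el(1) order_trans[OF b0.el(2,3)], of "4 * C * (loud_bounds.K1 va vb C el + 3) / \<beta>"]
    by blast
  define \<eta>2 where "\<eta>2 = min \<eta>0 (\<eta>s / 2)"
  have \<eta>2: "0 < \<eta>2" "\<eta>2 \<le> \<eta>0" "\<eta>2 < \<eta>s" "\<eta>2 \<le> el / 2" using \<eta>0 \<eta>s by (auto simp: \<eta>2_def)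
  have "\<forall>\<^sub>F \<mu> in nhds (D, 2). loud_bounds (fst \<mu>) (snd \<mu>) va vb C el \<beta> \<sigma> \<and> P \<mu>"
    using ev nb by eventually_elim simp
  then obtain d where d: "d > 0" "\<And>\<mu>. dist \<mu> (D, 2) < d \<Longrightarrow> loud_bounds (fst \<mu>) (snd \<mu>) va vb C el \<beta> \<sigma> \<and> P \<mu>"
    by (auto simp: eventually_nhds_metric)
  \<comment> \<open>The entries keep the parameter in the neighbourhood, ensure
    \<open>t \<le> \<nu> / 2\<close>, and meet the smallness condition of
    \<open>period1_positive\<close> at \<open>\<eta>2\<close>.\<close>
  define t where "t = min (min (d / 2) (\<nu> / 2)) (4 / (C * (C / \<eta>2)\<^sup>2))"
  have t: "0 < t" "t < d" "t \<le> \<nu> / 2" "t \<le> 4 / (C * (C / \<eta>2)\<^sup>2)"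
    using d(1) \<nu> C0 \<eta>2 by (auto simp: t_def)
  \<comment> \<open>This side of 2 gives \<open>\<sigma> * (2 - F) = - t < 0\<close>, as
    \<open>period1_negative\<close> demands.\<close>
  define \<mu> where "\<mu> = (D, 2 + \<sigma> * t)"
  have dist: "dist \<mu> (D, 2) < d" using t \<sigma> by (simp add: \<mu>_def dist_prod_def dist_real_def abs_mult)
  have P: "P \<mu>" using d(2)[OF dist] by simp
  interpret u: loud_bounds D "2 + \<sigma> * t" va vb C el \<beta> \<sigma> using d(2)[OF dist] by (simp add: \<mu>_def)
  have Ft: "\<bar>2 + \<sigma> * t - 2\<bar> = t" using \<sigma> t by (simp add: abs_mult)
  have \<mu>L: "\<mu> \<in> loud_params" using u.loud_center_axioms loud_params_iff[of D "2 + \<sigma> * t"] by (simp add: \<mu>_def)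
  have pos: "0 < \<sigma> * u.P1 \<eta>2"
  proof (rule u.period1_positive[OF \<eta>2(1,4) \<nu>])
    show "\<bar>2 + \<sigma> * t - 2\<bar> \<le> \<nu> / 2" unfolding Ft by (rule t(3))
    show "4 * C * (loud_bounds.K1 va vb C el + 3) / \<beta> \<le> abel (u.e va) (\<lambda>x. x powr (\<nu> - 1 / 2)) \<eta>2"
      by (rule K[OF \<eta>2(1,2) u.el(2)])
    have "C * (C / \<eta>2)\<^sup>2 > 0" using C0 \<eta>2 by simp
    then have "t * (C * (C / \<eta>2)\<^sup>2) \<le> 4" using t(4) by (simp only: pos_le_divide_eq)
    then show "\<bar>2 + \<sigma> * t - 2\<bar> * C * (C / \<eta>2)\<^sup>2 \<le> 4" unfolding Ft by (simp only: mult.assoc)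
  qed
  have "\<sigma> * \<sigma> = 1" using \<sigma> by (metis abs_mult_self_eq mult_1)
  moreover have "\<sigma> * (2 - (2 + \<sigma> * t)) = - (\<sigma> * \<sigma> * t)" by simp
  ultimately have "\<sigma> * (2 - (2 + \<sigma> * t)) < 0" using t by (simp only: mult_1 neg_less_0_iff_less)
  then obtain \<eta>1 where \<eta>1: "0 < \<eta>1" "\<eta>1 < \<eta>2" "\<eta>1 \<le> el / 2" and neg: "\<sigma> * u.P1 \<eta>1 < 0"
    by (rule u.period1_negative[OF _ \<eta>2(1)])
  have "\<exists>\<eta>\<ge>\<eta>1. \<eta> \<le> \<eta>2 \<and> \<sigma> * u.P1 \<eta> = 0"
  proof (rule IVT')
    show "continuous_on {\<eta>1..\<eta>2} (\<lambda>\<eta>. \<sigma> * u.P1 \<eta>)"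
    proof (intro continuous_intros continuous_at_imp_continuous_on ballI)
      fix \<eta> assume "\<eta> \<in> {\<eta>1..\<eta>2}"
      then have "0 < \<eta>" "\<eta> < u.e va" "\<eta> < u.e vb" using \<eta>1 \<eta>2 u.el by auto
      from u.period_deriv(2)[OF u.va u.vb this] show "isCont u.P1 \<eta>" by (rule DERIV_isCont)
    qed
  qed (use pos neg \<eta>1 in auto)
  then obtain \<eta> where \<eta>: "\<eta>1 \<le> \<eta>" "\<eta> \<le> \<eta>2" "\<sigma> * u.P1 \<eta> = 0" by blast
  have b: "0 < \<eta>" "\<eta> < u.e va" "\<eta> < u.e vb" using \<eta> \<eta>1 \<eta>2 u.el by linarith+
  have "u.P1 \<eta> = 0" using \<eta>(3) \<sigma> by auto
  then have "critical_periodic_orbit (loud \<mu>) (u.orbit \<eta>)"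
    using u.critical_orbit_period1[OF u.va u.vb b] by (simp add: \<mu>_def)
  moreover have "\<eta> < u.c" using b u.e_ab[OF u.va u.vb] by linarith
  ultimately show ?thesis
    using that[OF \<mu>L P b(1), unfolded \<mu>_def] \<eta>(2) \<eta>2(3) by (simp add: \<mu>_def)
qed

section \<open>Convergence of orbits to the outer boundary\<close>

text \<open>Maps the rectangle \<open>{0..1} \<times> {-1..1}\<close> onto the closed annulus in the chart; the energy of the
  image of \<open>(s, t)\<close> is \<open>e (loud_vmax D F * s) * (1 - t\<^sup>2)\<close>.\<close>

definition loud_map :: "real \<times> real \<Rightarrow> real \<times> real \<Rightarrow> real \<times> real" where
  "loud_map \<mu> z = (loud_vmax (fst \<mu>) (snd \<mu>) * fst z,
     snd z * sqrt (loud_q (fst \<mu>) (snd \<mu>) (loud_vmax (fst \<mu>) (snd \<mu>) * fst z)))"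

definition rect :: "(real \<times> real) set" where "rect = {0..1} \<times> {-1..1}"

definition rect_boundary :: "(real \<times> real) set" where
  "rect_boundary = {z \<in> rect. fst z = 0 \<or> fst z = 1 \<or> \<bar>snd z\<bar> = 1}"

lemma rect_split: "rect = {0<..<1} \<times> {-1<..<1} \<union> rect_boundary"
  by (auto simp: rect_def rect_boundary_def abs_if)

lemma cont_loud_map: "continuous_on (loud_params \<times> S) (\<lambda>(\<mu>, z). loud_map \<mu> z)"
proof -
  have v: "continuous_on (loud_params \<times> S) (\<lambda>w. loud_vmax (fst (fst w)) (snd (fst w)) * fst (snd w))"
    by (intro continuous_intros continuous_on_compose2[OF cont_vmax, of _ fst]) auto
  have "continuous_on (loud_params \<times> UNIV) (\<lambda>z. loud_q (fst (fst z)) (snd (fst z)) (snd z))"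
    by (rule cont_q) auto
  then have "continuous_on (loud_params \<times> S) (\<lambda>w. loud_q (fst (fst (fst w, loud_vmax (fst (fst w)) (snd (fst w)) * fst (snd w))))
      (snd (fst (fst w, loud_vmax (fst (fst w)) (snd (fst w)) * fst (snd w))))
      (snd (fst w, loud_vmax (fst (fst w)) (snd (fst w)) * fst (snd w))))"
    by (rule continuous_on_compose2) (auto intro!: continuous_on_Pair v continuous_on_fst continuous_on_id)
  then have "continuous_on (loud_params \<times> S) (\<lambda>w. snd (snd w) * sqrt (loud_q (fst (fst w)) (snd (fst w))
      (loud_vmax (fst (fst w)) (snd (fst w)) * fst (snd w))))"
    unfolding fst_conv snd_conv
    by (intro continuous_on_mult continuous_on_real_sqrt continuous_on_snd continuous_on_id)
  from continuous_on_Pair[OF v this] show ?thesis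
    by (simp add: loud_map_def case_prod_unfold)
qed

context loud_center
begin

lemma v_range: "0 \<le> s \<Longrightarrow> s \<le> 1 \<Longrightarrow> 0 \<le> loud_vmax D F * s \<and> loud_vmax D F * s \<le> loud_vmax D F"
  using vmax_gt_1 by (simp add: mult_left_le)

lemma q_nonneg: "0 \<le> v \<Longrightarrow> v \<le> loud_vmax D F \<Longrightarrow> 0 \<le> loud_q D F v"
  using q_pos[of v] q_vmax by (cases "v = loud_vmax D F") auto

lemma loud_map_energy:
  assumes "0 \<le> s" "s \<le> 1" "(v, p) = loud_map (D, F) (s, t)"
  shows "v powr m * (loud_q D F v - p\<^sup>2) = e (loud_vmax D F * s) * (1 - t\<^sup>2)"
proof -
  have v: "v = loud_vmax D F * s" "p = t * sqrt (loud_q D F v)" using assms(3) by (simp_all add: loud_map_def)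
  then have "p\<^sup>2 = t\<^sup>2 * loud_q D F v" using v_range[OF assms(1,2)] q_nonneg by (simp add: power_mult_distrib)
  then show ?thesis unfolding v(1)[symmetric] by (simp add: e_def algebra_simps)
qed

lemma loud_map_surj:
  assumes v: "0 \<le> v" "v < loud_vmax D F" and p: "p\<^sup>2 \<le> loud_q D F v"
  obtains s t where "0 \<le> s" "s < 1" "\<bar>t\<bar> \<le> 1" "(v, p) = loud_map (D, F) (s, t)"
    "s = v / loud_vmax D F" "t = p / sqrt (loud_q D F v)"
proof (rule that[of "v / loud_vmax D F" "p / sqrt (loud_q D F v)"])
  have q: "loud_q D F v > 0" by (rule q_pos[OF v])
  show "0 \<le> v / loud_vmax D F" "v / loud_vmax D F < 1" using v vmax_gt_1 by simp_all
  show "(v, p) = loud_map (D, F) (v / loud_vmax D F, p / sqrt (loud_q D F v))"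
    using q vmax_gt_1 by (simp add: loud_map_def)
  have "\<bar>p\<bar> \<le> sqrt (loud_q D F v)" using p by (metis real_sqrt_abs real_sqrt_le_mono)
  then show "\<bar>p / sqrt (loud_q D F v)\<bar> \<le> 1" using q by (simp add: abs_divide)
qed auto

definition level :: "real \<Rightarrow> (real \<times> real) set" where
  "level \<eta> = {z \<in> rect. e (loud_vmax D F * fst z) * (1 - (snd z)\<^sup>2) = \<eta>}"

lemma to_rp2_halfplane: "x < xmax \<Longrightarrow> to_rp2 (x, y) = rp_chart (1 / (1 - x), y / (1 - x))"
  using xmax by (intro to_rp2_chart) auto

lemma halfplane_point:
  assumes "0 < v" "v < loud_vmax D F"
  shows "1 - 1 / v < xmax" "to_rp2 (1 - 1 / v, p / v) = rp_chart (v, p)"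
proof -
  show "1 - 1 / v < xmax" using assms by (simp add: xmax_def frac_less2)
  from to_rp2_halfplane[OF this] show "to_rp2 (1 - 1 / v, p / v) = rp_chart (v, p)"
    using assms by simp
qed

lemma orbit_rp2:
  assumes \<eta>: "0 < \<eta>" "\<eta> < c"
  shows "to_rp2 ` orbit \<eta> = (\<lambda>z. rp_chart (loud_map (D, F) z)) ` level \<eta>"
proof (intro equalityI subsetI)
  fix r assume "r \<in> to_rp2 ` orbit \<eta>"
  then obtain x y where r: "r = to_rp2 (x, y)" and o: "x < xmax" "en (x, y) = \<eta>" by (auto simp: orbit_eq)
  define v p where "v = 1 / (1 - x)" and "p = y / (1 - x)"
  have v: "0 < v" "v < loud_vmax D F" using chart_bounds[OF o(1)] by (simp_all add: v_def)
  have E: "v powr m * (loud_q D F v - p\<^sup>2) = \<eta>" using o(2) by (simp add: en_def v_def p_def)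
  then have "p\<^sup>2 \<le> loud_q D F v" using \<eta> v by (smt (verit) mult_nonneg_nonpos powr_ge_zero)
  then obtain s t where st: "0 \<le> s" "s < 1" "\<bar>t\<bar> \<le> 1" "(v, p) = loud_map (D, F) (s, t)"
    using loud_map_surj[of v p] v by (metis less_imp_le)
  have "(s, t) \<in> level \<eta>"
    using loud_map_energy[OF st(1) _ st(4)] st E by (auto simp: level_def rect_def abs_le_iff)
  moreover have "r = rp_chart (loud_map (D, F) (s, t))"
    using r to_rp2_halfplane[OF o(1)] st(4) by (simp add: v_def p_def)
  ultimately show "r \<in> (\<lambda>z. rp_chart (loud_map (D, F) z)) ` level \<eta>" by blast
next
  fix r assume "r \<in> (\<lambda>z. rp_chart (loud_map (D, F) z)) ` level \<eta>"
  then obtain s t where st: "(s, t) \<in> level \<eta>" "r = rp_chart (loud_map (D, F) (s, t))" by auto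
  obtain v p where vp: "(v, p) = loud_map (D, F) (s, t)" by (metis surj_pair)
  have s: "0 \<le> s" "s \<le> 1" using st by (auto simp: level_def rect_def)
  have E: "e (loud_vmax D F * s) * (1 - t\<^sup>2) = \<eta>" using st by (simp add: level_def)
  have v: "v = loud_vmax D F * s" using vp by (simp add: loud_map_def)
  have "v \<noteq> 0" "v \<noteq> loud_vmax D F" using E \<eta> e_0 e_vmax unfolding v[symmetric] by auto
  then have v0: "0 < v" "v < loud_vmax D F" using v_range[OF s, folded v] by linarith+
  have "en (1 - 1 / v, p / v) = \<eta>" using en_chart[OF v0(1)] loud_map_energy[OF s vp] E by simp
  then have "(1 - 1 / v, p / v) \<in> orbit \<eta>" using halfplane_point(1)[OF v0] by (simp add: orbit_eq)
  moreover have "r = to_rp2 (1 - 1 / v, p / v)" using halfplane_point(2)[OF v0] st(2) vp by simp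
  ultimately show "r \<in> to_rp2 ` orbit \<eta>" by blast
qed

definition "R0 = {(v, p). 0 < v \<and> v < loud_vmax D F \<and> p\<^sup>2 < loud_q D F v}"

lemma q_cont: "continuous_on S (loud_q D F)"
  using q_deriv by (blast intro: DERIV_continuous_on has_field_derivative_at_within)

lemma loud_map_cont: "continuous_on S (loud_map (D, F))"
  unfolding loud_map_def fst_conv snd_conv
  by (intro continuous_intros continuous_on_compose2[OF q_cont[of UNIV]]) auto

lemma R0_image: "R0 = loud_map (D, F) ` ({0<..<1} \<times> {-1<..<1})"
proof (intro equalityI subsetI)
  fix z assume "z \<in> R0"
  then obtain v p where z: "z = (v, p)" and v: "0 < v" "v < loud_vmax D F" and p: "p\<^sup>2 < loud_q D F v"
    by (auto simp: R0_def)
  obtain s t where st: "0 \<le> s" "s < 1" "\<bar>t\<bar> \<le> 1" "(v, p) = loud_map (D, F) (s, t)"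
    using loud_map_surj[of v p] v p by (metis less_imp_le)
  have eq: "v = loud_vmax D F * s" "p = t * sqrt (loud_q D F v)" using st(4) by (simp_all add: loud_map_def)
  then have "s \<noteq> 0" using v by auto
  moreover have "\<bar>t\<bar> \<noteq> 1"
  proof
    assume "\<bar>t\<bar> = 1"
    then have "t\<^sup>2 = 1" by (metis one_power2 power2_abs)
    then have "p\<^sup>2 = loud_q D F v" using eq(2) q_pos[of v] v by (simp add: power_mult_distrib)
    then show False using p by simp
  qed
  ultimately have "(s, t) \<in> {0<..<1} \<times> {-1<..<1}" using st by (auto simp: abs_if split: if_splits)
  then show "z \<in> loud_map (D, F) ` ({0<..<1} \<times> {-1<..<1})" using st(4) z by blast
next
  fix z assume "z \<in> loud_map (D, F) ` ({0<..<1} \<times> {-1<..<1})"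
  then obtain s t where z: "z = loud_map (D, F) (s, t)" and st: "0 < s" "s < 1" "-1 < t" "t < 1" by auto
  define v where "v = loud_vmax D F * s"
  have v: "0 < v" "v < loud_vmax D F" using st vmax_gt_1 by (simp_all add: v_def)
  have q: "loud_q D F v > 0" using q_pos[of v] v by simp
  have "t\<^sup>2 < 1" using st by (simp add: abs_square_less_1)
  then have "(t * sqrt (loud_q D F v))\<^sup>2 < loud_q D F v" using q by (simp add: power_mult_distrib)
  then show "z \<in> R0" using v by (simp add: z loud_map_def R0_def v_def[symmetric])
qed

lemma open_R0: "open R0"
proof -
  have "R0 = {z. 0 < fst z \<and> fst z < loud_vmax D F \<and> (snd z)\<^sup>2 < loud_q D F (fst z)}" by (auto simp: R0_def)
  moreover have "open \<dots>"
    by (intro open_Collect_conj open_Collect_less continuous_intros continuous_on_compose2[OF q_cont[of UNIV]]) auto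
  ultimately show ?thesis by simp
qed

lemma closure_R0: "closure R0 = loud_map (D, F) ` rect"
proof
  have "compact (loud_map (D, F) ` rect)"
    unfolding rect_def by (intro compact_continuous_image loud_map_cont compact_Times compact_Icc)
  moreover have "R0 \<subseteq> loud_map (D, F) ` rect" unfolding R0_image rect_split by blast
  ultimately show "closure R0 \<subseteq> loud_map (D, F) ` rect" by (simp add: closure_minimal compact_imp_closed)
  have "rect = closure ({0<..<1} \<times> {-1<..<1})" by (simp add: closure_Times rect_def)
  then show "loud_map (D, F) ` rect \<subseteq> closure R0"
    unfolding R0_image by (metis image_closure_subset loud_map_cont closed_closure closure_subset)
qed

text \<open>\<open>loud_map\<close> is not injective, as it collapses the side \<open>s = 1\<close>
  to a point. That the image of the boundary misses \<open>R0\<close> is therefore checked directly: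
  there \<open>v\<close> is 0 or \<open>loud_vmax D F\<close>, or else
  \<open>p\<^sup>2 = loud_q D F v\<close>.\<close>

lemma loud_map_boundary: "closure R0 - R0 = loud_map (D, F) ` rect_boundary"
proof -
  have "loud_map (D, F) z \<notin> R0" if "z \<in> rect_boundary" for z
  proof
    assume R: "loud_map (D, F) z \<in> R0"
    have z: "0 \<le> fst z" "fst z \<le> 1" and zb: "fst z = 0 \<or> fst z = 1 \<or> \<bar>snd z\<bar> = 1"
      using that by (auto simp: rect_boundary_def rect_def)
    define v where "v = loud_vmax D F * fst z"
    have v: "0 < v" "v < loud_vmax D F" and p: "(snd z * sqrt (loud_q D F v))\<^sup>2 < loud_q D F v"
      using R by (auto simp: loud_map_def R0_def v_def)
    have "\<bar>snd z\<bar> = 1" using v zb by (auto simp: v_def)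
    then have "(snd z)\<^sup>2 = 1" by (metis one_power2 power2_abs)
    then show False using p q_pos[of v] v by (simp add: power_mult_distrib)
  qed
  moreover have "loud_map (D, F) ` rect = R0 \<union> loud_map (D, F) ` rect_boundary"
    unfolding R0_image rect_split image_Un ..
  ultimately show ?thesis unfolding closure_R0 by auto
qed

lemma region_rp2: "to_rp2 ` (region - {0}) = rp_chart ` (R0 - {(1, 0)})"
proof (intro equalityI subsetI)
  fix r assume "r \<in> to_rp2 ` (region - {0})"
  then obtain x y where r: "r = to_rp2 (x, y)" "(x, y) \<noteq> 0" and o: "x < xmax" "0 < en (x, y)"
    by (auto simp: region_def)
  define v p where "v = 1 / (1 - x)" and "p = y / (1 - x)"
  have v: "0 < v" "v < loud_vmax D F" using chart_bounds[OF o(1)] by (simp_all add: v_def)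
  have "p\<^sup>2 < loud_q D F v" using en_pos_iff[of x y] o xmax by (simp add: v_def p_def)
  then have "(v, p) \<in> R0" using v by (simp add: R0_def)
  moreover have "(v, p) \<noteq> (1, 0)" using r(2) v by (auto simp: v_def p_def zero_prod_def)
  ultimately show "r \<in> rp_chart ` (R0 - {(1, 0)})"
    using r(1) to_rp2_halfplane[OF o(1)] by (auto simp: v_def p_def)
next
  fix r assume "r \<in> rp_chart ` (R0 - {(1, 0)})"
  then obtain v p where r: "r = rp_chart (v, p)" "(v, p) \<noteq> (1, 0)" and vp: "0 < v" "v < loud_vmax D F" "p\<^sup>2 < loud_q D F v"
    by (auto simp: R0_def)
  have "0 < en (1 - 1 / v, p / v)" using vp by (simp add: en_chart)
  then have "(1 - 1 / v, p / v) \<in> region" using halfplane_point(1)[OF vp(1,2)] by (simp add: region_def)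
  moreover have "(1 - 1 / v, p / v) \<noteq> 0" using r(2) vp by (auto simp: zero_prod_def)
  moreover have "r = to_rp2 (1 - 1 / v, p / v)" using halfplane_point(2)[OF vp(1,2)] r by simp
  ultimately show "r \<in> to_rp2 ` (region - {0})" by blast
qed

theorem outer_boundary_loud: "outer_boundary (loud (D, F)) = (\<lambda>z. rp_chart (loud_map (D, F) z)) ` rect_boundary"
proof -
  have "bounded R0"
  proof -
    have "bounded (loud_map (D, F) ` rect)"
      unfolding rect_def by (intro compact_imp_bounded compact_continuous_image loud_map_cont compact_Times compact_Icc)
    then show ?thesis using closure_subset[of R0] unfolding closure_R0 by (rule bounded_subset)
  qed
  moreover have "(1, 0) \<in> R0" using vmax_gt_1 q_pos_at_1 by (simp add: R0_def)
  moreover have "to_rp2 0 = rp_chart (1, 0)" using to_rp2_chart[of 0 0] by (simp add: zero_prod_def)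
  ultimately have "outer_boundary (loud (D, F)) = rp_chart ` (closure R0 - R0)"
    unfolding outer_boundary_def period_annulus_loud region_rp2 using frontier_rp_chart[OF open_R0] by simp
  then show ?thesis unfolding loud_map_boundary by (simp add: image_image)
qed

lemma level_near_boundary:
  assumes \<delta>: "0 < \<delta>" "\<delta> < 1 / 2" and \<kappa>: "\<kappa> > 0" "\<And>s. \<delta> \<le> s \<Longrightarrow> s \<le> 1 - \<delta> \<Longrightarrow> \<kappa> \<le> e (loud_vmax D F * s)"
    and \<eta>: "0 < \<eta>" "\<eta> < \<kappa> * \<delta>" and z: "z \<in> level \<eta>"
  shows "fst z < \<delta> \<or> 1 - \<delta> < fst z \<or> 1 - \<delta> < \<bar>snd z\<bar>"
proof (rule ccontr)
  assume "\<not> ?thesis"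
  then have n: "\<delta> \<le> fst z" "fst z \<le> 1 - \<delta>" "\<bar>snd z\<bar> \<le> 1 - \<delta>" by auto
  have "(snd z)\<^sup>2 = \<bar>snd z\<bar> * \<bar>snd z\<bar>" by (simp add: power2_eq_square)
  also have "\<dots> \<le> (1 - \<delta>) * 1" using n \<delta> by (intro mult_mono) auto
  finally have "\<delta> \<le> 1 - (snd z)\<^sup>2" by simp
  then have "\<kappa> * \<delta> \<le> e (loud_vmax D F * fst z) * (1 - (snd z)\<^sup>2)"
    using \<kappa>(1) \<kappa>(2)[OF n(1,2)] \<delta> by (intro mult_mono) auto
  then show False using z \<eta> by (simp add: level_def)
qed

text \<open>On the rectangle the energy is a product that vanishes on the boundary and is at least
  \<open>\<kappa> * \<delta>\<close> away from it, so a level below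
  \<open>\<kappa> * \<delta>\<close> lies close to the boundary. Conversely, the segment from any
  boundary point to the midpoint \<open>(1/2, 0)\<close> passes through all energies between 0 and
  at least \<open>\<kappa>\<close>, and meets the level while it is still near the boundary.\<close>

lemma level_boundary_dist:
  assumes \<delta>: "0 < \<delta>" "\<delta> < 1 / 2" and \<kappa>: "\<kappa> > 0" "\<And>s. \<delta> \<le> s \<Longrightarrow> s \<le> 1 - \<delta> \<Longrightarrow> \<kappa> \<le> e (loud_vmax D F * s)"
    and \<eta>: "0 < \<eta>" "\<eta> < \<kappa> * \<delta>"
  shows "\<And>z. z \<in> level \<eta> \<Longrightarrow> \<exists>b\<in>rect_boundary. dist z b \<le> 4 * \<delta>"
    and "\<And>b. b \<in> rect_boundary \<Longrightarrow> \<exists>z\<in>level \<eta>. dist z b \<le> 4 * \<delta>"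
proof -
  have dle: "dist z b \<le> \<bar>fst z - fst b\<bar> + \<bar>snd z - snd b\<bar>" for z b :: "real \<times> real"
    by (simp add: dist_prod_def dist_real_def sqrt_sum_squares_le_sum_abs)
  fix z assume z: "z \<in> level \<eta>"
  then have r: "0 \<le> fst z" "fst z \<le> 1" "\<bar>snd z\<bar> \<le> 1" by (auto simp: level_def rect_def abs_le_iff)
  have "fst z < \<delta> \<or> 1 - \<delta> < fst z \<or> 1 - \<delta> < \<bar>snd z\<bar>"
    by (rule level_near_boundary[OF \<delta> \<kappa>(1) _ \<eta> z]) (rule \<kappa>(2))
  then show "\<exists>b\<in>rect_boundary. dist z b \<le> 4 * \<delta>"
  proof (elim disjE)
    assume "fst z < \<delta>"
    then show ?thesis using r \<delta> dle[of z "(0, snd z)"]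
      by (intro bexI[of _ "(0, snd z)"]) (auto simp: rect_boundary_def rect_def abs_le_iff)
  next
    assume "1 - \<delta> < fst z"
    then show ?thesis using r \<delta> dle[of z "(1, snd z)"]
      by (intro bexI[of _ "(1, snd z)"]) (auto simp: rect_boundary_def rect_def abs_le_iff)
  next
    assume t: "1 - \<delta> < \<bar>snd z\<bar>"
    have "\<bar>snd z - sgn (snd z)\<bar> \<le> \<delta>" using t r \<delta> by (auto simp: sgn_if abs_if split: if_splits)
    moreover have "\<bar>sgn (snd z)\<bar> = 1" using t \<delta> by (auto simp: sgn_if)
    ultimately have "dist z (fst z, sgn (snd z)) \<le> 4 * \<delta>" "(fst z, sgn (snd z)) \<in> rect_boundary"
      using r \<delta> dle[of z "(fst z, sgn (snd z))"]
      by (simp_all add: rect_boundary_def rect_def) (simp_all add: sgn_if split: if_splits)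
    then show ?thesis by blast
  qed
next
  have dle: "dist z b \<le> \<bar>fst z - fst b\<bar> + \<bar>snd z - snd b\<bar>" for z b :: "real \<times> real"
    by (simp add: dist_prod_def dist_real_def sqrt_sum_squares_le_sum_abs)
  fix b assume b: "b \<in> rect_boundary"
  obtain s t where st: "b = (s, t)" by (cases b)
  have r: "0 \<le> s" "s \<le> 1" "\<bar>t\<bar> \<le> 1" using b by (auto simp: rect_boundary_def rect_def st abs_le_iff)
  define \<phi> where "\<phi> \<tau> = ((1 - \<tau>) * s + \<tau> / 2, (1 - \<tau>) * t)" for \<tau> :: real
  define h where "h \<tau> = e (loud_vmax D F * fst (\<phi> \<tau>)) * (1 - (snd (\<phi> \<tau>))\<^sup>2)" for \<tau>
  have \<phi>: "\<tau> / 2 \<le> fst (\<phi> \<tau>)" "fst (\<phi> \<tau>) \<le> 1 - \<tau> / 2" "\<bar>snd (\<phi> \<tau>)\<bar> \<le> 1 - \<tau>" if "0 \<le> \<tau>" "\<tau> \<le> 1" for \<tau>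
  proof -
    have 1: "0 \<le> (1 - \<tau>) * s" using that r by simp
    have 2: "(1 - \<tau>) * s \<le> 1 - \<tau>" "(1 - \<tau>) * \<bar>t\<bar> \<le> 1 - \<tau>"
      using that r by (simp_all add: mult_left_le)
    show "\<tau> / 2 \<le> fst (\<phi> \<tau>)" using 1 by (simp add: \<phi>_def)
    show "fst (\<phi> \<tau>) \<le> 1 - \<tau> / 2" unfolding \<phi>_def fst_conv using 2(1) by linarith
    show "\<bar>snd (\<phi> \<tau>)\<bar> \<le> 1 - \<tau>" using 2(2) that by (simp add: \<phi>_def abs_mult)
  qed
  have "\<exists>\<tau>\<ge>0. \<tau> \<le> 1 \<and> h \<tau> = \<eta>"
  proof (rule IVT')
    have "s = 0 \<or> s = 1 \<or> \<bar>t\<bar> = 1" using b by (auto simp: rect_boundary_def st)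
    moreover have "\<bar>t\<bar> = 1 \<Longrightarrow> t\<^sup>2 = 1" by (metis one_power2 power2_abs)
    ultimately show "h 0 \<le> \<eta>" using \<eta> e_0 e_vmax by (auto simp: h_def \<phi>_def)
    have "\<kappa> \<le> h 1" using \<kappa>(2)[of "1 / 2"] \<delta> by (simp add: h_def \<phi>_def)
    moreover have "\<kappa> * \<delta> \<le> \<kappa> * 1" using \<kappa> \<delta> by (intro mult_left_mono) auto
    ultimately show "\<eta> \<le> h 1" using \<eta> by linarith
    show "continuous_on {0..1} h"
      unfolding h_def \<phi>_def fst_conv snd_conv
      by (intro continuous_intros continuous_on_compose2[OF e_cont])
         (use r vmax_gt_1 in \<open>auto intro!: mult_nonneg_nonneg add_nonneg_nonneg\<close>)
  qed simp
  then obtain \<tau> where \<tau>: "0 \<le> \<tau>" "\<tau> \<le> 1" "h \<tau> = \<eta>" by blast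
  have L: "\<phi> \<tau> \<in> level \<eta>"
  proof -
    have "\<phi> \<tau> \<in> rect" using \<phi>[OF \<tau>(1,2)] \<tau>(1) unfolding rect_def mem_Times_iff atLeastAtMost_iff abs_le_iff by linarith
    then show ?thesis using \<tau>(3) by (simp add: level_def h_def)
  qed
  have "fst (\<phi> \<tau>) < \<delta> \<or> 1 - \<delta> < fst (\<phi> \<tau>) \<or> 1 - \<delta> < \<bar>snd (\<phi> \<tau>)\<bar>"
    by (rule level_near_boundary[OF \<delta> \<kappa>(1) _ \<eta> L]) (rule \<kappa>(2))
  \<comment> \<open>At parameter \<open>\<tau>\<close> the segment has distance at least
    \<open>\<tau> / 2\<close> from every side, so closeness to some side bounds
    \<open>\<tau>\<close> by \<open>2 * \<delta>\<close>. Each coordinate has then moved by at most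
    \<open>\<tau>\<close>, which explains \<open>4 * \<delta>\<close>.\<close>
  then have \<tau>\<delta>: "\<tau> \<le> 2 * \<delta>" using \<phi>[OF \<tau>(1,2)] \<delta> by (elim disjE) linarith+
  have "dist (\<phi> \<tau>) b \<le> \<bar>\<tau> * (1 / 2 - s)\<bar> + \<bar>\<tau> * t\<bar>"
    using dle[of "\<phi> \<tau>" b] by (simp add: \<phi>_def st algebra_simps abs_mult[symmetric])
  also have "\<bar>\<tau> * (1 / 2 - s)\<bar> \<le> \<tau> * 1" unfolding abs_mult using \<tau> r by (intro mult_mono) (auto simp: abs_le_iff)
  also have "\<bar>\<tau> * t\<bar> \<le> \<tau> * 1" unfolding abs_mult using \<tau> r by (intro mult_mono) auto
  finally have "dist (\<phi> \<tau>) b \<le> 4 * \<delta>" using \<tau>\<delta> by linarith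
  then show "\<exists>z\<in>level \<eta>. dist z b \<le> 4 * \<delta>" using L by blast
qed

end


section \<open>Hausdorff distances, uniformly in the parameters\<close>

lemma hausdorff_dist_le:
  assumes "A \<noteq> {}" "B \<noteq> {}"
    and "\<And>a. a \<in> A \<Longrightarrow> \<exists>b\<in>B. dist a b \<le> \<epsilon>" "\<And>b. b \<in> B \<Longrightarrow> \<exists>a\<in>A. dist a b \<le> \<epsilon>"
  shows "hausdorff_dist A B \<le> \<epsilon>"
  unfolding hausdorff_dist_def
proof (intro max.boundedI cSUP_least assms(1,2))
  show "infdist a B \<le> \<epsilon>" if "a \<in> A" for a using assms(3)[OF that] by (auto intro: infdist_le2)
  show "infdist b A \<le> \<epsilon>" if "b \<in> B" for b
    using assms(4)[OF that] by (auto intro: infdist_le2 simp: dist_commute)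
qed

lemma rect_boundary_subset: "rect_boundary \<subseteq> rect" by (auto simp: rect_boundary_def)

lemma compact_rect: "compact rect" unfolding rect_def by (intro compact_Times compact_Icc)

lemma zero_in_rect_boundary: "(0, 0) \<in> rect_boundary" by (simp add: rect_boundary_def rect_def)

lemma loud_map_close:
  assumes "\<mu>0 \<in> loud_params" "\<epsilon> > 0"
  shows "\<forall>\<^sub>F \<mu> in nhds \<mu>0. \<forall>z\<in>rect. dist (loud_map \<mu> z) (loud_map \<mu>0 z) \<le> \<epsilon>"
proof -
  have "continuous_on (loud_params \<times> rect) (\<lambda>w. loud_map (fst w) (snd w))"
    using cont_loud_map[of rect] by (simp add: case_prod_unfold)
  then obtain X0 where X0: "\<mu>0 \<in> X0" "open X0"
      "\<forall>x\<in>X0 \<inter> loud_params. \<forall>t\<in>rect. dist (loud_map (fst (x, t)) (snd (x, t))) (loud_map (fst (\<mu>0, t)) (snd (\<mu>0, t))) \<le> \<epsilon>"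
    by (rule continuous_on_prod_compactE[OF _ compact_rect assms])
  then have "\<forall>\<^sub>F \<mu> in nhds \<mu>0. \<mu> \<in> X0 \<inter> loud_params"
    using assms open_loud_params by (intro eventually_nhds_in_open) auto
  then show ?thesis by eventually_elim (use X0 in auto)
qed

lemma eventually_loud_params: "\<mu>0 \<in> loud_params \<Longrightarrow> \<forall>\<^sub>F \<mu> in nhds \<mu>0. \<mu> \<in> loud_params"
  by (rule eventually_nhds_in_open[OF open_loud_params])

lemma loud_params_center: "\<mu> \<in> loud_params \<Longrightarrow> loud_center (fst \<mu>) (snd \<mu>)"
  using loud_params_iff[of "fst \<mu>" "snd \<mu>"] by simp

lemma outer_boundary_params:
  "\<mu> \<in> loud_params \<Longrightarrow> outer_boundary (loud \<mu>) = (\<lambda>z. rp_chart (loud_map \<mu> z)) ` rect_boundary"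
  using loud_center.outer_boundary_loud[OF loud_params_center] by simp

text \<open>All outer boundaries are images of the same \<open>rect_boundary\<close>, so it suffices
  to compare points with equal rectangle coordinates; the 4 is the Lipschitz constant of
  \<open>rp_chart\<close>.\<close>

lemma outer_boundary_close:
  assumes "\<mu>0 \<in> loud_params" "\<epsilon> > 0"
  shows "\<forall>\<^sub>F \<mu> in nhds \<mu>0. hausdorff_dist (outer_boundary (loud \<mu>)) (outer_boundary (loud \<mu>0)) \<le> \<epsilon>"
proof -
  have "\<epsilon> / 4 > 0" using assms by simp
  from loud_map_close[OF assms(1) this] eventually_loud_params[OF assms(1)] show ?thesis
  proof eventually_elim
    case (elim \<mu>)
    have d: "dist (rp_chart (loud_map \<mu> z)) (rp_chart (loud_map \<mu>0 z)) \<le> \<epsilon>" if "z \<in> rect_boundary" for z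
    proof -
      have "dist (loud_map \<mu> z) (loud_map \<mu>0 z) \<le> \<epsilon> / 4" using elim(1) that rect_boundary_subset by blast
      then show ?thesis using rp_chart_lipschitz[of "loud_map \<mu> z" "loud_map \<mu>0 z"] by linarith
    qed
    show ?case
      unfolding outer_boundary_params[OF elim(2)] outer_boundary_params[OF assms(1)]
    proof (rule hausdorff_dist_le)
      fix a assume "a \<in> (\<lambda>z. rp_chart (loud_map \<mu> z)) ` rect_boundary"
      then obtain z where "z \<in> rect_boundary" "a = rp_chart (loud_map \<mu> z)" by blast
      then show "\<exists>b\<in>(\<lambda>z. rp_chart (loud_map \<mu>0 z)) ` rect_boundary. dist a b \<le> \<epsilon>" using d by blast
    next
      fix b assume "b \<in> (\<lambda>z. rp_chart (loud_map \<mu>0 z)) ` rect_boundary"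
      then obtain z where "z \<in> rect_boundary" "b = rp_chart (loud_map \<mu>0 z)" by blast
      then show "\<exists>a\<in>(\<lambda>z. rp_chart (loud_map \<mu> z)) ` rect_boundary. dist a b \<le> \<epsilon>" using d by blast
    qed (use zero_in_rect_boundary in blast)+
  qed
qed

lemma orbit_close:
  assumes \<mu>0: "\<mu>0 \<in> loud_params" and \<epsilon>: "\<epsilon> > 0"
  obtains \<eta>0 where "\<eta>0 > 0"
    "\<forall>\<^sub>F \<mu> in nhds \<mu>0. \<forall>\<eta>. 0 < \<eta> \<and> \<eta> < \<eta>0 \<and> \<eta> < loud_center.c (fst \<mu>) (snd \<mu>) \<longrightarrow>
       hausdorff_dist (to_rp2 ` loud_center.orbit (fst \<mu>) (snd \<mu>) \<eta>) (outer_boundary (loud \<mu>0)) \<le> \<epsilon>"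
proof -
  interpret c0: loud_center "fst \<mu>0" "snd \<mu>0" by (rule loud_params_center[OF \<mu>0])
  have "uniformly_continuous_on rect (loud_map \<mu>0)"
    using c0.loud_map_cont by (intro compact_uniformly_continuous compact_rect) simp
  moreover have e8: "\<epsilon> / 8 > 0" using \<epsilon> by simp
  ultimately have "\<exists>d>0. \<forall>z\<in>rect. \<forall>z'\<in>rect. dist z' z < d \<longrightarrow> dist (loud_map \<mu>0 z') (loud_map \<mu>0 z) < \<epsilon> / 8"
    unfolding uniformly_continuous_on_def by blast
  then obtain d where d: "d > 0" "\<And>z z'. z \<in> rect \<Longrightarrow> z' \<in> rect \<Longrightarrow> dist z' z < d \<Longrightarrow>
      dist (loud_map \<mu>0 z') (loud_map \<mu>0 z) < \<epsilon> / 8"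
    by blast
  \<comment> \<open>\<open>level_boundary_dist\<close> gives \<open>4 * \<delta>\<close>, which must
    be below the modulus of continuity \<open>d\<close>.\<close>
  define \<delta> where "\<delta> = min (d / 5) (1 / 4)"
  have \<delta>: "0 < \<delta>" "\<delta> < 1 / 2" "4 * \<delta> < d" using d(1) by (auto simp: \<delta>_def min_def)
  define K where "K = {\<delta>..1 - \<delta>}"
  define f where "f w = loud_e (fst (fst w)) (snd (fst w)) (loud_vmax (fst (fst w)) (snd (fst w)) * snd w)"
    for w :: "(real \<times> real) \<times> real"
  have v: "continuous_on (loud_params \<times> K) (\<lambda>w. loud_vmax (fst (fst w)) (snd (fst w)) * snd w)"
    by (intro continuous_intros continuous_on_compose2[OF cont_vmax, of _ fst]) auto
  have "continuous_on (loud_params \<times> {0..}) (\<lambda>z. loud_e (fst (fst z)) (snd (fst z)) (snd z))"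
    by (rule cont_e) auto
  then have "continuous_on (loud_params \<times> K) (\<lambda>w. loud_e (fst (fst (fst w, loud_vmax (fst (fst w)) (snd (fst w)) * snd w)))
      (snd (fst (fst w, loud_vmax (fst (fst w)) (snd (fst w)) * snd w)))
      (snd (fst w, loud_vmax (fst (fst w)) (snd (fst w)) * snd w)))"
  proof (rule continuous_on_compose2)
    show "continuous_on (loud_params \<times> K) (\<lambda>w. (fst w, loud_vmax (fst (fst w)) (snd (fst w)) * snd w))"
      by (intro continuous_on_Pair v continuous_on_fst continuous_on_id)
    show "(\<lambda>w. (fst w, loud_vmax (fst (fst w)) (snd (fst w)) * snd w)) ` (loud_params \<times> K) \<subseteq> loud_params \<times> {0..}"
    proof (rule image_subsetI)
      fix w assume w: "w \<in> loud_params \<times> K"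
      then have "fst w \<in> loud_params" by auto
      from loud_center.v_range[OF loud_params_center[OF this], of "snd w"] w \<delta>
      show "(fst w, loud_vmax (fst (fst w)) (snd (fst w)) * snd w) \<in> loud_params \<times> {0..}"
        by (auto simp: K_def)
    qed
  qed
  then have fc: "continuous_on (loud_params \<times> K) f" by (simp add: f_def[abs_def])
  have fpos: "f (\<mu>0, s) > 0" if "s \<in> K" for s
  proof -
    have "0 < loud_vmax (fst \<mu>0) (snd \<mu>0) * s" "loud_vmax (fst \<mu>0) (snd \<mu>0) * s < loud_vmax (fst \<mu>0) (snd \<mu>0)"
      using that \<delta> c0.vmax_gt_1 by (auto simp: K_def)
    from c0.e_pos[OF this] show ?thesis by (simp add: f_def c0.e_loud_e)
  qed
  have cK: "compact K" by (simp add: K_def)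
  obtain \<kappa> where \<kappa>: "\<kappa> > 0" "\<forall>\<^sub>F \<mu> in nhds \<mu>0. \<forall>s\<in>K. \<kappa> \<le> f (\<mu>, s)"
    by (rule eventually_lower_bound[OF fc open_loud_params \<mu>0 cK]) (rule fpos)
  show ?thesis
  proof (rule that[of "\<kappa> * \<delta>"])
    show "\<kappa> * \<delta> > 0" using \<kappa> \<delta> by simp
    from \<kappa>(2) eventually_loud_params[OF \<mu>0] loud_map_close[OF \<mu>0 e8]
    show "\<forall>\<^sub>F \<mu> in nhds \<mu>0. \<forall>\<eta>. 0 < \<eta> \<and> \<eta> < \<kappa> * \<delta> \<and> \<eta> < loud_center.c (fst \<mu>) (snd \<mu>) \<longrightarrow>
       hausdorff_dist (to_rp2 ` loud_center.orbit (fst \<mu>) (snd \<mu>) \<eta>) (outer_boundary (loud \<mu>0)) \<le> \<epsilon>"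
    proof eventually_elim
      case (elim \<mu>)
      interpret c1: loud_center "fst \<mu>" "snd \<mu>" by (rule loud_params_center[OF elim(2)])
      have \<kappa>e: "\<kappa> \<le> c1.e (loud_vmax (fst \<mu>) (snd \<mu>) * s)" if "\<delta> \<le> s" "s \<le> 1 - \<delta>" for s
        using elim(1) that by (simp add: K_def f_def c1.e_loud_e)
      have d4: "dist (rp_chart (loud_map \<mu> z)) (rp_chart (loud_map \<mu>0 b)) \<le> \<epsilon>"
        if "z \<in> rect" "b \<in> rect" "dist z b \<le> 4 * \<delta>" for z b
      proof -
        have "dist (loud_map \<mu> z) (loud_map \<mu>0 z) \<le> \<epsilon> / 8" using elim(3) that by blast
        moreover have "dist (loud_map \<mu>0 z) (loud_map \<mu>0 b) < \<epsilon> / 8" using d(2)[OF that(2,1)] that(3) \<delta> by simp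
        ultimately have "dist (loud_map \<mu> z) (loud_map \<mu>0 b) \<le> \<epsilon> / 4"
          using dist_triangle[of "loud_map \<mu> z" "loud_map \<mu>0 b" "loud_map \<mu>0 z"] by linarith
        then show ?thesis using rp_chart_lipschitz[of "loud_map \<mu> z" "loud_map \<mu>0 b"] by linarith
      qed
      show ?case
      proof (intro allI impI)
        fix \<eta> assume \<eta>: "0 < \<eta> \<and> \<eta> < \<kappa> * \<delta> \<and> \<eta> < c1.c"
        have img: "to_rp2 ` c1.orbit \<eta> = (\<lambda>z. rp_chart (loud_map \<mu> z)) ` c1.level \<eta>"
          using c1.orbit_rp2[of \<eta>] \<eta> by simp
        have sub: "c1.level \<eta> \<subseteq> rect" by (auto simp: c1.level_def)
        have n1: "\<exists>b\<in>rect_boundary. dist z b \<le> 4 * \<delta>" if "z \<in> c1.level \<eta>" for z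
          by (rule c1.level_boundary_dist(1)[OF \<delta>(1,2) \<kappa>(1) \<kappa>e _ _ that]) (use \<eta> in auto)
        have n2: "\<exists>z\<in>c1.level \<eta>. dist z b \<le> 4 * \<delta>" if "b \<in> rect_boundary" for b
          by (rule c1.level_boundary_dist(2)[OF \<delta>(1,2) \<kappa>(1) \<kappa>e _ _ that]) (use \<eta> in auto)
        show "hausdorff_dist (to_rp2 ` c1.orbit \<eta>) (outer_boundary (loud \<mu>0)) \<le> \<epsilon>"
          unfolding img outer_boundary_params[OF \<mu>0]
        proof (rule hausdorff_dist_le)
          fix a assume "a \<in> (\<lambda>z. rp_chart (loud_map \<mu> z)) ` c1.level \<eta>"
          then obtain z where z: "z \<in> c1.level \<eta>" "a = rp_chart (loud_map \<mu> z)" by blast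
          from n1[OF z(1)] obtain b where "b \<in> rect_boundary" "dist z b \<le> 4 * \<delta>" by blast
          then show "\<exists>b\<in>(\<lambda>z. rp_chart (loud_map \<mu>0 z)) ` rect_boundary. dist a b \<le> \<epsilon>"
            using d4[of z b] z sub rect_boundary_subset by blast
        next
          fix r assume "r \<in> (\<lambda>z. rp_chart (loud_map \<mu>0 z)) ` rect_boundary"
          then obtain b where b: "b \<in> rect_boundary" "r = rp_chart (loud_map \<mu>0 b)" by blast
          from n2[OF b(1)] obtain z where "z \<in> c1.level \<eta>" "dist z b \<le> 4 * \<delta>" by blast
          then show "\<exists>a\<in>(\<lambda>z. rp_chart (loud_map \<mu> z)) ` c1.level \<eta>. dist a r \<le> \<epsilon>"
            using d4[of z b] b sub rect_boundary_subset by blast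
        next
          show "(\<lambda>z. rp_chart (loud_map \<mu> z)) ` c1.level \<eta> \<noteq> {}"
            using n2[OF zero_in_rect_boundary] by blast
        qed (use zero_in_rect_boundary in blast)
      qed
    qed
  qed
qed

text \<open>A single boundary point suffices. The chart point \<open>(0, 0)\<close> lies on the line
  at infinity and belongs to the outer boundary, so an orbit close to the outer boundary has a point
  with small \<open>v\<close>, and its energy is at most \<open>e v\<close>.\<close>

lemma energy_small_near_boundary:
  assumes \<mu>0: "\<mu>0 \<in> loud_params" and \<eta>0: "\<eta>0 > 0"
  obtains \<epsilon> where "\<epsilon> > 0"
    "\<forall>\<^sub>F \<mu> in nhds \<mu>0. \<forall>\<eta>. 0 < \<eta> \<and> \<eta> < loud_center.c (fst \<mu>) (snd \<mu>) \<and>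
       hausdorff_dist (to_rp2 ` loud_center.orbit (fst \<mu>) (snd \<mu>) \<eta>) (outer_boundary (loud \<mu>0)) \<le> \<epsilon> \<longrightarrow>
       \<eta> \<le> \<eta>0"
proof -
  interpret c0: loud_center "fst \<mu>0" "snd \<mu>0" by (rule loud_params_center[OF \<mu>0])
  have "\<exists>d>0. \<forall>x'\<in>{0..}. dist x' 0 < d \<longrightarrow> dist (c0.e x') (c0.e 0) < \<eta>0 / 2"
    using c0.e_cont \<eta>0 unfolding continuous_on_iff by (metis atLeast_iff half_gt_zero order_refl)
  then obtain d where d: "d > 0" "\<And>x. 0 \<le> x \<Longrightarrow> x < d \<Longrightarrow> \<bar>c0.e x\<bar> < \<eta>0 / 2"
    by (auto simp: c0.e_0)
  define \<delta> where "\<delta> = min (d / 2) (1 / 2)"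
  have \<delta>: "0 < \<delta>" "\<delta> < 1" "\<delta> < d" using d(1) by (auto simp: \<delta>_def)
  have fc: "continuous_on (loud_params \<times> {\<delta>}) (\<lambda>z. loud_e (fst (fst z)) (snd (fst z)) (snd z))"
    by (rule cont_e) (use \<delta> in auto)
  have "\<eta>0 / 2 > 0" using \<eta>0 by simp
  from eventually_close[OF fc open_loud_params \<mu>0 _ this]
  have ev: "\<forall>\<^sub>F \<mu> in nhds \<mu>0. \<bar>loud_e (fst \<mu>) (snd \<mu>) \<delta> - loud_e (fst \<mu>0) (snd \<mu>0) \<delta>\<bar> \<le> \<eta>0 / 2" by simp
  have "open (rp_chart ` {z. fst z < \<delta>})"
    by (intro rp_chart_open_map open_Collect_less continuous_intros)
  moreover have "rp_chart (0, 0) \<in> rp_chart ` {z. fst z < \<delta>}" using \<delta> by auto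
  ultimately obtain \<epsilon> where \<epsilon>: "\<epsilon> > 0"
    "\<And>s. dist s (rp_chart (0, 0)) < \<epsilon> \<Longrightarrow> s \<in> rp_chart ` {z. fst z < \<delta>}"
    unfolding open_dist by blast
  have b0: "rp_chart (0, 0) \<in> outer_boundary (loud \<mu>0)"
    unfolding outer_boundary_params[OF \<mu>0]
    by (rule image_eqI[OF _ zero_in_rect_boundary]) (simp add: loud_map_def)
  show ?thesis
  proof (rule that[of "\<epsilon> / 2"])
    show "\<epsilon> / 2 > 0" using \<epsilon> by simp
    from ev eventually_loud_params[OF \<mu>0]
    show "\<forall>\<^sub>F \<mu> in nhds \<mu>0. \<forall>\<eta>. 0 < \<eta> \<and> \<eta> < loud_center.c (fst \<mu>) (snd \<mu>) \<and>
       hausdorff_dist (to_rp2 ` loud_center.orbit (fst \<mu>) (snd \<mu>) \<eta>) (outer_boundary (loud \<mu>0)) \<le> \<epsilon> / 2 \<longrightarrow>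
       \<eta> \<le> \<eta>0"
    proof (eventually_elim, intro allI impI)
      fix \<mu> \<eta>
      assume e\<delta>: "\<bar>loud_e (fst \<mu>) (snd \<mu>) \<delta> - loud_e (fst \<mu>0) (snd \<mu>0) \<delta>\<bar> \<le> \<eta>0 / 2"
        and \<mu>: "\<mu> \<in> loud_params"
      interpret c1: loud_center "fst \<mu>" "snd \<mu>" by (rule loud_params_center[OF \<mu>])
      assume h: "0 < \<eta> \<and> \<eta> < c1.c \<and> hausdorff_dist (to_rp2 ` c1.orbit \<eta>) (outer_boundary (loud \<mu>0)) \<le> \<epsilon> / 2"
      define A where "A = to_rp2 ` c1.orbit \<eta>"
      have "c1.orbit \<eta> \<noteq> {}" using c1.orbit_periodic[of \<eta>] h by (auto simp: periodic_orbit_def is_period_def)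
      then have A: "A \<noteq> {}" by (simp add: A_def)
      then obtain a0 where a0: "a0 \<in> A" by blast
      \<comment> \<open>Without this bound the supremum in \<open>hausdorff_dist\<close> would say
        nothing about individual points.\<close>
      have "bdd_above ((\<lambda>b. infdist b A) ` outer_boundary (loud \<mu>0))"
        by (rule bdd_aboveI2[of _ _ 2]) (rule infdist_le2[OF a0 dist_rp2_le_2])
      then have "infdist (rp_chart (0, 0)) A \<le> (SUP b\<in>outer_boundary (loud \<mu>0). infdist b A)"
        by (rule cSUP_upper[OF b0])
      also have "\<dots> \<le> \<epsilon> / 2" using h unfolding hausdorff_dist_def A_def max.bounded_iff by blast
      also have "\<dots> < \<epsilon>" using \<epsilon> by simp
      finally have "(INF a\<in>A. dist (rp_chart (0, 0)) a) < \<epsilon>" using A by (simp add: infdist_def)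
      then obtain a where a: "a \<in> A" "dist (rp_chart (0, 0)) a < \<epsilon>"
        using cINF_less_iff[OF A, of "dist (rp_chart (0, 0))"] by (metis bdd_belowI2 zero_le_dist)
      from a(1) obtain x y where o: "a = to_rp2 (x, y)" "x < c1.xmax" "c1.en (x, y) = \<eta>"
        by (auto simp: A_def c1.orbit_eq)
      have "rp_chart (1 / (1 - x), y / (1 - x)) \<in> rp_chart ` {z. fst z < \<delta>}"
        using \<epsilon>(2)[of a] a(2) o(1) c1.to_rp2_halfplane[OF o(2)] by (simp add: dist_commute)
      then have v\<delta>: "1 / (1 - x) < \<delta>" by (auto dest!: rp_chart_inj)
      have "\<eta> \<le> c1.e (1 / (1 - x))" using c1.en_le_e[of x y] o(2,3) c1.xmax by simp
      also have "\<dots> < c1.e \<delta>" using c1.e_strict_mono[OF _ v\<delta>] \<delta> o(2) c1.xmax by simp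
      also have "\<dots> \<le> \<eta>0" 
      proof -
        have "\<bar>loud_e (fst \<mu>0) (snd \<mu>0) \<delta>\<bar> < \<eta>0 / 2" using d(2)[of \<delta>] \<delta> by (simp add: c0.e_loud_e)
        then show ?thesis using e\<delta> unfolding c1.e_loud_e by linarith
      qed
      finally show "\<eta> \<le> \<eta>0" by simp
    qed
  qed
qed

section \<open>Criticality\<close>

lemma eventually_nhds_norm:
  fixes x :: "'a::real_normed_vector"
  shows "(\<forall>\<^sub>F y in nhds x. P y) \<longleftrightarrow> (\<exists>\<delta>>0. \<forall>y. norm (y - x) \<le> \<delta> \<longrightarrow> P y)"
proof
  assume "\<forall>\<^sub>F y in nhds x. P y"
  then obtain d where "d > 0" "\<And>y. dist y x < d \<Longrightarrow> P y" by (auto simp: eventually_nhds_metric)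
  then have "d / 2 > 0 \<and> (\<forall>y. norm (y - x) \<le> d / 2 \<longrightarrow> P y)" by (simp add: dist_norm)
  then show "\<exists>\<delta>>0. \<forall>y. norm (y - x) \<le> \<delta> \<longrightarrow> P y" by blast
next
  assume "\<exists>\<delta>>0. \<forall>y. norm (y - x) \<le> \<delta> \<longrightarrow> P y"
  then show "\<forall>\<^sub>F y in nhds x. P y" by (auto simp: eventually_nhds_metric dist_norm)
qed

lemma ecard_le_1: "(\<And>a b. a \<in> A \<Longrightarrow> b \<in> A \<Longrightarrow> a = b) \<Longrightarrow> ecard A \<le> 1"
proof -
  assume *: "\<And>a b. a \<in> A \<Longrightarrow> b \<in> A \<Longrightarrow> a = b"
  consider "A = {}" | a where "A = {a}" using * by blast
  then show ?thesis by cases (auto simp: ecard_def zero_enat_def one_enat_def)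
qed

lemma ecard_ge_1: "a \<in> A \<Longrightarrow> 1 \<le> ecard A"
  by (auto simp: ecard_def one_enat_def card_gt_0_iff Suc_le_eq)

theorem theorem2:
  fixes D :: real
  assumes "D \<in> {-2<..<0} - {-1/2}"
  shows "outer_boundary_continuous_at loud_params loud (D, 2) \<and>
         criticality loud_params loud (D, 2) = 1"
proof
  have D: "- 2 < D" "D < 0" "D \<noteq> - 1 / 2" using assms by auto
  have \<mu>0: "(D, 2) \<in> loud_params" using D by (simp add: loud_params_def)
  show "outer_boundary_continuous_at loud_params loud (D, 2)"
    unfolding outer_boundary_continuous_at_def
    using outer_boundary_close[OF \<mu>0] unfolding eventually_nhds_norm by blast
  define S where "S \<epsilon> \<mu> = {\<gamma>. critical_periodic_orbit (loud \<mu>) \<gamma> \<and>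
    hausdorff_dist (to_rp2 ` \<gamma>) (outer_boundary (loud (D, 2))) \<le> \<epsilon>}" for \<epsilon> \<mu>
  have bound: "criticality_bound loud_params loud (D, 2) \<delta> \<epsilon> =
    (SUP \<mu>\<in>{\<mu>\<in>loud_params. norm (\<mu> - (D, 2)) \<le> \<delta>}. ecard (S \<epsilon> \<mu>))" for \<delta> \<epsilon>
    by (simp add: criticality_bound_def S_def)
  show "criticality loud_params loud (D, 2) = 1"
  proof (rule antisym)
    obtain \<eta>0 where \<eta>0: "\<eta>0 > 0" and unique:
      "\<forall>\<^sub>F \<mu> in nhds (D, 2). \<mu> \<in> loud_params \<and> (\<forall>\<eta>1 \<eta>2. 0 < \<eta>1 \<and> \<eta>1 < \<eta>2 \<and> \<eta>2 \<le> \<eta>0 \<longrightarrow>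
         \<not> (critical_periodic_orbit (loud \<mu>) (loud_center.orbit (fst \<mu>) (snd \<mu>) \<eta>1) \<and>
           critical_periodic_orbit (loud \<mu>) (loud_center.orbit (fst \<mu>) (snd \<mu>) \<eta>2)))"
      by (rule critical_orbit_unique_near_boundary[OF D])
    obtain \<epsilon> where \<epsilon>: "\<epsilon> > 0" and small:
      "\<forall>\<^sub>F \<mu> in nhds (D, 2). \<forall>\<eta>. 0 < \<eta> \<and> \<eta> < loud_center.c (fst \<mu>) (snd \<mu>) \<and>
         hausdorff_dist (to_rp2 ` loud_center.orbit (fst \<mu>) (snd \<mu>) \<eta>) (outer_boundary (loud (D, 2))) \<le> \<epsilon> \<longrightarrow>
         \<eta> \<le> \<eta>0"
      by (rule energy_small_near_boundary[OF \<mu>0 \<eta>0])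
    \<comment> \<open>Closeness to the outer boundary forces energies at most
      \<open>\<eta>0\<close>, where at most one level is critical.\<close>
    from unique small have "\<forall>\<^sub>F \<mu> in nhds (D, 2). ecard (S \<epsilon> \<mu>) \<le> 1"
    proof eventually_elim
      case (elim \<mu>)
      interpret c1: loud_center "fst \<mu>" "snd \<mu>" using elim(1) by (simp add: loud_params_center)
      have \<gamma>: "\<exists>\<eta>. 0 < \<eta> \<and> \<eta> \<le> \<eta>0 \<and> \<gamma> = c1.orbit \<eta>" if "\<gamma> \<in> S \<epsilon> \<mu>" for \<gamma>
      proof -
        have "critical_periodic_orbit (loud (fst \<mu>, snd \<mu>)) \<gamma>" using that by (simp add: S_def)
        then obtain \<eta> where "0 < \<eta>" "\<eta> < c1.c" "\<gamma> = c1.orbit \<eta>" by (rule c1.critical_orbit_energy)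
        then show ?thesis using elim(2) that by (auto simp: S_def)
      qed
      show ?case
      proof (rule ecard_le_1)
        fix \<gamma>1 \<gamma>2 assume *: "\<gamma>1 \<in> S \<epsilon> \<mu>" "\<gamma>2 \<in> S \<epsilon> \<mu>"
        obtain \<eta>1 \<eta>2 where h: "0 < \<eta>1" "\<eta>1 \<le> \<eta>0" "\<gamma>1 = c1.orbit \<eta>1" "0 < \<eta>2" "\<eta>2 \<le> \<eta>0" "\<gamma>2 = c1.orbit \<eta>2"
          using \<gamma>[OF *(1)] \<gamma>[OF *(2)] by blast
        have "critical_periodic_orbit (loud \<mu>) \<gamma>1" "critical_periodic_orbit (loud \<mu>) \<gamma>2"
          using * by (simp_all add: S_def)
        then have "\<not> \<eta>1 < \<eta>2" "\<not> \<eta>2 < \<eta>1" using elim(1) h by blast+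
        then show "\<gamma>1 = \<gamma>2" using h by simp
      qed
    qed
    then obtain \<delta> where \<delta>: "\<delta> > 0" "\<And>\<mu>. norm (\<mu> - (D, 2)) \<le> \<delta> \<Longrightarrow> ecard (S \<epsilon> \<mu>) \<le> 1"
      unfolding eventually_nhds_norm by blast
    have "criticality_bound loud_params loud (D, 2) \<delta> \<epsilon> \<le> 1"
      unfolding bound by (rule SUP_least) (use \<delta>(2) in blast)
    then show "criticality loud_params loud (D, 2) \<le> 1"
      unfolding criticality_def using \<delta>(1) \<epsilon>
      by (intro INF_lower2[where i=\<delta>] INF_lower2[where i=\<epsilon>]) auto
    \<comment> \<open>\<open>close\<close> is passed on as part of the predicate \<open>P\<close>,
      so the critical orbit that is found also satisfies the distance condition of
      \<open>S\<close>.\<close>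
    have "1 \<le> criticality_bound loud_params loud (D, 2) \<delta> \<epsilon>" if \<delta>: "\<delta> > 0" and \<epsilon>: "\<epsilon> > 0" for \<delta> \<epsilon>
    proof -
      obtain \<eta>s where \<eta>s: "\<eta>s > 0" and close:
        "\<forall>\<^sub>F \<mu> in nhds (D, 2). \<forall>\<eta>. 0 < \<eta> \<and> \<eta> < \<eta>s \<and> \<eta> < loud_center.c (fst \<mu>) (snd \<mu>) \<longrightarrow>
           hausdorff_dist (to_rp2 ` loud_center.orbit (fst \<mu>) (snd \<mu>) \<eta>) (outer_boundary (loud (D, 2))) \<le> \<epsilon>"
        by (rule orbit_close[OF \<mu>0 \<epsilon>])
      have "\<forall>\<^sub>F \<mu> in nhds (D, 2). norm (\<mu> - (D, 2)) \<le> \<delta>"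
        unfolding eventually_nhds_norm using \<delta> by blast
      note nb = eventually_conj[OF this close]
      obtain \<mu> \<eta> where \<mu>: "\<mu> \<in> loud_params" "norm (\<mu> - (D, 2)) \<le> \<delta> \<and>
          (\<forall>\<eta>. 0 < \<eta> \<and> \<eta> < \<eta>s \<and> \<eta> < loud_center.c (fst \<mu>) (snd \<mu>) \<longrightarrow>
           hausdorff_dist (to_rp2 ` loud_center.orbit (fst \<mu>) (snd \<mu>) \<eta>) (outer_boundary (loud (D, 2))) \<le> \<epsilon>)"
        and \<eta>: "0 < \<eta>" "\<eta> < \<eta>s" "\<eta> < loud_center.c (fst \<mu>) (snd \<mu>)"
        and crit: "critical_periodic_orbit (loud \<mu>) (loud_center.orbit (fst \<mu>) (snd \<mu>) \<eta>)"
        by (rule critical_orbit_exists_near_boundary[OF D \<eta>s nb])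
      have "loud_center.orbit (fst \<mu>) (snd \<mu>) \<eta> \<in> S \<epsilon> \<mu>" using \<mu>(2) \<eta> crit by (simp add: S_def)
      then have "1 \<le> ecard (S \<epsilon> \<mu>)" by (rule ecard_ge_1)
      then show ?thesis unfolding bound using \<mu> by (intro SUP_upper2[of \<mu>]) auto
    qed
    then show "1 \<le> criticality loud_params loud (D, 2)"
      unfolding criticality_def by (intro INF_greatest) auto
  qed
qed

end
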